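(* There exists $\varepsilon>0$ such that for every $u_0\in B\mathcal X$ with $\|u_0\|_{B\mathcal X}<\varepsilon$ there is a global in time (mild) solution $u\in\mathscr X$ of the Debye system with initial datum $u_0$, i.e. a function $u\in\mathscr X$ satisfying $$u(t)=S(t)u_0+\int_0^t S(t-\tau)\,\nabla\cdot\big(u\nabla\phi_u\big)(\tau)\,d\tau\qquad\text{for all }t>0.$$ This solution is unique among all functions $u\in\mathscr X$ satisfying $\sup_{t>0}t^{1/4}\|u(t)\|_{4/3}<2\varepsilon$.
   Context: $\|\cdot\|_p$ is the norm of $L^p(\mathbb R^2)$. $S(t)$ is the heat semigroup on $\mathbb R^2$: $S(t)f=G(\cdot,t)*f$ with $G(x,t)=\frac1{4\pi t}e^{-|x|^2/(4t)}$, defined for tempered distributions $f\in\mathscr S'(\mathbb R^2)$. The Debye system is $u_t=\Delta u+\nabla\cdot(u\nabla\phi_u)$, $\phi_u=-E_2*u$ in $\mathbb R^2$, $u(x,0)=u_0(x)$, with $E_2(z)=\frac1{2\pi}\log|z|$; thus $\nabla\phi_u=-(\nabla E_2)*u$, i.e. $\nabla\phi_u(x)=-\frac1{2\pi}\int_{\mathbb R^2}\frac{x-y}{|x-y|^2}u(y)\,dy$. The product $u\nabla\phi_u$ is in $L^1(\mathbb R^2)$ for $u\in L^{4/3}(\mathbb R^2)$ and the divergence is taken in the sense of distributions. $B\mathcal X=\{u\in\mathscr S'(\mathbb R^2):\ \|u\|_{B\mathcal X}:=\sup_{t>0}t^{1/4}\|S(t)u\|_{4/3}<\infty\}$. For given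 $u_0$, $\mathscr X$ is the set of measurable functions $f:[0,\infty)\to B\mathcal X$ belonging to $L^\infty([0,\infty);B\mathcal X)$, attaining the initial datum $u_0$ as $t\to0^+$ in the sense of tempered distributions (i.e. $\langle f(t),\psi\rangle\to\langle u_0,\psi\rangle$ for all $\psi\in\mathscr S(\mathbb R^2)$), and such that $f(t)\in L^{4/3}(\mathbb R^2)$ for $t>0$ with $\sup_{t>0}t^{1/4}\|f(t)\|_{4/3}<\infty$; it is equipped with $\|f\|_{\mathscr X}=\max\{\sup_{t>0}\|f(t)\|_{B\mathcal X},\ \sup_{t>0}t^{1/4}\|f(t)\|_{4/3}\}$. *)

theory Defs
  imports "HOL-Analysis.Analysis"
begin

subsection \<open>Schwartz functions and tempered distributions on the plane\<close>

definition partial :: "2 \<Rightarrow> (real^2 \<Rightarrow> real) \<Rightarrow> real^2 \<Rightarrow> real" where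
  "partial i f x = frechet_derivative f (at x) (axis i 1)"

definition grad :: "(real^2 \<Rightarrow> real) \<Rightarrow> real^2 \<Rightarrow> real^2" where
  "grad f x = (\<chi> i. partial i f x)"

text \<open>A list of coordinate directions plays the role of a multi-index.\<close>

definition partials :: "2 list \<Rightarrow> (real^2 \<Rightarrow> real) \<Rightarrow> real^2 \<Rightarrow> real" where
  "partials is f = foldr partial is f"

text \<open>Differentiability of all iterated partial derivatives makes each of them continuous, so the
  first conjunct says that \<open>f\<close> is of class \<open>C\<^sup>\<infinity>\<close>.\<close>

definition schwartz :: "(real^2 \<Rightarrow> real) set" where
  "schwartz = {f. (\<forall>is. partials is f differentiable_on UNIV) \<and>
     (\<forall>is k. \<exists>C. \<forall>x. (1 + norm x) ^ k * \<bar>partials is f x\<bar> \<le> C)}"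

definition schwartz_seminorm :: "nat \<Rightarrow> 2 list \<Rightarrow> (real^2 \<Rightarrow> real) \<Rightarrow> real" where
  "schwartz_seminorm k is f = (SUP x. (1 + norm x) ^ k * \<bar>partials is f x\<bar>)"

text \<open>A distribution is represented by its values on test functions, set to \<open>0\<close> outside the
  Schwartz space, so that equality of distributions is equality of functions.\<close>

type_synonym distr = "(real^2 \<Rightarrow> real) \<Rightarrow> real"

definition tempered :: "distr set" where
  "tempered = {T.
     (\<forall>\<psi>. \<psi> \<notin> schwartz \<longrightarrow> T \<psi> = 0) \<and>
     (\<forall>\<psi>\<in>schwartz. \<forall>\<eta>\<in>schwartz. T (\<lambda>x. \<psi> x + \<eta> x) = T \<psi> + T \<eta>) \<and>
     (\<forall>\<psi>\<in>schwartz. \<forall>c. T (\<lambda>x. c * \<psi> x) = c * T \<psi>) \<and>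
     (\<exists>C N. \<forall>\<psi>\<in>schwartz.
        \<bar>T \<psi>\<bar> \<le> C * (\<Sum>is | length is \<le> N. schwartz_seminorm N is \<psi>))}"

definition represents :: "(real^2 \<Rightarrow> real) \<Rightarrow> distr \<Rightarrow> bool" where
  "represents g T \<longleftrightarrow> g \<in> borel_measurable borel \<and>
     (\<forall>\<psi>\<in>schwartz. integrable lborel (\<lambda>x. g x * \<psi> x) \<and> T \<psi> = (LINT x|lborel. g x * \<psi> x))"

text \<open>The function representing a regular distribution; it is determined only almost everywhere,
  and it is used below only where the choice of the version does not matter.\<close>

definition density_of :: "distr \<Rightarrow> real^2 \<Rightarrow> real" where
  "density_of T = (SOME g. represents g T)"

definition Lp_norm_fun :: "real \<Rightarrow> (real^2 \<Rightarrow> real) \<Rightarrow> ennreal" where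
  "Lp_norm_fun p g =
     (if integrable lborel (\<lambda>x. \<bar>g x\<bar> powr p)
      then ennreal ((LINT x|lborel. \<bar>g x\<bar> powr p) powr (1 / p)) else \<infinity>)"

definition Lp_norm :: "real \<Rightarrow> distr \<Rightarrow> ennreal" where
  "Lp_norm p T = (if \<exists>g. represents g T then Lp_norm_fun p (density_of T) else \<infinity>)"

subsection \<open>The heat semigroup and the spaces\<close>

definition heat_kernel :: "real \<Rightarrow> real^2 \<Rightarrow> real" where
  "heat_kernel t x = exp (- (norm x)\<^sup>2 / (4 * t)) / (4 * pi * t)"

text \<open>The convolution \<open>G(\<cdot>,t) * T\<close>, in the sense that \<open>\<langle>G * T, \<psi>\<rangle> = \<langle>T, y \<mapsto> \<integral> G(x - y,t) \<psi>(x) dx\<rangle>\<close>.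
  Only \<open>t > 0\<close> is meaningful.\<close>

definition heat :: "real \<Rightarrow> distr \<Rightarrow> distr" where
  "heat t T = (\<lambda>\<psi>. if \<psi> \<in> schwartz
     then T (\<lambda>y. LINT x|lborel. heat_kernel t (x - y) * \<psi> x) else 0)"

definition BX_norm :: "distr \<Rightarrow> ennreal" where
  "BX_norm T = (SUP t\<in>{0<..}. ennreal (t powr (1/4)) * Lp_norm (4/3) (heat t T))"

definition BX :: "distr set" where
  "BX = {T \<in> tempered. BX_norm T < \<infinity>}"

text \<open>Strong (Bochner) measurability of \<open>f : [0,\<infinity>) \<rightarrow> BX\<close>: almost everywhere a limit, in the norm
  of \<open>BX\<close>, of simple functions. The values of \<open>f\<close> at negative times are irrelevant.\<close>

definition BX_measurable :: "(real \<Rightarrow> distr) \<Rightarrow> bool" where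
  "BX_measurable f \<longleftrightarrow> (\<exists>s :: nat \<Rightarrow> real \<Rightarrow> distr.
     (\<forall>n. simple_function (lebesgue_on {0..}) (s n) \<and> (\<forall>t\<ge>0. s n t \<in> BX)) \<and>
     (AE t in lebesgue_on {0..}. (\<lambda>n. BX_norm (f t - s n t)) \<longlonglongrightarrow> 0))"

definition weighted_norm :: "(real \<Rightarrow> distr) \<Rightarrow> ennreal" where
  "weighted_norm f = (SUP t\<in>{0<..}. ennreal (t powr (1/4)) * Lp_norm (4/3) (f t))"

definition X_norm :: "(real \<Rightarrow> distr) \<Rightarrow> ennreal" where
  "X_norm f = max (SUP t\<in>{0<..}. BX_norm (f t)) (weighted_norm f)"

text \<open>Finiteness of \<open>X_norm\<close> contains both the boundedness in \<open>BX\<close> and the weighted bound in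
  \<open>L\<^sup>4\<^sup>/\<^sup>3\<close>. The value \<open>f 0\<close> is any element of \<open>BX\<close>; the initial datum is attained as a limit.\<close>

definition X_space :: "distr \<Rightarrow> (real \<Rightarrow> distr) set" where
  "X_space u0 = {f.
     (\<forall>t\<ge>0. f t \<in> BX) \<and> BX_measurable f \<and>
     (\<forall>\<psi>\<in>schwartz. ((\<lambda>t. f t \<psi>) \<longlongrightarrow> u0 \<psi>) (at_right 0)) \<and>
     (\<forall>t>0. Lp_norm (4/3) (f t) < \<infinity>) \<and> X_norm f < \<infinity>}"

subsection \<open>The Debye system\<close>

text \<open>The field \<open>\<nabla>\<phi>\<close> generated by the density \<open>g\<close>; the integral converges absolutely for almost every
  \<open>x\<close> when \<open>g\<close> is in \<open>L\<^sup>4\<^sup>/\<^sup>3\<close>.\<close>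

definition grad_phi :: "(real^2 \<Rightarrow> real) \<Rightarrow> real^2 \<Rightarrow> real^2" where
  "grad_phi g x =
     - (1 / (2 * pi)) *\<^sub>R (LINT y|lborel. (g y / (norm (x - y))\<^sup>2) *\<^sub>R (x - y))"

definition div_distr :: "(real^2 \<Rightarrow> real^2) \<Rightarrow> distr" where
  "div_distr F = (\<lambda>\<psi>. if \<psi> \<in> schwartz then - (LINT x|lborel. F x \<bullet> grad \<psi> x) else 0)"

definition debye_nonlin :: "distr \<Rightarrow> distr" where
  "debye_nonlin T = div_distr (\<lambda>x. density_of T x *\<^sub>R grad_phi (density_of T) x)"

text \<open>The Duhamel integral is a weak integral of a distribution-valued function, i.e. it is
  evaluated after pairing with test functions.\<close>

definition mild_solution :: "distr \<Rightarrow> (real \<Rightarrow> distr) \<Rightarrow> bool" where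
  "mild_solution u0 u \<longleftrightarrow> (\<forall>t>0. \<forall>\<psi>\<in>schwartz.
     set_integrable lebesgue {0<..<t} (\<lambda>\<tau>. heat (t - \<tau>) (debye_nonlin (u \<tau>)) \<psi>) \<and>
     u t \<psi> = heat t u0 \<psi>
       + (LINT \<tau>:{0<..<t}|lebesgue. heat (t - \<tau>) (debye_nonlin (u \<tau>)) \<psi>))"

end

theory Submission
  imports Defs "HOL-Probability.Probability" "HOL-Real_Asymp.Real_Asymp"
begin

text \<open>
  The solution is the fixed point of \<open>u \<mapsto> S(t) u\<^sub>0 + \<integral> S(t - \<tau>) \<nabla>\<cdot>(u \<nabla>\<phi>\<^sub>u) d\<tau>\<close> in the weighted norm
  \<open>sup t powr (1/4) * \<parallel>u t\<parallel>\<^bsub>4/3\<^esub>\<close>. The diagonal Hardy-Littlewood-Sobolev inequality bounds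
  \<open>\<parallel>u \<nabla>\<phi>\<^sub>v\<parallel>\<^sub>1\<close> by \<open>\<parallel>u\<parallel>\<^bsub>4/3\<^esub> \<parallel>v\<parallel>\<^bsub>4/3\<^esub>\<close>, and \<open>\<parallel>S(s) \<nabla>\<cdot>F\<parallel>\<^bsub>4/3\<^esub> \<le> C s powr (-3/4) * \<parallel>F\<parallel>\<^sub>1\<close>, so that the
  quadratic term is controlled by the Beta integral of \<open>(t - \<tau>) powr (-3/4) * \<tau> powr (-1/2)\<close>.

  All norm bounds are obtained by duality from bounds on pairings with Schwartz functions: a function
  \<open>h\<close> with \<open>\<bar>\<integral> h \<psi>\<bar> \<le> A \<parallel>\<psi>\<parallel>\<^sub>4\<close> for all such \<open>\<psi>\<close> satisfies \<open>\<parallel>h\<parallel>\<^bsub>4/3\<^esub> \<le> A\<close>. For \<open>A = 0\<close> this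
  gives the uniqueness of densities. Uniqueness of solutions uses pairings only, since a competitor
  \<open>v\<close> need not be jointly measurable in time and space; the Picard iterates are, and this allows
  the Duhamel integral to be represented by a function.
\<close>

subsection \<open>The heat kernel\<close>

text \<open>The exponents are forced by scaling: two factors of size t^(-1/4) give an L^1 field of
  size tau^(-1/2), and integration against (t - tau)^(-3/4) returns exactly t^(-1/4). No power of t
  is left over, so smallness of the datum, not of time, drives the contraction. With kappa =
  \<open>contraction_const\<close> the quadratic term is Lipschitz with constant 2 kappa A on the
  ball of radius A; the choice 8 kappa eps = 1 makes this 1/2 on the ball of radius 2 eps in which
  uniqueness is claimed. Two demands of the statement shape the rest. Densities exist separately at
  each time and only up to null sets, so a jointly measurable density of the linear orbit has to be
  built before Fubini applies to the Duhamel term. And \<open>X_space\<close> asks for strong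
  measurability in the norm of \<open>BX\<close>; it comes from a modulus of right continuity at
  each t > 0, and this is why time increments of the heat kernel are estimated at all. The datum
  itself is attained only in the sense of distributions, by letting the gradient act on the test
  function.\<close>

lemma nn_integral_lborel_plus:
  fixes f :: "'a::euclidean_space \<Rightarrow> ennreal"
  assumes [measurable]: "f \<in> borel_measurable borel"
  shows "(\<integral>\<^sup>+x. f (c + x) \<partial>lborel) = (\<integral>\<^sup>+x. f x \<partial>lborel)"
  by (subst (2) lborel_distr_plus[of c, symmetric]) (simp add: nn_integral_distr)

lemma lborel_distr_uminus_euclidean: "distr lborel borel uminus = (lborel :: 'a::euclidean_space measure)"
proof -
  have "(lborel :: 'a measure) = density (distr lborel borel (\<lambda>x. 0 + (-1) *\<^sub>R x))
      (\<lambda>_. \<bar>-1::real\<bar> ^ DIM('a))"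
    by (rule lborel_affine) simp
  also have "\<dots> = distr lborel borel uminus"
    by (simp add: density_1)
  finally show ?thesis by simp
qed

lemma nn_integral_lborel_reflect:
  fixes f :: "'a::euclidean_space \<Rightarrow> ennreal"
  assumes [measurable]: "f \<in> borel_measurable borel"
  shows "(\<integral>\<^sup>+x. f (c - x) \<partial>lborel) = (\<integral>\<^sup>+x. f x \<partial>lborel)"
proof -
  have "(\<integral>\<^sup>+x. f (c - x) \<partial>lborel) = (\<integral>\<^sup>+x. f (c + x) \<partial>distr lborel borel uminus)"
    by (subst nn_integral_distr) auto
  then show ?thesis
    by (simp add: lborel_distr_uminus_euclidean nn_integral_lborel_plus)
qed

lemma nn_integral_lborel_minus:
  fixes f :: "'a::euclidean_space \<Rightarrow> ennreal"
  assumes [measurable]: "f \<in> borel_measurable borel"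
  shows "(\<integral>\<^sup>+x. f (x - c) \<partial>lborel) = (\<integral>\<^sup>+x. f x \<partial>lborel)"
  using nn_integral_lborel_plus[of f "-c"] by simp

lemma integral_lborel_reflect:
  fixes f :: "'a::euclidean_space \<Rightarrow> 'b::{banach, second_countable_topology}"
  assumes [measurable]: "f \<in> borel_measurable borel"
  shows "(LINT x|lborel. f (c - x)) = (LINT x|lborel. f x)"
proof -
  have "(LINT x|lborel. f (c - x)) = (LINT x|distr lborel borel uminus. f (c + x))"
    by (subst integral_distr) auto
  also have "\<dots> = (LINT x|distr lborel borel ((+) c). f x)"
    by (subst integral_distr) (auto simp: lborel_distr_uminus_euclidean)
  finally show ?thesis
    by (simp add: lborel_distr_plus)
qed

lemma nn_integral_plane_prod:
  fixes f g :: "real \<Rightarrow> ennreal"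
  assumes [measurable]: "f \<in> borel_measurable borel" "g \<in> borel_measurable borel"
  shows "(\<integral>\<^sup>+x. f (x $ 1) * g (x $ 2) \<partial>(lborel :: (real^2) measure)) =
    (\<integral>\<^sup>+x. f x \<partial>lborel) * (\<integral>\<^sup>+x. g x \<partial>lborel)"
proof -
  \<comment> \<open>\<open>nn_integral_lborel_prod\<close> indexes its factors by basis vectors, so
    \<open>h\<close> assigns \<open>f\<close> and \<open>g\<close> to the two elements of
    \<open>Basis\<close>.\<close>
  define h where "h b = (if b = axis (1::2) (1::real) then f else g)" for b
  have ne: "axis (1::2) (1::real) \<noteq> axis 2 1" by (simp add: axis_eq_axis)
  have B: "(Basis :: (real^2) set) = {axis 1 1, axis 2 1}"
    by (auto simp: Basis_vec_def UNIV_2)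
  have "(\<integral>\<^sup>+x. (\<Prod>b\<in>Basis. h b (x \<bullet> b)) \<partial>(lborel :: (real^2) measure)) = (\<Prod>b\<in>Basis. (\<integral>\<^sup>+x. h b x \<partial>lborel))"
    by (rule nn_integral_lborel_prod) (auto simp: h_def)
  then show ?thesis
    using ne by (simp add: B h_def inner_axis)
qed

lemma norm_plane: "(norm (x::real^2))\<^sup>2 = (x$1)\<^sup>2 + (x$2)\<^sup>2"
  unfolding norm_eq_sqrt_inner inner_vec_def by (simp add: sum_2 power2_eq_square)

lemma measurable_heat_kernel [measurable (raw)]:
  "f \<in> borel_measurable M \<Longrightarrow> g \<in> borel_measurable M \<Longrightarrow> (\<lambda>x. heat_kernel (f x) (g x)) \<in> borel_measurable M"
  unfolding heat_kernel_def by simp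

lemma heat_kernel_pos: "0 < t \<Longrightarrow> 0 < heat_kernel t x"
  by (simp add: heat_kernel_def)

lemma heat_kernel_nonneg [simp]: "0 < t \<Longrightarrow> 0 \<le> heat_kernel t x"
  by (simp add: heat_kernel_def)

lemma heat_kernel_commute: "heat_kernel t (x - y) = heat_kernel t (y - x)"
  by (simp add: heat_kernel_def norm_minus_commute)

lemma heat_kernel_le: "0 < t \<Longrightarrow> heat_kernel t x \<le> 1 / (4 * pi * t)"
  by (simp add: heat_kernel_def divide_right_mono)

text \<open>In the plane the kernel factors into two centred normal densities of variance 2t, each
  of mass 1.\<close>

lemma nn_integral_heat_kernel:
  assumes "0 < t"
  shows "(\<integral>\<^sup>+x. ennreal (heat_kernel t x) \<partial>lborel) = 1"
proof -
  let ?n = "normal_density 0 (sqrt (2 * t))"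
  have s: "sqrt (pi * (t*4)) * sqrt (pi * (t*4)) = pi * (t*4)" using assms by simp
  have eq: "heat_kernel t x = ?n (x$1) * ?n (x$2)" for x
    using assms s by (simp add: heat_kernel_def normal_density_def norm_plane mult_exp_exp
        add_divide_distrib field_simps)
  have one: "(\<integral>\<^sup>+x. ennreal (?n x) \<partial>lborel) = 1"
    using assms by (subst nn_integral_eq_integral) (auto simp: integral_normal_density)
  show ?thesis
    unfolding eq using one
    by (simp add: ennreal_mult nn_integral_plane_prod[of "\<lambda>x. ennreal (?n x)" "\<lambda>x. ennreal (?n x)"])
qed

lemma integrable_heat_kernel: "0 < t \<Longrightarrow> integrable lborel (heat_kernel t)"
  by (rule integrableI_nonneg) (auto simp: nn_integral_heat_kernel)

lemma integral_heat_kernel: "0 < t \<Longrightarrow> (LINT x|lborel. heat_kernel t x) = 1"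
  by (subst integral_eq_nn_integral) (auto simp: nn_integral_heat_kernel)

text \<open>Completing the square in y. The second factor on the right is a Gaussian in y centred at
  s/(s+t) times x, so it integrates to 1 and the convolution law for kernels follows at
  once.\<close>

lemma heat_kernel_mult:
  assumes "0 < s" "0 < t"
  shows "heat_kernel t (x - y) * heat_kernel s y =
    heat_kernel (s + t) x * heat_kernel (s * t / (s + t)) ((s / (s + t)) *\<^sub>R x - y)"
proof -
  have *: "(a - 2 * b + c) / (4 * t) + c / (4 * s) = a / (4 * (s + t)) +
      ((s / (s + t))\<^sup>2 * a - 2 * (s / (s + t)) * b + c) / (4 * (s * t / (s + t)))" for a b c :: real
  proof -
    define u where "u = s + t"
    have u: "u > 0" using assms by (simp add: u_def)
    have "((s / u)\<^sup>2 * a - 2 * (s / u) * b + c) / (4 * (s * t / u)) =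
        (s / u)\<^sup>2 * a / (4 * (s * t / u)) - 2 * (s / u) * b / (4 * (s * t / u)) + c / (4 * (s * t / u))"
      by (simp only: add_divide_distrib diff_divide_distrib)
    moreover have "(s / u)\<^sup>2 * a / (4 * (s * t / u)) = a / (4 * t) - a / (4 * u)"
    proof -
      have "(s / u)\<^sup>2 * a / (4 * (s * t / u)) = s * a / (4 * u * t)"
        using assms u by (simp add: power2_eq_square)
      also have "\<dots> = (u - t) * a / (4 * u * t)" by (simp add: u_def)
      also have "\<dots> = a / (4 * t) - a / (4 * u)"
        using assms u by (simp add: left_diff_distrib diff_divide_distrib)
      finally show ?thesis .
    qed
    moreover have "2 * (s / u) * b / (4 * (s * t / u)) = 2 * b / (4 * t)"
      using assms u by simp
    moreover have "c / (4 * (s * t / u)) = c / (4 * t) + c / (4 * s)"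
    proof -
      have "c / (4 * (s * t / u)) = c * (s + t) / (4 * s * t)" using u by (simp add: u_def mult.assoc)
      also have "\<dots> = c / (4 * t) + c / (4 * s)"
        using assms by (simp add: distrib_left add_divide_distrib)
      finally show ?thesis .
    qed
    ultimately show ?thesis
      unfolding u_def[symmetric] by (simp add: add_divide_distrib diff_divide_distrib)
  qed
  have nxy: "(norm (x - y))\<^sup>2 = x \<bullet> x - 2 * (x \<bullet> y) + y \<bullet> y"
    by (simp add: power2_norm_eq_inner inner_diff inner_commute)
  have nq: "(norm (q *\<^sub>R x - y))\<^sup>2 = q\<^sup>2 * (x \<bullet> x) - 2 * q * (x \<bullet> y) + y \<bullet> y" for q
    unfolding power2_norm_eq_inner by (simp add: inner_diff inner_commute power2_eq_square)
  have "(norm (x - y))\<^sup>2 / (4 * t) + (norm y)\<^sup>2 / (4 * s) =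
    (norm x)\<^sup>2 / (4 * (s + t)) + (norm ((s / (s + t)) *\<^sub>R x - y))\<^sup>2 / (4 * (s * t / (s + t)))"
    using *[of "x \<bullet> x" "x \<bullet> y" "y \<bullet> y"]
    unfolding nxy nq power2_norm_eq_inner[of x] power2_norm_eq_inner[of y] .
  then have e: "exp (- (norm (x - y))\<^sup>2 / (4 * t)) * exp (- (norm y)\<^sup>2 / (4 * s)) =
     exp (- (norm x)\<^sup>2 / (4 * (s + t))) * exp (- (norm ((s / (s + t)) *\<^sub>R x - y))\<^sup>2 / (4 * (s * t / (s + t))))"
    unfolding exp_add[symmetric] minus_divide_left[symmetric] minus_add_distrib[symmetric] by (simp only:)
  have c: "(4 * pi * t) * (4 * pi * s) = (4 * pi * (s + t)) * (4 * pi * (s * t / (s + t)))"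
    using assms by simp
  show ?thesis
    unfolding heat_kernel_def times_divide_times_eq e c ..
qed

lemma nn_integral_heat_kernel_conv:
  assumes "0 < s" "0 < t"
  shows "(\<integral>\<^sup>+y. ennreal (heat_kernel t (x - y) * heat_kernel s y) \<partial>lborel) = ennreal (heat_kernel (s + t) x)"
proof -
  have "(\<integral>\<^sup>+y. ennreal (heat_kernel t (x - y) * heat_kernel s y) \<partial>lborel) =
    (\<integral>\<^sup>+y. ennreal (heat_kernel (s + t) x) * ennreal
        (heat_kernel (s * t / (s + t)) ((s / (s + t)) *\<^sub>R x - y)) \<partial>lborel)"
    using assms by (simp add: heat_kernel_mult ennreal_mult)
  also have "\<dots> = ennreal (heat_kernel (s + t) x) * 1"
    using assms
    by (simp add: nn_integral_cmult nn_integral_heat_kernel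
         nn_integral_lborel_reflect[of "\<lambda>y. ennreal (heat_kernel (s * t / (s + t)) y)"])
  finally show ?thesis by simp
qed

lemma integrable_heat_kernel_conv:
  assumes "0 < s" "0 < t"
  shows "integrable lborel (\<lambda>y. heat_kernel t (x - y) * heat_kernel s y)"
  using assms by (intro integrableI_nonneg) (auto simp: nn_integral_heat_kernel_conv)

lemma integral_heat_kernel_conv:
  assumes "0 < s" "0 < t"
  shows "(LINT y|lborel. heat_kernel t (x - y) * heat_kernel s y) = heat_kernel (s + t) x"
  using assms by (subst integral_eq_nn_integral) (auto simp: nn_integral_heat_kernel_conv)

text \<open>The Gaussian without its prefactor grows with time, and in two dimensions the prefactors
  at r and r' have ratio r'/r. This serves both the L^1 distance of two kernels and the domination
  by a kernel at a fixed time.\<close>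

lemma heat_kernel_compare:
  assumes "0 < r" "r \<le> r'"
  shows "(r / r') * heat_kernel r x \<le> heat_kernel r' x"
proof -
  have "exp (- (norm x)\<^sup>2 / (4 * r)) \<le> exp (- (norm x)\<^sup>2 / (4 * r'))"
    using assms by (simp add: frac_le)
  then show ?thesis
    unfolding heat_kernel_def using assms by (simp add: field_simps)
qed

text \<open>Both kernels lie above r/r' times the kernel at r, and the two excesses have mass 1 -
  r/r' each. This gives Lipschitz dependence on time without differentiating in time.\<close>

lemma nn_integral_heat_kernel_diff:
  assumes "0 < r" "r \<le> r'"
  shows "(\<integral>\<^sup>+x. ennreal \<bar>heat_kernel r' x - heat_kernel r x\<bar> \<partial>lborel) \<le> ennreal (2 * (r' - r) / r')"
proof -
  note [simp] = integrable_heat_kernel integral_heat_kernel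
  let ?b = "\<lambda>x. (heat_kernel r' x - (r / r') * heat_kernel r x) + (1 - r / r') * heat_kernel r x"
  have le: "\<bar>heat_kernel r' x - heat_kernel r x\<bar> \<le> ?b x" for x
  proof -
    define q where "q = r / r' * heat_kernel r x"
    have "q \<le> heat_kernel r x"
      unfolding q_def using assms by (intro mult_left_le_one_le) auto
    moreover have "q \<le> heat_kernel r' x"
      unfolding q_def by (rule heat_kernel_compare[OF assms])
    ultimately show ?thesis
      unfolding left_diff_distrib mult_1 q_def[symmetric] by arith
  qed
  have "(\<integral>\<^sup>+x. ennreal \<bar>heat_kernel r' x - heat_kernel r x\<bar> \<partial>lborel) \<le> (\<integral>\<^sup>+x. ennreal (?b x) \<partial>lborel)"
    by (intro nn_integral_mono ennreal_leI le)
  also have "\<dots> = ennreal (LINT x|lborel. ?b x)"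
    using assms by (intro nn_integral_eq_integral AE_I2 order_trans[OF abs_ge_zero le]) auto
  also have "(LINT x|lborel. ?b x) = 2 * (r' - r) / r'"
    using assms by (simp add: field_simps)
  finally show ?thesis .
qed

section \<open>Gaussian moments with polynomial weights\<close>

lemma power_gaussian_bounded:
  fixes c :: real
  assumes "0 < c"
  shows "\<exists>C>0. \<forall>u\<ge>0. (1 + u) ^ k * exp (- c * u\<^sup>2) \<le> C"
proof -
  have "((\<lambda>u::real. (1 + u) ^ k * exp (- c * u\<^sup>2)) \<longlongrightarrow> 0) at_top"
    using assms by real_asymp
  then have "\<forall>\<^sub>F u in at_top. (1 + u) ^ k * exp (- c * u\<^sup>2) < 1"
    by (rule order_tendstoD) simp
  then obtain N where N: "\<And>u. u \<ge> N \<Longrightarrow> (1 + u) ^ k * exp (- c * u\<^sup>2) < 1"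
    by (auto simp: eventually_at_top_linorder)
  have "(1 + u) ^ k * exp (- c * u\<^sup>2) \<le> 1 + (1 + \<bar>N\<bar>) ^ k" if "u \<ge> 0" for u
  proof (cases "u \<ge> N")
    case True
    have "0 \<le> (1 + \<bar>N\<bar>) ^ k" by simp
    with N[OF True] show ?thesis by linarith
  next
    case False
    have "(1 + u) ^ k * exp (- c * u\<^sup>2) \<le> (1 + \<bar>N\<bar>) ^ k * 1"
      using False that assms by (intro mult_mono power_mono) auto
    then show ?thesis by simp
  qed
  then show ?thesis
    by (intro exI[of _ "1 + (1 + \<bar>N\<bar>) ^ k"]) (auto intro: add_pos_nonneg)
qed

text \<open>Doubling the time frees half of the exponent; the freed Gaussian factor absorbs
  polynomial weights while an integrable kernel remains.\<close>

lemma heat_kernel_double: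
  "0 < t \<Longrightarrow> heat_kernel t x = 2 * exp (- (norm x)\<^sup>2 / (8 * t)) * heat_kernel (2 * t) x"
  by (simp add: heat_kernel_def mult_exp_exp field_simps)

lemma heat_kernel_moment:
  assumes "0 < t"
  shows "\<exists>C>0. \<forall>x. (1 + norm x) ^ k * heat_kernel t x \<le> C * heat_kernel (2 * t) x"
proof -
  have c: "0 < 1 / (8 * t)" using assms by simp
  obtain C where C: "C > 0" "\<And>u. u \<ge> 0 \<Longrightarrow> (1 + u) ^ k * exp (- (1 / (8 * t)) * u\<^sup>2) \<le> C"
    using power_gaussian_bounded[OF c, of k] by blast
  have "(1 + norm x) ^ k * heat_kernel t x \<le> 2 * C * heat_kernel (2 * t) x" for x :: "real^2"
    using mult_right_mono[OF C(2)[of "norm x"], of "2 * heat_kernel (2 * t) x"] assms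
    by (subst heat_kernel_double) (auto simp: algebra_simps)
  then show ?thesis using C(1) by (intro exI[of _ "2 * C"]) auto
qed

lemma integrable_heat_kernel_moment:
  assumes "0 < t"
  shows "integrable lborel (\<lambda>x. (1 + norm x) ^ k * heat_kernel t x)"
proof -
  obtain C where C: "C > 0" "\<And>x::real^2. (1 + norm x) ^ k * heat_kernel t x \<le> C * heat_kernel (2 * t) x"
    using heat_kernel_moment[OF assms] by blast
  show ?thesis
    by (rule Bochner_Integration.integrable_bound[of _ "\<lambda>x. C * heat_kernel (2 * t) x"])
      (use assms C in \<open>auto intro!: integrable_heat_kernel simp: abs_mult order_trans[OF C(2)]\<close>)
qed

text \<open>The exponent is split in three. One factor turns \<open>norm x\<close> into sqrt t, a
  second absorbs the weight uniformly in t because t \<le> 1, and the third is the kernel at time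
  4t.\<close>

lemma heat_kernel_first_moment:
  "\<exists>C>0. \<forall>t x. 0 < t \<and> t \<le> 1 \<longrightarrow> norm x * (1 + norm x) ^ k * heat_kernel t x \<le> C * sqrt t * heat_kernel
      (4 * t) x"
proof -
  have c8: "0 < (1/8::real)" and c16: "0 < (1/16::real)" by auto
  obtain C where C: "C > 0" "\<And>u::real. u \<ge> 0 \<Longrightarrow> (1 + u) ^ 1 * exp (- (1/8) * u\<^sup>2) \<le> C"
    using power_gaussian_bounded[OF c8, of 1] by blast
  obtain D where D: "D > 0" "\<And>u::real. u \<ge> 0 \<Longrightarrow> (1 + u) ^ k * exp (- (1/16) * u\<^sup>2) \<le> D"
    using power_gaussian_bounded[OF c16, of k] by blast
  have "norm x * (1 + norm x) ^ k * heat_kernel t x \<le> (4 * C * D) * sqrt t * heat_kernel (4 * t) x"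
    if t: "0 < t" "t \<le> 1" for t and x :: "real^2"
  proof -
    have "(norm x / sqrt t) * exp (- (norm x)\<^sup>2 / (8 * t)) \<le> (1 + norm x / sqrt t) * exp
        (- (norm x)\<^sup>2 / (8 * t))"
      by (rule mult_right_mono) auto
    also have "\<dots> = (1 + norm x / sqrt t) ^ 1 * exp (- (1/8) * (norm x / sqrt t)\<^sup>2)"
      using t by (simp add: power_divide)
    also have "\<dots> \<le> C" using t by (intro C) auto
    finally have 1: "norm x * exp (- (norm x)\<^sup>2 / (8 * t)) \<le> C * sqrt t"
      using t by (simp add: field_simps)
    have "exp (- (norm x)\<^sup>2 / (16 * t)) \<le> exp (- (1/16) * (norm x)\<^sup>2)"
      using t by (simp add: field_simps mult_left_le_one_le mult_right_le_one_le)
    then have "(1 + norm x) ^ k * exp (- (norm x)\<^sup>2 / (16 * t)) \<le> (1 + norm x) ^ k * exp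
        (- (1/16) * (norm x)\<^sup>2)"
      by (intro mult_left_mono) auto
    also have "\<dots> \<le> D" by (rule D) simp
    finally have 2: "(1 + norm x) ^ k * exp (- (norm x)\<^sup>2 / (16 * t)) \<le> D" .
    have "heat_kernel t x = 4 * (exp (- (norm x)\<^sup>2 / (8 * t)) * exp (- (norm x)\<^sup>2 / (16 * t))) * heat_kernel
        (4 * t) x"
      using t heat_kernel_double[of t x] heat_kernel_double[of "2 * t" x] by simp
    then have "norm x * (1 + norm x) ^ k * heat_kernel t x =
       4 * ((norm x * exp (- (norm x)\<^sup>2 / (8 * t))) * ((1 + norm x) ^ k * exp (- (norm x)\<^sup>2 / (16 * t)))) *
           heat_kernel (4 * t) x"
      by simp
    also have "\<dots> \<le> 4 * ((C * sqrt t) * D) * heat_kernel (4 * t) x"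
    proof -
      have "(norm x * exp (- (norm x)\<^sup>2 / (8 * t))) * ((1 + norm x) ^ k * exp (- (norm x)\<^sup>2 / (16 * t))) \<le>
          (C * sqrt t) * D"
        using C D t by (intro mult_mono 1 2) auto
      then show ?thesis using t by (intro mult_right_mono mult_left_mono) auto
    qed
    finally show ?thesis by (simp add: algebra_simps)
  qed
  then show ?thesis using C(1) D(1) by (intro exI[of _ "4 * C * D"]) auto
qed

subsection \<open>Schwartz functions\<close>

lemma partials_Nil [simp]: "partials [] f = f"
  by (simp add: partials_def)

lemma partials_Cons: "partials (i # is) f = partial i (partials is f)"
  by (simp add: partials_def)

lemma partials_snoc: "partials (is @ [i]) f = partials is (partial i f)"
  by (simp add: partials_def)

lemma schwartz_partial: "\<psi> \<in> schwartz \<Longrightarrow> partial i \<psi> \<in> schwartz"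
  unfolding schwartz_def by (auto simp flip: partials_snoc)

lemma schwartz_partials: "\<psi> \<in> schwartz \<Longrightarrow> partials is \<psi> \<in> schwartz"
  by (induction "is") (auto simp: partials_Cons schwartz_partial)

lemma schwartz_differentiable: "\<psi> \<in> schwartz \<Longrightarrow> \<psi> differentiable (at x)"
  unfolding schwartz_def differentiable_on_def by (auto dest!: spec[of _ "[]"])

lemma schwartz_bound:
  assumes "\<psi> \<in> schwartz"
  obtains C where "C > 0" "\<And>x. (1 + norm x) ^ k * \<bar>\<psi> x\<bar> \<le> C"
proof -
  obtain C where "\<And>x. (1 + norm x) ^ k * \<bar>\<psi> x\<bar> \<le> C"
    using assms unfolding schwartz_def mem_Collect_eq by (metis partials_Nil)
  then show thesis
    by (intro that[of "max C 1"]) (auto simp: le_max_iff_disj)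
qed

lemma schwartz_bounded:
  assumes "\<psi> \<in> schwartz"
  obtains C where "C > 0" "\<And>x. \<bar>\<psi> x\<bar> \<le> C"
  using schwartz_bound[OF assms, of 0] by auto

lemma frechet_derivative_partial:
  assumes "f differentiable (at x)"
  shows "(f has_derivative (\<lambda>h. grad f x \<bullet> h)) (at x)"
proof -
  let ?D = "frechet_derivative f (at x)"
  have D: "(f has_derivative ?D) (at x)"
    using assms by (simp add: frechet_derivative_works)
  interpret bounded_linear ?D
    using D by (rule has_derivative_bounded_linear)
  have "?D h = grad f x \<bullet> h" for h
  proof -
    have "?D h = ?D (\<Sum>i\<in>UNIV. (h $ i) *\<^sub>R axis i 1)"
      using basis_expansion[of h] by (simp add: scalar_mult_eq_scaleR)
    also have "\<dots> = (\<Sum>i\<in>UNIV. h $ i * partial i f x)"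
      by (simp add: sum scaleR partial_def)
    finally show ?thesis
      by (simp add: inner_vec_def grad_def mult.commute)
  qed
  then have "?D = (\<lambda>h. grad f x \<bullet> h)" by (rule ext)
  with D show ?thesis by simp
qed

lemma partial_eqI:
  assumes "(f has_derivative D) (at x)"
  shows "partial i f x = D (axis i 1)"
  using frechet_derivative_at[OF assms] by (simp add: partial_def)

lemma grad_eqI:
  assumes "(f has_derivative (\<lambda>h. v \<bullet> h)) (at x)"
  shows "grad f x = v"
  by (simp add: grad_def vec_eq_iff partial_eqI[OF assms] inner_axis)

lemma schwartz_has_derivative:
  "\<psi> \<in> schwartz \<Longrightarrow> (\<psi> has_derivative (\<lambda>h. grad \<psi> x \<bullet> h)) (at x)"
  by (intro frechet_derivative_partial schwartz_differentiable)

lemma schwartz_continuous: "\<psi> \<in> schwartz \<Longrightarrow> continuous_on UNIV \<psi>"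
  by (meson continuous_at_imp_continuous_on differentiable_imp_continuous_within schwartz_differentiable)

lemma schwartz_measurable [measurable_dest]: "\<psi> \<in> schwartz \<Longrightarrow> \<psi> \<in> borel_measurable borel"
  by (intro borel_measurable_continuous_onI schwartz_continuous)

lemma schwartz_grad_measurable: "\<psi> \<in> schwartz \<Longrightarrow> grad \<psi> \<in> borel_measurable borel"
  unfolding grad_def[abs_def]
  by (intro borel_measurable_continuous_onI continuous_on_vec_lambda)
    (metis schwartz_continuous schwartz_partial)

lemma norm_grad_le: "norm (grad f x) \<le> (\<Sum>i\<in>UNIV. \<bar>partial i f x\<bar>)"
  using norm_le_l1_cart[of "grad f x"] by (simp add: grad_def)

lemma schwartz_grad_bound:
  assumes "\<psi> \<in> schwartz"
  obtains C where "C > 0" "\<And>x. (1 + norm x) ^ k * norm (grad \<psi> x) \<le> C"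
proof -
  obtain C where C: "\<And>i. C i > 0" "\<And>i x. (1 + norm x) ^ k * \<bar>partial i \<psi> x\<bar> \<le> C i"
  proof -
    have "\<forall>i. \<exists>C>0. \<forall>x. (1 + norm x) ^ k * \<bar>partial i \<psi> x\<bar> \<le> C"
      using schwartz_bound[OF schwartz_partial[OF assms], of k] by blast
    then show thesis using that by metis
  qed
  have "(1 + norm x) ^ k * norm (grad \<psi> x) \<le> (\<Sum>i\<in>UNIV. C i)" for x
  proof -
    have "(1 + norm x) ^ k * norm (grad \<psi> x) \<le> (1 + norm x) ^ k * (\<Sum>i\<in>UNIV. \<bar>partial i \<psi> x\<bar>)"
      by (intro mult_left_mono norm_grad_le) auto
    also have "\<dots> \<le> (\<Sum>i\<in>UNIV. C i)"
      unfolding sum_distrib_left by (intro sum_mono C)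
    finally show ?thesis .
  qed
  moreover have "(\<Sum>i\<in>UNIV. C i) > 0" by (intro sum_pos C) auto
  ultimately show thesis by (rule that[rotated])
qed

lemma differentiable_bound_inner:
  fixes f :: "real^2 \<Rightarrow> real"
  assumes "convex S" "\<And>z. z \<in> S \<Longrightarrow> (f has_derivative (\<lambda>h. v z \<bullet> h)) (at z)"
    "\<And>z. z \<in> S \<Longrightarrow> norm (v z) \<le> B" "x \<in> S" "y \<in> S"
  shows "\<bar>f x - f y\<bar> \<le> B * norm (x - y)"
proof -
  have B: "0 \<le> B" using assms(3,4) norm_ge_zero order_trans by blast
  have "onorm (\<lambda>h. v z \<bullet> h) \<le> B" if "z \<in> S" for z
    using assms(3)[OF that] B
    by (intro onorm_bound) (auto intro!: order_trans[OF Cauchy_Schwarz_ineq2] mult_right_mono)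
  then show ?thesis
    using differentiable_bound[OF assms(1) has_derivative_at_withinI[OF assms(2)] _ assms(4,5), of B]
        by auto
qed

lemma schwartz_lipschitz:
  assumes "\<psi> \<in> schwartz"
  obtains C where "C > 0" "\<And>x y. \<bar>\<psi> x - \<psi> y\<bar> \<le> C * norm (x - y)"
proof -
  obtain C where C: "C > 0" "\<And>x. norm (grad \<psi> x) \<le> C"
    using schwartz_grad_bound[OF assms, of 0] by auto
  show thesis
    by (rule that[OF C(1)])
      (rule differentiable_bound_inner[OF convex_UNIV schwartz_has_derivative[OF assms] C(2)], auto)
qed

lemma schwartz_grad_lipschitz:
  assumes "\<psi> \<in> schwartz"
  obtains C where "C > 0" "\<And>x y. norm (grad \<psi> x - grad \<psi> y) \<le> C * norm (x - y)"
proof -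
  obtain C where C: "\<And>i. C i > 0" "\<And>i x y. \<bar>partial i \<psi> x - partial i \<psi> y\<bar> \<le> C i * norm (x - y)"
  proof -
    have "\<forall>i. \<exists>C>0. \<forall>x y. \<bar>partial i \<psi> x - partial i \<psi> y\<bar> \<le> C * norm (x - y)"
      using schwartz_lipschitz[OF schwartz_partial[OF assms]] by blast
    then show thesis using that by metis
  qed
  have "norm (grad \<psi> x - grad \<psi> y) \<le> (\<Sum>i\<in>UNIV. C i) * norm (x - y)" for x y
  proof -
    have "norm (grad \<psi> x - grad \<psi> y) \<le> (\<Sum>i\<in>UNIV. \<bar>(grad \<psi> x - grad \<psi> y) $ i\<bar>)"
      by (rule norm_le_l1_cart)
    also have "\<dots> \<le> (\<Sum>i\<in>UNIV. C i * norm (x - y))"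
      by (intro sum_mono) (use C(2) in \<open>auto simp: grad_def\<close>)
    finally show ?thesis by (simp add: sum_distrib_right)
  qed
  moreover have "(\<Sum>i\<in>UNIV. C i) > 0" by (intro sum_pos C) auto
  ultimately show thesis by (rule that[rotated])
qed

text \<open>Mean value inequality for \<open>\<psi>\<close> minus its linear part on the ball of
  radius \<open>norm h\<close>, where the gradient varies by at most C \<open>norm h\<close>.
  Uniformity in the base point is what differentiation of a convolution needs.\<close>

lemma schwartz_taylor:
  assumes "\<psi> \<in> schwartz"
  obtains C where "C > 0" "\<And>y h. \<bar>\<psi> (y + h) - \<psi> y - grad \<psi> y \<bullet> h\<bar> \<le> C * (norm h)\<^sup>2"
proof -
  obtain C where C: "C > 0" "\<And>x y. norm (grad \<psi> x - grad \<psi> y) \<le> C * norm (x - y)"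
    using schwartz_grad_lipschitz[OF assms] by blast
  show thesis
  proof (rule that[OF C(1)])
    fix y h
    have "\<bar>(\<psi> (y + h) - grad \<psi> y \<bullet> (y + h)) - (\<psi> y - grad \<psi> y \<bullet> y)\<bar> \<le> (C * norm h) * norm (y + h - y)"
    proof (rule differentiable_bound_inner[where S = "cball y (norm h)" and v = "\<lambda>z. grad \<psi> z - grad \<psi> y"])
      fix z assume z: "z \<in> cball y (norm h)"
      show "((\<lambda>z. \<psi> z - grad \<psi> y \<bullet> z) has_derivative (\<lambda>h. (grad \<psi> z - grad \<psi> y) \<bullet> h)) (at z)"
        by (auto intro!: derivative_eq_intros schwartz_has_derivative[OF assms] simp: inner_diff_left)
      have "C * norm (z - y) \<le> C * norm h"
        using z C(1) by (auto simp: dist_norm norm_minus_commute)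
      then show "norm (grad \<psi> z - grad \<psi> y) \<le> C * norm h"
        using C(2)[of z y] by simp
    qed (auto simp: dist_norm)
    then show "\<bar>\<psi> (y + h) - \<psi> y - grad \<psi> y \<bullet> h\<bar> \<le> C * (norm h)\<^sup>2"
      by (simp add: inner_add_right power2_eq_square algebra_simps)
  qed
qed

subsection \<open>Seminorms and linear structure\<close>

lemma schwartz_seminorm_upper:
  assumes "\<psi> \<in> schwartz"
  shows "(1 + norm x) ^ k * \<bar>partials is \<psi> x\<bar> \<le> schwartz_seminorm k is \<psi>"
proof -
  obtain C where "\<And>x. (1 + norm x) ^ k * \<bar>partials is \<psi> x\<bar> \<le> C"
    using schwartz_bound[OF schwartz_partials[OF assms]] by blast
  then show ?thesis
    unfolding schwartz_seminorm_def by (intro cSUP_upper bdd_aboveI2) auto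
qed

lemma schwartz_seminorm_nonneg: "\<psi> \<in> schwartz \<Longrightarrow> 0 \<le> schwartz_seminorm k is \<psi>"
  by (rule order_trans[OF _ schwartz_seminorm_upper]) auto

lemma schwartz_seminorm_le:
  "(\<And>x. (1 + norm x) ^ k * \<bar>partials is \<psi> x\<bar> \<le> C) \<Longrightarrow> schwartz_seminorm k is \<psi> \<le> C"
  unfolding schwartz_seminorm_def by (rule cSUP_least) auto

lemma lincomb_has_derivative:
  assumes "\<psi> \<in> schwartz" "\<eta> \<in> schwartz"
  shows "((\<lambda>x. a * \<psi> x + b * \<eta> x) has_derivative (\<lambda>h. (a *\<^sub>R grad \<psi> x + b *\<^sub>R grad \<eta> x) \<bullet> h)) (at x within S)"
  by (rule has_derivative_at_withinI)
    (auto intro!: derivative_eq_intros schwartz_has_derivative assms simp: inner_add_left)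

lemma partials_lincomb:
  assumes "\<psi> \<in> schwartz" "\<eta> \<in> schwartz"
  shows "partials is (\<lambda>x. a * \<psi> x + b * \<eta> x) = (\<lambda>x. a * partials is \<psi> x + b * partials is \<eta> x)"
proof (induction "is")
  case (Cons i js)
  have "partial i (\<lambda>x. a * partials js \<psi> x + b * partials js \<eta> x) x =
      a * partial i (partials js \<psi>) x + b * partial i (partials js \<eta>) x" for x
  proof -
    note d = lincomb_has_derivative[OF schwartz_partials[OF assms(1), of js]
        schwartz_partials[OF assms(2), of js]]
    from partial_eqI[OF d] show ?thesis by (simp add: grad_def inner_axis)
  qed
  then show ?case unfolding partials_Cons Cons.IH by (rule ext)
qed simp

lemma schwartz_lincomb:
  assumes "\<psi> \<in> schwartz" "\<eta> \<in> schwartz"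
  shows "(\<lambda>x. a * \<psi> x + b * \<eta> x) \<in> schwartz"
  unfolding schwartz_def mem_Collect_eq
proof (intro conjI allI)
  fix "is"
  show "partials is (\<lambda>x. a * \<psi> x + b * \<eta> x) differentiable_on UNIV"
    unfolding differentiable_on_def partials_lincomb[OF assms] differentiable_def
    by (intro ballI exI) (rule lincomb_has_derivative[OF schwartz_partials[OF assms(1)]
        schwartz_partials[OF assms(2)]])
next
  fix "is" k
  obtain C where C: "\<And>x. (1 + norm x) ^ k * \<bar>partials is \<psi> x\<bar> \<le> C"
    using schwartz_bound[OF schwartz_partials[OF assms(1)]] by blast
  obtain D where D: "\<And>x. (1 + norm x) ^ k * \<bar>partials is \<eta> x\<bar> \<le> D"
    using schwartz_bound[OF schwartz_partials[OF assms(2)]] by blast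
  have "(1 + norm x) ^ k * \<bar>a * partials is \<psi> x + b * partials is \<eta> x\<bar> \<le> \<bar>a\<bar> * C + \<bar>b\<bar> * D" for x
  proof -
    have "(1 + norm x) ^ k * \<bar>a * partials is \<psi> x + b * partials is \<eta> x\<bar> \<le>
      (1 + norm x) ^ k * (\<bar>a\<bar> * \<bar>partials is \<psi> x\<bar> + \<bar>b\<bar> * \<bar>partials is \<eta> x\<bar>)"
      by (intro mult_left_mono) (auto simp flip: abs_mult)
    also have "\<dots> = \<bar>a\<bar> * ((1 + norm x) ^ k * \<bar>partials is \<psi> x\<bar>) + \<bar>b\<bar> *
        ((1 + norm x) ^ k * \<bar>partials is \<eta> x\<bar>)"
      by (simp add: algebra_simps)
    also have "\<dots> \<le> \<bar>a\<bar> * C + \<bar>b\<bar> * D"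
      by (intro add_mono mult_left_mono C D) auto
    finally show ?thesis .
  qed
  then show "\<exists>C. \<forall>x. (1 + norm x) ^ k * \<bar>partials is (\<lambda>x. a * \<psi> x + b * \<eta> x) x\<bar> \<le> C"
    unfolding partials_lincomb[OF assms] by blast
qed

lemma schwartz_minus: "\<psi> \<in> schwartz \<Longrightarrow> \<eta> \<in> schwartz \<Longrightarrow> (\<lambda>x. \<psi> x - \<eta> x) \<in> schwartz"
  using schwartz_lincomb[of \<psi> \<eta> 1 "-1"] by simp

subsection \<open>Convolution\<close>

lemma integrable_mult_bounded:
  fixes w :: "'a \<Rightarrow> real" and f :: "'a \<Rightarrow> 'b::{banach, second_countable_topology}"
  assumes w: "integrable M w" and [measurable]: "f \<in> borel_measurable M" and b: "\<And>x. norm (f x) \<le> C"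
  shows "integrable M (\<lambda>x. w x *\<^sub>R f x)"
proof (rule Bochner_Integration.integrable_bound[of _ "\<lambda>x. C * w x"])
  have [measurable]: "w \<in> borel_measurable M" using w by auto
  show "(\<lambda>x. w x *\<^sub>R f x) \<in> borel_measurable M" by measurable
  show "AE x in M. norm (w x *\<^sub>R f x) \<le> norm (C * w x)"
    using b by (auto simp: abs_mult mult.commute[of C] intro!: AE_I2 mult_left_mono order_trans[OF b])
qed (use w in auto)

text \<open>A function that is not integrable has integral 0, so the bound covers that case too and
  integrability of \<open>f\<close> never has to be discussed by its users.\<close>

lemma integral_norm_le:
  fixes f :: "'a \<Rightarrow> 'b::{banach, second_countable_topology}"
  assumes g: "integrable M g" and le: "\<And>x. norm (f x) \<le> g x"
  shows "norm (integral\<^sup>L M f) \<le> integral\<^sup>L M g"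
proof (cases "integrable M f")
  case True
  then show ?thesis
    by (intro order_trans[OF integral_norm_bound integral_mono] integrable_norm g le)
next
  case False
  then show ?thesis
    by (auto simp: not_integrable_integral_eq intro!: integral_nonneg_AE AE_I2
        order_trans[OF norm_ge_zero le])
qed

text \<open>The uniform quadratic Taylor remainder, integrated against \<bar>w\<bar>, yields an
  error of order \<open>norm h\<close> squared; this takes the place of a dominated convergence
  argument.\<close>

lemma conv_has_derivative:
  assumes w: "integrable lborel w" and \<phi>: "\<phi> \<in> schwartz"
  shows "((\<lambda>y. LINT x|lborel. w x * \<phi> (y - x)) has_derivative
      (\<lambda>h. (LINT x|lborel. w x *\<^sub>R grad \<phi> (y - x)) \<bullet> h)) (at y)"
proof -
  note [measurable] = schwartz_measurable[OF \<phi>] schwartz_grad_measurable[OF \<phi>]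
  obtain B where B: "\<And>x. \<bar>\<phi> x\<bar> \<le> B" using schwartz_bounded[OF \<phi>] by blast
  obtain B' where B': "\<And>x. norm (grad \<phi> x) \<le> B'" using schwartz_grad_bound[OF \<phi>, of 0] by auto
  obtain C where C: "C > 0" "\<And>y h. \<bar>\<phi> (y + h) - \<phi> y - grad \<phi> y \<bullet> h\<bar> \<le> C * (norm h)\<^sup>2"
    using schwartz_taylor[OF \<phi>] by blast
  have i1: "integrable lborel (\<lambda>x. w x * \<phi> (y - x))" for y
    using integrable_mult_bounded[OF w, of "\<lambda>x. \<phi> (y - x)" B] B by simp
  have i2: "integrable lborel (\<lambda>x. w x *\<^sub>R grad \<phi> (y - x))" for y
    using integrable_mult_bounded[OF w, of "\<lambda>x. grad \<phi> (y - x)" B'] B' by simp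
  let ?F = "\<lambda>y. LINT x|lborel. w x * \<phi> (y - x)"
  let ?L = "LINT x|lborel. w x *\<^sub>R grad \<phi> (y - x)"
  let ?K = "C * (LINT x|lborel. \<bar>w x\<bar>)"
  have bound: "\<bar>?F (y + h) - ?F y - ?L \<bullet> h\<bar> \<le> ?K * (norm h)\<^sup>2" for h
  proof -
    have L: "?L \<bullet> h = (LINT x|lborel. (w x *\<^sub>R grad \<phi> (y - x)) \<bullet> h)"
      by (rule integral_inner_left[symmetric]) (rule i2)
    have i3: "integrable lborel (\<lambda>x. (w x *\<^sub>R grad \<phi> (y - x)) \<bullet> h)"
      by (rule integrable_inner_left) (rule i2)
    have "?F (y + h) - ?F y - ?L \<bullet> h =
        (LINT x|lborel. w x * \<phi> (y + h - x) - w x * \<phi> (y - x) - (w x *\<^sub>R grad \<phi> (y - x)) \<bullet> h)"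
      unfolding L using i1 i3 by (simp only: Bochner_Integration.integral_diff
          Bochner_Integration.integrable_diff)
    also have "norm \<dots> \<le> (LINT x|lborel. \<bar>w x\<bar> * (C * (norm h)\<^sup>2))"
    proof (rule integral_norm_le)
      fix x
      have "norm (w x * \<phi> (y + h - x) - w x * \<phi> (y - x) - (w x *\<^sub>R grad \<phi> (y - x)) \<bullet> h) =
        \<bar>w x\<bar> * \<bar>\<phi> ((y - x) + h) - \<phi> (y - x) - grad \<phi> (y - x) \<bullet> h\<bar>"
        by (simp add: abs_mult[symmetric] algebra_simps)
      also have "\<dots> \<le> \<bar>w x\<bar> * (C * (norm h)\<^sup>2)"
        by (intro mult_left_mono C) auto
      finally show "norm (w x * \<phi> (y + h - x) - w x * \<phi> (y - x) - (w x *\<^sub>R grad \<phi> (y - x)) \<bullet> h) \<le> \<bar>w x\<bar> *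
          (C * (norm h)\<^sup>2)" .
    qed (use w in auto)
    finally show ?thesis by (simp add: mult_ac)
  qed
  show ?thesis
    unfolding has_derivative_at
  proof (intro conjI)
    show "bounded_linear (\<lambda>h. ?L \<bullet> h)" by (rule bounded_linear_inner_right)
    show "((\<lambda>h. norm (?F (y + h) - ?F y - ?L \<bullet> h) / norm h) \<longlongrightarrow> 0) (at 0)"
    proof (rule tendsto_sandwich[of "\<lambda>_. 0"])
      show "\<forall>\<^sub>F h in at 0. norm (?F (y + h) - ?F y - ?L \<bullet> h) / norm h \<le> ?K * norm h"
        unfolding eventually_at_filter
        using bound by (auto intro!: always_eventually simp: divide_le_eq power2_eq_square mult.assoc)
      show "((\<lambda>h. ?K * norm h) \<longlongrightarrow> 0) (at (0::real^2))"
        by (intro tendsto_mult_right_zero tendsto_norm_zero tendsto_ident_at)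
    qed auto
  qed
qed

lemma partial_conv:
  assumes w: "integrable lborel w" and \<phi>: "\<phi> \<in> schwartz"
  shows "partial i (\<lambda>y. LINT x|lborel. w x * \<phi> (y - x)) = (\<lambda>y. LINT x|lborel. w x * partial i \<phi> (y - x))"
proof
  fix y
  note [measurable] = schwartz_grad_measurable[OF \<phi>]
  obtain B' where B': "\<And>x. norm (grad \<phi> x) \<le> B'" using schwartz_grad_bound[OF \<phi>, of 0] by auto
  have i2: "integrable lborel (\<lambda>x. w x *\<^sub>R grad \<phi> (y - x))" for y
    using integrable_mult_bounded[OF w, of "\<lambda>x. grad \<phi> (y - x)" B'] B' by simp
  have "partial i (\<lambda>y. LINT x|lborel. w x * \<phi> (y - x)) y = (LINT x|lborel. w x *\<^sub>R grad \<phi> (y - x)) \<bullet> axis i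
      1"
    by (rule partial_eqI[OF conv_has_derivative[OF w \<phi>]])
  also have "\<dots> = (LINT x|lborel. (w x *\<^sub>R grad \<phi> (y - x)) \<bullet> axis i 1)"
    by (rule integral_inner_left[symmetric]) (rule i2)
  finally show "partial i (\<lambda>y. LINT x|lborel. w x * \<phi> (y - x)) y =
      (LINT x|lborel. w x * partial i \<phi> (y - x))"
    by (simp add: inner_axis grad_def)
qed

lemma partials_conv:
  assumes w: "integrable lborel w" and \<phi>: "\<phi> \<in> schwartz"
  shows "partials is (\<lambda>y. LINT x|lborel. w x * \<phi> (y - x)) =
      (\<lambda>y. LINT x|lborel. w x * partials is \<phi> (y - x))"
  by (induction "is") (auto simp: partials_Cons partial_conv[OF w schwartz_partials[OF \<phi>]])

text \<open>Peetre's inequality: it distributes a polynomial weight over the two factors of a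
  convolution.\<close>

lemma one_plus_norm_le: "1 + norm y \<le> (1 + norm x) * (1 + norm (y - x))"
proof -
  have "norm y \<le> norm x + norm (y - x)"
    using norm_triangle_sub[of y x] by simp
  moreover have "0 \<le> norm x * norm (y - x)" by simp
  ultimately show ?thesis by (simp only: distrib_left distrib_right mult_1 mult_1_right)
qed

lemma conv_decay:
  fixes \<phi> :: "real^2 \<Rightarrow> real"
  assumes w: "integrable lborel (\<lambda>x. (1 + norm x) ^ k * \<bar>w x\<bar>)"
    and [measurable]: "\<phi> \<in> borel_measurable borel" "w \<in> borel_measurable borel"
    and C: "\<And>x. (1 + norm x) ^ k * \<bar>\<phi> x\<bar> \<le> C"
  shows "(1 + norm y) ^ k * \<bar>LINT x|lborel. w x * \<phi> (y - x)\<bar> \<le> C *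
      (LINT x|lborel. (1 + norm x) ^ k * \<bar>w x\<bar>)"
proof -
  have pt: "\<bar>(1 + norm y) ^ k * (w x * \<phi> (y - x))\<bar> \<le> C * ((1 + norm x) ^ k * \<bar>w x\<bar>)" for x
  proof -
    have "(1 + norm y) ^ k \<le> ((1 + norm x) * (1 + norm (y - x))) ^ k"
      by (intro power_mono one_plus_norm_le) auto
    then have "(1 + norm y) ^ k * (\<bar>w x\<bar> * \<bar>\<phi> (y - x)\<bar>) \<le>
      ((1 + norm x) * (1 + norm (y - x))) ^ k * (\<bar>w x\<bar> * \<bar>\<phi> (y - x)\<bar>)"
      by (intro mult_right_mono) auto
    also have "\<dots> = ((1 + norm x) ^ k * \<bar>w x\<bar>) * ((1 + norm (y - x)) ^ k * \<bar>\<phi> (y - x)\<bar>)"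
      by (simp add: power_mult_distrib)
    also have "\<dots> \<le> ((1 + norm x) ^ k * \<bar>w x\<bar>) * C"
      by (intro mult_left_mono C) auto
    finally show ?thesis by (simp add: abs_mult mult.commute)
  qed
  have "(1 + norm y) ^ k * \<bar>LINT x|lborel. w x * \<phi> (y - x)\<bar> = norm
      (LINT x|lborel. (1 + norm y) ^ k * (w x * \<phi> (y - x)))"
    by (simp add: abs_mult)
  also have "\<dots> \<le> (LINT x|lborel. C * ((1 + norm x) ^ k * \<bar>w x\<bar>))"
    by (rule integral_norm_le) (use w pt in auto)
  finally show ?thesis by simp
qed

text \<open>All derivatives fall on \<open>\<phi>\<close>, so \<open>w\<close> only has to decay and
  may be rough. It is applied with \<open>w\<close> the heat kernel, and also with
  \<open>\<phi>\<close> the heat kernel and \<open>w\<close> a continuous function of bounded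
  support.\<close>

lemma conv_schwartz:
  assumes w: "\<And>k. integrable lborel (\<lambda>x. (1 + norm x) ^ k * \<bar>w x\<bar>)"
    and [measurable]: "w \<in> borel_measurable borel" and \<phi>: "\<phi> \<in> schwartz"
  shows "(\<lambda>y. LINT x|lborel. w x * \<phi> (y - x)) \<in> schwartz"
proof -
  have w1: "integrable lborel w"
    using w[of 0] by (simp add: integrable_abs_iff)
  have "(\<lambda>y. LINT x|lborel. w x * partials is \<phi> (y - x)) differentiable_on UNIV" for "is"
    unfolding differentiable_on_def
    using conv_has_derivative[OF w1 schwartz_partials[OF \<phi>]] by (auto simp: differentiable_def)
  moreover have "\<exists>C. \<forall>y. (1 + norm y) ^ k * \<bar>LINT x|lborel. w x * partials is \<phi> (y - x)\<bar> \<le> C" for k "is"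
  proof -
    obtain C where "\<And>x. (1 + norm x) ^ k * \<bar>partials is \<phi> x\<bar> \<le> C"
      using schwartz_bound[OF schwartz_partials[OF \<phi>]] by blast
    from conv_decay[OF w _ _ this] show ?thesis
      using schwartz_measurable[OF schwartz_partials[OF \<phi>]] by auto
  qed
  ultimately show ?thesis
    unfolding schwartz_def mem_Collect_eq partials_conv[OF w1 \<phi>] by blast
qed

subsection \<open>Gaussians as Schwartz functions\<close>

lemma heat_kernel_has_derivative:
  assumes "0 < t"
  shows "(heat_kernel t has_derivative (\<lambda>h. (- (heat_kernel t x / (2 * t)) *\<^sub>R x) \<bullet> h)) (at x)"
proof -
  have "((\<lambda>x. exp (- (x \<bullet> x) / (4 * t)) / (4 * pi * t)) has_derivative
      (\<lambda>h. (- (exp (- (x \<bullet> x) / (4 * t)) / (4 * pi * t) / (2 * t)) *\<^sub>R x) \<bullet> h)) (at x)"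
    using assms by (auto intro!: derivative_eq_intros simp: inner_commute)
  then show ?thesis
    by (simp add: heat_kernel_def[abs_def] power2_norm_eq_inner)
qed

lemma grad_heat_kernel: "0 < t \<Longrightarrow> grad (heat_kernel t) x = - (heat_kernel t x / (2 * t)) *\<^sub>R x"
  by (rule grad_eqI[OF heat_kernel_has_derivative])

text \<open>Every iterated derivative of a Gaussian is a polynomial times the same Gaussian; this is
  the polynomial half of that induction.\<close>

lemma real_polynomial_function_partial:
  fixes p :: "real^2 \<Rightarrow> real"
  assumes "real_polynomial_function p"
  shows "\<exists>q. real_polynomial_function q \<and> (\<forall>x. \<exists>D. (p has_derivative D) (at x) \<and> D (axis i 1) = q x)"
  using assms
proof (induction p)
  case (linear f)
  then show ?case
    by (intro exI[of _ "\<lambda>x. f (axis i 1)"])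
      (auto intro: real_polynomial_function.intros(2) bounded_linear_imp_has_derivative)
next
  case (const c)
  then show ?case
    by (intro exI[of _ "\<lambda>x. 0"]) (auto intro!: real_polynomial_function.intros(2) exI[of _ "\<lambda>_. 0"])
next
  case (add f g)
  then obtain f' g' where *: "real_polynomial_function f'" "real_polynomial_function g'"
    "\<And>x. \<exists>D. (f has_derivative D) (at x) \<and> D (axis i 1) = f' x"
    "\<And>x. \<exists>D. (g has_derivative D) (at x) \<and> D (axis i 1) = g' x" by metis
  show ?case
  proof (rule exI[of _ "\<lambda>x. f' x + g' x"], intro conjI allI real_polynomial_function.intros(3) *(1,2))
    fix x
    obtain D E where "(f has_derivative D) (at x)" "D (axis i 1) = f' x"
      "(g has_derivative E) (at x)" "E (axis i 1) = g' x" using * by metis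
    then show "\<exists>D. ((\<lambda>x. f x + g x) has_derivative D) (at x) \<and> D (axis i 1) = f' x + g' x"
      by (intro exI[of _ "\<lambda>h. D h + E h"]) (auto intro: has_derivative_add)
  qed
next
  case (mult f g)
  then obtain f' g' where *: "real_polynomial_function f'" "real_polynomial_function g'"
    "\<And>x. \<exists>D. (f has_derivative D) (at x) \<and> D (axis i 1) = f' x"
    "\<And>x. \<exists>D. (g has_derivative D) (at x) \<and> D (axis i 1) = g' x" by metis
  show ?case
  proof (rule exI[of _ "\<lambda>x. f x * g' x + f' x * g x"], intro conjI allI real_polynomial_function.intros(3)
      real_polynomial_function.intros(4) *(1,2) mult.hyps(1,2))
    fix x
    obtain D E where "(f has_derivative D) (at x)" "D (axis i 1) = f' x"
      "(g has_derivative E) (at x)" "E (axis i 1) = g' x" using * by metis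
    then show "\<exists>D. ((\<lambda>x. f x * g x) has_derivative D) (at x) \<and> D (axis i 1) = f x * g' x + f' x * g x"
      by (intro exI[of _ "\<lambda>h. f x * E h + D h * g x"]) (auto intro: has_derivative_mult)
  qed
qed

lemma real_polynomial_function_growth:
  fixes p :: "real^2 \<Rightarrow> real"
  assumes "real_polynomial_function p"
  shows "\<exists>C k. 0 \<le> C \<and> (\<forall>x. \<bar>p x\<bar> \<le> C * (1 + norm x) ^ k)"
  using assms
proof (induction p)
  case (linear f)
  then interpret bounded_linear f .
  obtain K where K: "0 \<le> K" "\<And>x. norm (f x) \<le> norm x * K" using nonneg_bounded by blast
  have "\<bar>f x\<bar> \<le> K * (1 + norm x) ^ 1" for x
    using K(2)[of x] K(1) by (simp add: algebra_simps)
  with K(1) show ?case by blast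
next
  case (const c)
  then show ?case by (intro exI[of _ "\<bar>c\<bar>"] exI[of _ 0]) auto
next
  case (add f g)
  then obtain C D k l where *: "0 \<le> C" "0 \<le> D" "\<And>x. \<bar>f x\<bar> \<le> C * (1 + norm x) ^ k" "\<And>x. \<bar>g x\<bar> \<le> D *
      (1 + norm x) ^ l"
    by metis
  have "\<bar>f x + g x\<bar> \<le> (C + D) * (1 + norm x) ^ (max k l)" for x
  proof -
    have "C * (1 + norm x) ^ k \<le> C * (1 + norm x) ^ (max k l)" "D * (1 + norm x) ^ l \<le> D * (1 + norm x) ^
        (max k l)"
      using * by (intro mult_left_mono power_increasing; simp)+
    with *(3,4)[of x] show ?thesis unfolding distrib_right by linarith
  qed
  with * show ?case by (intro exI[of _ "C + D"] exI[of _ "max k l"]) auto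
next
  case (mult f g)
  then obtain C D k l where *: "0 \<le> C" "0 \<le> D" "\<And>x. \<bar>f x\<bar> \<le> C * (1 + norm x) ^ k" "\<And>x. \<bar>g x\<bar> \<le> D *
      (1 + norm x) ^ l"
    by metis
  have "\<bar>f x * g x\<bar> \<le> (C * D) * (1 + norm x) ^ (k + l)" for x
  proof -
    have "\<bar>f x\<bar> * \<bar>g x\<bar> \<le> (C * (1 + norm x) ^ k) * (D * (1 + norm x) ^ l)"
      using * by (intro mult_mono) auto
    then show ?thesis by (simp add: abs_mult power_add mult_ac)
  qed
  with * show ?case by (intro exI[of _ "C * D"] exI[of _ "k + l"]) auto
qed

lemma partial_polynomial_gaussian:
  assumes "0 < t" "real_polynomial_function p"
  shows "\<exists>q. real_polynomial_function q \<and> partial i (\<lambda>x. p x * heat_kernel t x) =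
      (\<lambda>x. q x * heat_kernel t x)"
    and "(\<lambda>x. p x * heat_kernel t x) differentiable (at x)"
proof -
  obtain q where q: "real_polynomial_function q" "\<And>x. \<exists>D. (p has_derivative D) (at x) \<and> D (axis i 1) = q x"
    using real_polynomial_function_partial[OF assms(2), of i] by blast
  have *: "\<exists>D. ((\<lambda>x. p x * heat_kernel t x) has_derivative D) (at x) \<and>
      D (axis i 1) = (q x + p x * ((- 1 / (2 * t)) * x $ i)) * heat_kernel t x" for x
  proof -
    obtain D where "(p has_derivative D) (at x)" "D (axis i 1) = q x" using q by blast
    then show ?thesis
      by (intro exI conjI) (rule has_derivative_mult[OF _ heat_kernel_has_derivative[OF assms(1)]],
          assumption,
          simp add: algebra_simps inner_axis)
  qed
  have "partial i (\<lambda>x. p x * heat_kernel t x) = (\<lambda>x. (q x + p x * ((- 1 / (2 * t)) * x $ i)) * heat_kernel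
      t x)"
  proof
    fix x
    obtain D where "((\<lambda>x. p x * heat_kernel t x) has_derivative D) (at x)"
      "D (axis i 1) = (q x + p x * ((- 1 / (2 * t)) * x $ i)) * heat_kernel t x"
      using * by blast
    then show "partial i (\<lambda>x. p x * heat_kernel t x) x = (q x + p x * ((- 1 / (2 * t)) * x $ i)) *
        heat_kernel t x"
      by (simp add: partial_eqI)
  qed
  moreover have "real_polynomial_function (\<lambda>x. q x + p x * ((- 1 / (2 * t)) * x $ i))"
    by (intro real_polynomial_function.intros q assms bounded_linear_vec_nth)
  ultimately show "\<exists>q. real_polynomial_function q \<and> partial i (\<lambda>x. p x * heat_kernel t x) =
      (\<lambda>x. q x * heat_kernel t x)"
    by blast
  show "(\<lambda>x. p x * heat_kernel t x) differentiable (at x)"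
    using *[of x] unfolding differentiable_def by blast
qed

lemma schwartz_heat_kernel:
  assumes "0 < t"
  shows "heat_kernel t \<in> schwartz"
proof -
  have P: "\<exists>q. real_polynomial_function q \<and> partials is (heat_kernel t) = (\<lambda>x. q x * heat_kernel t x)" for
      "is"
  proof (induction "is")
    case Nil
    then show ?case by (intro exI[of _ "\<lambda>_. 1"]) (auto intro: real_polynomial_function.intros(2))
  next
    case (Cons i "is")
    then show ?case using partial_polynomial_gaussian(1)[OF assms] by (metis partials_Cons)
  qed
  show ?thesis
    unfolding schwartz_def mem_Collect_eq
  proof (intro conjI allI)
    fix "is" k
    obtain q where q: "real_polynomial_function q" "partials is (heat_kernel t) =
        (\<lambda>x. q x * heat_kernel t x)"
      using P by blast
    show "partials is (heat_kernel t) differentiable_on UNIV"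
      unfolding q(2) differentiable_on_def
      by (rule ballI, rule differentiable_at_withinI, rule partial_polynomial_gaussian(2)[OF assms q(1)])
    obtain C m where C: "0 \<le> C" "\<And>x. \<bar>q x\<bar> \<le> C * (1 + norm x) ^ m"
      using real_polynomial_function_growth[OF q(1)] by blast
    obtain D where D: "D > 0" "\<And>x. (1 + norm x) ^ (k + m) * heat_kernel t x \<le> D * heat_kernel (2 * t) x"
      using heat_kernel_moment[OF assms] by blast
    have "(1 + norm x) ^ k * \<bar>partials is (heat_kernel t) x\<bar> \<le> C * (D * (1 / (4 * pi * (2 * t))))" for x
    proof -
      have "(1 + norm x) ^ k * \<bar>q x * heat_kernel t x\<bar> \<le> (1 + norm x) ^ k *
          ((C * (1 + norm x) ^ m) * heat_kernel t x)"
        using assms C by (auto simp: abs_mult intro!: mult_left_mono mult_right_mono)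
      also have "\<dots> = C * ((1 + norm x) ^ (k + m) * heat_kernel t x)"
        by (simp add: power_add mult_ac)
      also have "\<dots> \<le> C * (D * heat_kernel (2 * t) x)"
        by (intro mult_left_mono D C)
      also have "\<dots> \<le> C * (D * (1 / (4 * pi * (2 * t))))"
        using assms C D heat_kernel_le[of "2 * t" x] by (intro mult_left_mono) auto
      finally show ?thesis by (simp add: q)
    qed
    then show "\<exists>C. \<forall>x. (1 + norm x) ^ k * \<bar>partials is (heat_kernel t) x\<bar> \<le> C" by blast
  qed
qed

subsection \<open>Integrability of Schwartz functions\<close>

text \<open>The integrand is dominated by the product of 1/(1 + x^2) in each coordinate, whose
  one-dimensional integrals are finite.\<close>

lemma nn_integral_plane_decay: "(\<integral>\<^sup>+(x::real^2). ennreal (1 / (1 + norm x) ^ 4) \<partial>lborel) < \<infinity>"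
proof -
  define I where "I = (\<integral>\<^sup>+(x::real). ennreal (1 / (1 + x\<^sup>2)) \<partial>lborel)"
  have fin: "I < \<infinity>"
    using integrable_inverse_1_plus_square
    by (simp add: I_def set_integrable_def integrable_iff_bounded divide_inverse einterval_def)
  have le: "1 / (1 + norm x) ^ 4 \<le> 1 / (1 + (x$1)\<^sup>2) * (1 / (1 + (x$2)\<^sup>2))" for x :: "real^2"
  proof -
    have "1 + (norm x)\<^sup>2 \<le> (1 + norm x)\<^sup>2" by (simp add: power2_sum)
    then have "(1 + (norm x)\<^sup>2) * (1 + (norm x)\<^sup>2) \<le> (1 + norm x)\<^sup>2 * (1 + norm x)\<^sup>2"
      by (intro mult_mono) auto
    moreover have "(1 + (x$1)\<^sup>2) * (1 + (x$2)\<^sup>2) \<le> (1 + (norm x)\<^sup>2) * (1 + (norm x)\<^sup>2)"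
      by (intro mult_mono) (auto simp: norm_plane)
    ultimately have "(1 + (x$1)\<^sup>2) * (1 + (x$2)\<^sup>2) \<le> (1 + norm x) ^ 4"
      by (simp add: power4_eq_xxxx power2_eq_square mult.assoc)
    moreover have "0 < (1 + (x$1)\<^sup>2) * (1 + (x$2)\<^sup>2)"
      by (intro mult_pos_pos) (auto intro: add_pos_nonneg)
    ultimately show ?thesis by (simp add: frac_le)
  qed
  have "(\<integral>\<^sup>+(x::real^2). ennreal (1 / (1 + norm x) ^ 4) \<partial>lborel) \<le>
     (\<integral>\<^sup>+(x::real^2). ennreal (1 / (1 + (x$1)\<^sup>2)) * ennreal (1 / (1 + (x$2)\<^sup>2)) \<partial>lborel)"
    by (intro nn_integral_mono) (use le in \<open>auto simp flip: ennreal_mult intro!: ennreal_leI\<close>)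
  also have "\<dots> = I * I"
    unfolding I_def by (rule nn_integral_plane_prod) auto
  also have "\<dots> < \<infinity>" using fin by (simp add: ennreal_mult_less_top)
  finally show ?thesis .
qed

lemma integrable_plane_decay: "integrable lborel (\<lambda>x::real^2. 1 / (1 + norm x) ^ 4)"
  using nn_integral_plane_decay by (intro integrableI_nonneg) auto

lemma integrable_of_decay:
  fixes f :: "real^2 \<Rightarrow> real"
  assumes [measurable]: "f \<in> borel_measurable borel" and "\<And>x. (1 + norm x) ^ 4 * \<bar>f x\<bar> \<le> C"
  shows "integrable lborel f"
proof (rule Bochner_Integration.integrable_bound)
  show "integrable lborel (\<lambda>x::real^2. C * (1 / (1 + norm x) ^ 4))"
    by (intro integrable_mult_right integrable_plane_decay)
  have "\<bar>f x\<bar> \<le> C * (1 / (1 + norm x) ^ 4)" for x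
  proof -
    have "0 < (1 + norm x) ^ 4" by (intro zero_less_power add_pos_nonneg) auto
    with assms(2)[of x] show ?thesis by (simp add: le_divide_eq mult.commute)
  qed
  then show "AE x in lborel. norm (f x) \<le> norm (C * (1 / (1 + norm x) ^ 4))"
    by (intro AE_I2) (auto simp: order_trans[OF _ divide_right_mono[OF abs_ge_self]])
qed measurable

lemma schwartz_moment_integrable:
  assumes "\<psi> \<in> schwartz"
  shows "integrable lborel (\<lambda>x. (1 + norm x) ^ k * \<bar>\<psi> x\<bar>)"
proof -
  note [measurable] = schwartz_measurable[OF assms]
  obtain C where "\<And>x. (1 + norm x) ^ (4 + k) * \<bar>\<psi> x\<bar> \<le> C" using schwartz_bound[OF assms] by blast
  then show ?thesis
    by (intro integrable_of_decay[where C = C]) (auto simp: power_add abs_mult mult_ac)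
qed

lemma schwartz_integrable: "\<psi> \<in> schwartz \<Longrightarrow> integrable lborel \<psi>"
  using schwartz_moment_integrable[of \<psi> 0] schwartz_measurable[of \<psi>] by (simp add: integrable_abs_iff)

subsection \<open>The heat semigroup on test functions\<close>

text \<open>The test function at which \<open>heat t T\<close> evaluates T. As the kernel is even,
  the transposed convolution is again convolution with the Gaussian, so facts about the semigroup
  are proved here and pass to distributions by duality.\<close>

definition heat_test :: "real \<Rightarrow> (real^2 \<Rightarrow> real) \<Rightarrow> real^2 \<Rightarrow> real" where
  "heat_test t \<psi> = (\<lambda>y. LINT x|lborel. heat_kernel t (x - y) * \<psi> x)"

lemma heat_eq: "heat t T \<psi> = (if \<psi> \<in> schwartz then T (heat_test t \<psi>) else 0)"
  by (simp add: heat_def heat_test_def)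

lemma heat_kernel_minus: "heat_kernel t (- x) = heat_kernel t x"
  by (simp add: heat_kernel_def)

lemma heat_test_eq_conv:
  assumes [measurable]: "\<psi> \<in> borel_measurable borel"
  shows "heat_test t \<psi> = (\<lambda>y. LINT x|lborel. heat_kernel t x * \<psi> (y - x))"
proof
  fix y
  show "heat_test t \<psi> y = (LINT x|lborel. heat_kernel t x * \<psi> (y - x))"
    unfolding heat_test_def
    using integral_lborel_reflect[of "\<lambda>x. heat_kernel t (x - y) * \<psi> x" y]
    by (simp add: heat_kernel_minus)
qed

text \<open>The two forms decide where a derivative lands: on \<open>\<psi>\<close> in the preceding
  one, which gives bounds uniform in t, and on the kernel in this one, which gives the singular
  smoothing bounds.\<close>

lemma heat_test_eq_conv': "heat_test t \<psi> = (\<lambda>y. LINT x|lborel. \<psi> x * heat_kernel t (y - x))"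
  unfolding heat_test_def by (simp add: heat_kernel_commute mult.commute)

lemma schwartz_heat_test:
  assumes "0 < t" "\<psi> \<in> schwartz"
  shows "heat_test t \<psi> \<in> schwartz"
  unfolding heat_test_eq_conv[OF schwartz_measurable[OF assms(2)]]
  using assms by (intro conv_schwartz) (auto intro: integrable_heat_kernel_moment)

lemma integral_lborel_plus:
  fixes f :: "'a::euclidean_space \<Rightarrow> 'b::{banach, second_countable_topology}"
  assumes [measurable]: "f \<in> borel_measurable borel"
  shows "(LINT x|lborel. f (c + x)) = (LINT x|lborel. f x)"
  by (subst (2) lborel_distr_plus[of c, symmetric]) (simp add: integral_distr)

lemma heat_kernel_chapman:
  assumes "0 < s" "0 < t"
  shows "integrable lborel (\<lambda>x. heat_kernel s (x - y) * heat_kernel t (z - x))"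
    and "(LINT x|lborel. heat_kernel s (x - y) * heat_kernel t (z - x)) = heat_kernel (s + t) (z - y)"
proof -
  let ?f = "\<lambda>x. heat_kernel s (x - y) * heat_kernel t (z - x)"
  have eq: "?f (y + x) = heat_kernel t ((z - y) - x) * heat_kernel s x" for x
    by (simp add: algebra_simps)
  show "(LINT x|lborel. ?f x) = heat_kernel (s + t) (z - y)"
    using integral_heat_kernel_conv[OF assms, of "z - y"] unfolding eq[symmetric]
    by (subst (asm) integral_lborel_plus) auto
  have "(\<integral>\<^sup>+x. ennreal (?f x) \<partial>lborel) = ennreal (heat_kernel (s + t) (z - y))"
    using nn_integral_heat_kernel_conv[OF assms, of "z - y"] unfolding eq[symmetric]
    by (subst (asm) nn_integral_lborel_plus) auto
  then show "integrable lborel ?f"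
    using assms by (intro integrableI_nonneg) auto
qed

lemma heat_test_heat_test:
  assumes "0 < s" "0 < t" and \<psi>: "integrable lborel \<psi>"
  shows "heat_test s (heat_test t \<psi>) = heat_test (s + t) \<psi>"
proof
  fix y
  have [measurable]: "\<psi> \<in> borel_measurable borel" using \<psi> by auto
  let ?f = "\<lambda>z x. (heat_kernel s (x - y) * heat_kernel t (z - x)) * \<psi> z"
  have int: "integrable (lborel \<Otimes>\<^sub>M lborel) (\<lambda>(z, x). ?f z x)"
  proof (rule lborel_pair.Fubini_integrable)
    have "(\<lambda>z. LINT x|lborel. norm (case (z, x) of (z, x) \<Rightarrow> ?f z x)) =
        (\<lambda>z. heat_kernel (s + t) (z - y) * \<bar>\<psi> z\<bar>)"
      using assms by (simp add: abs_mult heat_kernel_chapman)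
    moreover have "integrable lborel (\<lambda>z. \<bar>\<psi> z\<bar> *\<^sub>R heat_kernel (s + t) (z - y))"
      using assms by (intro integrable_mult_bounded[where C = "1 / (4 * pi * (s + t))"])
        (auto simp del: real_scaleR_def intro!: heat_kernel_le)
    ultimately show "integrable lborel (\<lambda>z. LINT x|lborel. norm (case (z, x) of (z, x) \<Rightarrow> ?f z x))"
      by (simp add: mult.commute)
    show "AE z in lborel. integrable lborel (\<lambda>x. case (z, x) of (z, x) \<Rightarrow> ?f z x)"
      using assms by (auto intro!: heat_kernel_chapman)
  qed measurable
  have "heat_test s (heat_test t \<psi>) y = (LINT x|lborel. LINT z|lborel. ?f z x)"
    unfolding heat_test_def by (simp add: mult.assoc)
  also have "\<dots> = (LINT z|lborel. LINT x|lborel. ?f z x)"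
    by (rule lborel_pair.Fubini_integral[OF int])
  also have "\<dots> = heat_test (s + t) \<psi> y"
    using assms by (simp add: heat_kernel_chapman heat_test_def)
  finally show "heat_test s (heat_test t \<psi>) y = heat_test (s + t) \<psi> y" .
qed

lemma heat_heat: "0 < s \<Longrightarrow> 0 < t \<Longrightarrow> heat s (heat t T) = heat (s + t) T"
  by (rule ext) (simp add: heat_eq schwartz_heat_test heat_test_heat_test schwartz_integrable add.commute)

lemma grad_heat_test:
  assumes "0 < t" "\<psi> \<in> schwartz"
  shows "grad (heat_test t \<psi>) y = (LINT x|lborel. \<psi> x *\<^sub>R grad (heat_kernel t) (y - x))"
  unfolding heat_test_eq_conv'
  by (rule grad_eqI[OF conv_has_derivative]) (use assms in \<open>auto intro: schwartz_integrable
      schwartz_heat_kernel\<close>)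

lemma grad_heat_test':
  assumes "0 < t" "\<psi> \<in> schwartz"
  shows "grad (heat_test t \<psi>) y = (LINT x|lborel. heat_kernel t x *\<^sub>R grad \<psi> (y - x))"
  unfolding heat_test_eq_conv[OF schwartz_measurable[OF assms(2)]]
  by (rule grad_eqI[OF conv_has_derivative]) (use assms in \<open>auto intro: integrable_heat_kernel\<close>)

lemma norm_grad_heat_test_le:
  assumes "0 < t" "\<psi> \<in> schwartz" "\<And>x. norm (grad \<psi> x) \<le> C"
  shows "norm (grad (heat_test t \<psi>) y) \<le> C"
proof -
  have "norm (grad (heat_test t \<psi>) y) \<le> (LINT x|lborel. heat_kernel t x * C)"
    unfolding grad_heat_test'[OF assms(1,2)] using assms
    by (intro integral_norm_le) (auto intro!: mult_left_mono integrable_heat_kernel)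
  then show ?thesis using assms by (simp add: integral_heat_kernel)
qed

text \<open>Mean value inequality on the ball of radius \<open>norm x\<close> about y. Peetre's
  inequality moves the weight from an intermediate point to y at the cost of (1 +
  \<open>norm x\<close>)^k.\<close>

lemma schwartz_difference_decay:
  assumes "\<psi> \<in> schwartz"
  obtains C where "C > 0" "\<And>x y. (1 + norm y) ^ k * \<bar>\<psi> (y - x) - \<psi> y\<bar> \<le> C * (norm x * (1 + norm x) ^ k)"
proof -
  obtain C where C: "C > 0" "\<And>x. (1 + norm x) ^ k * norm (grad \<psi> x) \<le> C"
    using schwartz_grad_bound[OF assms] by blast
  show thesis
  proof (rule that[OF C(1)])
    fix x y :: "real^2"
    have p: "0 < (1 + norm z) ^ k" for z :: "real^2" by (simp add: add_pos_nonneg)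
    have "\<bar>\<psi> (y - x) - \<psi> y\<bar> \<le> (C * (1 + norm x) ^ k / (1 + norm y) ^ k) * norm (y - x - y)"
    proof (rule differentiable_bound_inner[where S = "cball y (norm x)" and v = "grad \<psi>"])
      fix z assume z: "z \<in> cball y (norm x)"
      show "(\<psi> has_derivative (\<lambda>h. grad \<psi> z \<bullet> h)) (at z)" by (rule schwartz_has_derivative[OF assms])
      have "1 + norm y \<le> (1 + norm z) * (1 + norm (y - z))" by (rule one_plus_norm_le)
      also have "\<dots> \<le> (1 + norm z) * (1 + norm x)"
        using z by (intro mult_left_mono) (auto simp: dist_norm)
      finally have "(1 + norm y) ^ k \<le> ((1 + norm z) * (1 + norm x)) ^ k" by (intro power_mono) auto
      then have "(1 + norm y) ^ k * norm (grad \<psi> z) \<le> ((1 + norm z) * (1 + norm x)) ^ k * norm (grad \<psi> z)"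
        by (rule mult_right_mono) auto
      also have "\<dots> = (1 + norm x) ^ k * ((1 + norm z) ^ k * norm (grad \<psi> z))"
          by (simp add: power_mult_distrib)
      also have "\<dots> \<le> (1 + norm x) ^ k * C" by (intro mult_left_mono C) auto
      finally show "norm (grad \<psi> z) \<le> C * (1 + norm x) ^ k / (1 + norm y) ^ k"
        using p[of y] by (simp add: le_divide_eq mult.commute)
    qed (auto simp: dist_norm)
    then show "(1 + norm y) ^ k * \<bar>\<psi> (y - x) - \<psi> y\<bar> \<le> C * (norm x * (1 + norm x) ^ k)"
      using p[of y] by (simp add: field_simps)
  qed
qed

text \<open>Since the kernel has mass 1, the difference is an average of increments of the
  derivative, and the weighted first moment of the kernel supplies the rate sqrt t. Convergence in
  every seminorm is what a tempered distribution can be evaluated on.\<close>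

lemma heat_test_approx:
  assumes "\<psi> \<in> schwartz"
  shows "\<exists>C\<ge>0. \<forall>t. 0 < t \<and> t \<le> 1 \<longrightarrow> schwartz_seminorm k is (\<lambda>y. heat_test t \<psi> y - \<psi> y) \<le> C * sqrt t"
proof -
  let ?\<eta> = "partials is \<psi>"
  have \<eta>: "?\<eta> \<in> schwartz" by (rule schwartz_partials[OF assms])
  note [measurable] = schwartz_measurable[OF assms] schwartz_measurable[OF \<eta>]
  obtain C where C: "C > 0" "\<And>x y. (1 + norm y) ^ k * \<bar>?\<eta> (y - x) - ?\<eta> y\<bar> \<le> C * (norm x * (1 + norm x) ^ k)"
    using schwartz_difference_decay[OF \<eta>] by blast
  obtain D where D: "D > 0" "\<And>t x. 0 < t \<Longrightarrow> t \<le> 1 \<Longrightarrow> norm x * (1 + norm x) ^ k * heat_kernel t x \<le> D * sqrt t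
      * heat_kernel (4 * t) x"
    using heat_kernel_first_moment[of k] by blast
  obtain B where B: "\<And>x. \<bar>?\<eta> x\<bar> \<le> B" using schwartz_bounded[OF \<eta>] by blast
  have "schwartz_seminorm k is (\<lambda>y. heat_test t \<psi> y - \<psi> y) \<le> (C * D) * sqrt t" if t: "0 < t" "t \<le> 1" for t
  proof (rule schwartz_seminorm_le)
    fix y
    have i: "integrable lborel (\<lambda>x. heat_kernel t x * ?\<eta> (y - x))"
      using integrable_mult_bounded[OF integrable_heat_kernel[OF t(1)], of "\<lambda>x. ?\<eta> (y - x)" B] B by simp
    have "partials is (\<lambda>y. heat_test t \<psi> y - \<psi> y) y = heat_test t ?\<eta> y - ?\<eta> y"
      using partials_lincomb[OF schwartz_heat_test[OF t(1) assms] assms, of "is" 1 "-1"]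
        partials_conv[OF integrable_heat_kernel[OF t(1)] assms, of "is"]
      by (simp add: heat_test_eq_conv)
    also have "\<dots> = (LINT x|lborel. heat_kernel t x * ?\<eta> (y - x) - heat_kernel t x * ?\<eta> y)"
      using i t by (simp add: heat_test_eq_conv integrable_heat_kernel integral_heat_kernel)
    finally have "(1 + norm y) ^ k * \<bar>partials is (\<lambda>y. heat_test t \<psi> y - \<psi> y) y\<bar> =
      norm (LINT x|lborel. (1 + norm y) ^ k * (heat_kernel t x * ?\<eta> (y - x) - heat_kernel t x * ?\<eta> y))"
      by (simp add: abs_mult)
    also have "\<dots> \<le> (LINT x|lborel. C * D * sqrt t * heat_kernel (4 * t) x)"
    proof (rule integral_norm_le)
      fix x
      have "norm ((1 + norm y) ^ k * (heat_kernel t x * ?\<eta> (y - x) - heat_kernel t x * ?\<eta> y)) =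
        heat_kernel t x * ((1 + norm y) ^ k * \<bar>?\<eta> (y - x) - ?\<eta> y\<bar>)"
        using t by (simp add: abs_mult right_diff_distrib[symmetric])
      also have "\<dots> \<le> heat_kernel t x * (C * (norm x * (1 + norm x) ^ k))"
        using t by (intro mult_left_mono C) auto
      also have "\<dots> = C * (norm x * (1 + norm x) ^ k * heat_kernel t x)" by simp
      also have "\<dots> \<le> C * (D * sqrt t * heat_kernel (4 * t) x)"
        using C(1) t by (intro mult_left_mono D) auto
      finally show "norm ((1 + norm y) ^ k * (heat_kernel t x * ?\<eta> (y - x) - heat_kernel t x * ?\<eta> y)) \<le>
         C * D * sqrt t * heat_kernel (4 * t) x" by (simp add: mult.assoc)
    qed (use t in \<open>auto intro: integrable_heat_kernel\<close>)
    finally show "(1 + norm y) ^ k * \<bar>partials is (\<lambda>y. heat_test t \<psi> y - \<psi> y) y\<bar> \<le> (C * D) * sqrt t"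
      using t by (simp add: integral_heat_kernel)
  qed
  then show ?thesis using C(1) D(1) by (intro exI[of _ "C * D"]) auto
qed

subsection \<open>Tempered distributions\<close>

lemma tempered_minus:
  assumes "T \<in> tempered" "\<psi> \<in> schwartz" "\<eta> \<in> schwartz"
  shows "T (\<lambda>x. \<psi> x - \<eta> x) = T \<psi> - T \<eta>"
proof -
  have m: "(\<lambda>x. -1 * \<eta> x) \<in> schwartz" using schwartz_lincomb[OF assms(3,3), of "-1" 0] by simp
  have "T (\<lambda>x. \<psi> x + -1 * \<eta> x) = T \<psi> + T (\<lambda>x. -1 * \<eta> x)"
    using assms m unfolding tempered_def mem_Collect_eq by (elim conjE) (drule (1) bspec, drule (1) bspec)
  moreover have "T (\<lambda>x. -1 * \<eta> x) = -1 * T \<eta>"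
    using assms unfolding tempered_def mem_Collect_eq by (elim conjE) fast
  ultimately show ?thesis by simp
qed

lemma finite_multi_indices: "finite {is :: 2 list. length is \<le> N}"
  using finite_lists_length_le[of "UNIV :: 2 set" N] by simp

lemma heat_tendsto:
  assumes T: "T \<in> tempered" and \<psi>: "\<psi> \<in> schwartz"
  shows "((\<lambda>t. heat t T \<psi>) \<longlongrightarrow> T \<psi>) (at_right 0)"
proof -
  obtain C N where C: "\<And>\<psi>. \<psi> \<in> schwartz \<Longrightarrow> \<bar>T \<psi>\<bar> \<le> C * (\<Sum>is | length is \<le> N. schwartz_seminorm N is \<psi>)"
    using T unfolding tempered_def by blast
  \<comment> \<open>The constant in \<open>tempered\<close> carries no sign; passing to its absolute
    value makes the right-hand side monotone in the seminorms.\<close>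
  have C': "\<bar>T \<psi>\<bar> \<le> \<bar>C\<bar> * (\<Sum>is | length is \<le> N. schwartz_seminorm N is \<psi>)" if "\<psi> \<in> schwartz" for \<psi>
    by (rule order_trans[OF C[OF that]]) (intro mult_right_mono sum_nonneg schwartz_seminorm_nonneg that,
        auto)
  obtain D where D: "\<And>is t. 0 < t \<Longrightarrow> t \<le> 1 \<Longrightarrow> schwartz_seminorm N is (\<lambda>y. heat_test t \<psi> y - \<psi> y) \<le> D is *
      sqrt t"
    using heat_test_approx[OF \<psi>, of N] by metis
  define E where "E = \<bar>C\<bar> * (\<Sum>is | length is \<le> N. D is)"
  have "norm (heat t T \<psi> - T \<psi>) \<le> E * sqrt t" if t: "0 < t" "t \<le> 1" for t
  proof -
    have "heat t T \<psi> - T \<psi> = T (\<lambda>y. heat_test t \<psi> y - \<psi> y)"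
      using t \<psi> T by (simp add: heat_eq tempered_minus schwartz_heat_test)
    also have "\<bar>\<dots>\<bar> \<le> \<bar>C\<bar> * (\<Sum>is | length is \<le> N. schwartz_seminorm N is (\<lambda>y. heat_test t \<psi> y - \<psi> y))"
      using t \<psi> by (intro C' schwartz_minus schwartz_heat_test)
    also have "\<dots> \<le> \<bar>C\<bar> * (\<Sum>is | length is \<le> N. D is * sqrt t)"
      by (intro mult_left_mono sum_mono D t) auto
    finally show ?thesis by (simp add: E_def sum_distrib_right mult.assoc)
  qed
  moreover have "\<forall>\<^sub>F t in at_right 0. 0 < t \<and> t \<le> (1::real)"
    unfolding eventually_at_right_field by (intro exI[of _ 1]) auto
  ultimately have "\<forall>\<^sub>F t in at_right 0. norm (heat t T \<psi> - T \<psi>) \<le> E * sqrt t"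
    by (auto elim: eventually_mono)
  moreover have "((\<lambda>t. E * sqrt t) \<longlongrightarrow> 0) (at_right 0)"
    by (intro tendsto_mult_right_zero) (use tendsto_real_sqrt[OF tendsto_ident_at, of 0 "{0<..}"] in simp)
  ultimately have "((\<lambda>t. heat t T \<psi> - T \<psi>) \<longlongrightarrow> 0) (at_right 0)"
    by (rule Lim_null_comparison)
  then show ?thesis by (simp add: LIM_zero_iff)
qed

subsection \<open>The spaces \<open>L\<^sup>4\<^sup>/\<^sup>3\<close> and \<open>L\<^sup>4\<close>\<close>

text \<open>A bound on the norm instead of the norm itself: duality, Fatou and series all produce
  upper bounds, and a real bound avoids any treatment of infinite norms.\<close>

definition L43 :: "(real^2 \<Rightarrow> real) \<Rightarrow> real \<Rightarrow> bool" where
  "L43 f A \<longleftrightarrow> f \<in> borel_measurable borel \<and> 0 \<le> A \<and>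
     (\<integral>\<^sup>+x. ennreal (\<bar>f x\<bar> powr (4/3)) \<partial>lborel) \<le> ennreal (A powr (4/3))"

definition L4 :: "(real^2 \<Rightarrow> real) \<Rightarrow> real \<Rightarrow> bool" where
  "L4 f B \<longleftrightarrow> f \<in> borel_measurable borel \<and> 0 \<le> B \<and>
     (\<integral>\<^sup>+x. ennreal (f x ^ 4) \<partial>lborel) \<le> ennreal (B ^ 4)"

definition norm4 :: "(real^2 \<Rightarrow> real) \<Rightarrow> real" where
  "norm4 f = root 4 (LINT x|lborel. f x ^ 4)"

lemma L43_measurable [measurable_dest]: "L43 f A \<Longrightarrow> f \<in> borel_measurable borel"
  by (simp add: L43_def)

lemma L4_measurable [measurable_dest]: "L4 f A \<Longrightarrow> f \<in> borel_measurable borel"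
  by (simp add: L4_def)

lemma L43_nonneg: "L43 f A \<Longrightarrow> 0 \<le> A" by (simp add: L43_def)

lemma L43_mono:
  assumes "L43 f A" "A \<le> B" shows "L43 f B"
proof -
  have "ennreal (A powr (4/3)) \<le> ennreal (B powr (4/3))"
    using assms by (auto simp: L43_def intro!: ennreal_leI powr_mono2)
  with assms show ?thesis unfolding L43_def by (meson order_trans)
qed

lemma L4_mono:
  assumes "L4 f A" "A \<le> B" shows "L4 f B"
proof -
  have "ennreal (A ^ 4) \<le> ennreal (B ^ 4)"
    using assms by (auto simp: L4_def intro!: ennreal_leI power_mono)
  with assms show ?thesis unfolding L4_def by (meson order_trans)
qed

lemma norm4_nonneg: "0 \<le> norm4 f"
  by (simp add: norm4_def integral_nonneg_AE)

lemma norm4_pow: "norm4 f ^ 4 = (LINT x|lborel. f x ^ 4)"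
  unfolding norm4_def by (rule real_root_pow_pos2) (auto intro: integral_nonneg_AE)

lemma L4_norm4:
  assumes "f \<in> borel_measurable borel" "integrable lborel (\<lambda>x. f x ^ 4)"
  shows "L4 f (norm4 f)"
  using assms nn_integral_eq_integral[OF assms(2)]
  by (simp add: L4_def norm4_nonneg norm4_pow)

lemma schwartz_integrable_pow4:
  assumes "\<psi> \<in> schwartz"
  shows "integrable lborel (\<lambda>x. \<psi> x ^ 4)"
proof -
  note [measurable] = schwartz_measurable[OF assms]
  obtain C where C: "\<And>x. \<bar>\<psi> x\<bar> \<le> C" using schwartz_bounded[OF assms] by blast
  have "\<bar>\<psi> x ^ 3\<bar> \<le> C ^ 3" for x
    by (simp add: power_abs power_mono C)
  then have "integrable lborel (\<lambda>x. \<psi> x *\<^sub>R \<psi> x ^ 3)"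
    by (intro integrable_mult_bounded[of _ _ _ "C ^ 3"] schwartz_integrable[OF assms]) auto
  then show ?thesis by (simp add: power3_eq_cube power4_eq_xxxx mult.assoc)
qed

lemma L4_schwartz: "\<psi> \<in> schwartz \<Longrightarrow> L4 \<psi> (norm4 \<psi>)"
  by (intro L4_norm4 schwartz_integrable_pow4) (auto intro: schwartz_measurable)

lemma Holder_pos:
  assumes f: "L43 f A" and g: "L4 g B" and AB: "0 < A" "0 < B"
  shows "(\<integral>\<^sup>+x. ennreal \<bar>f x * g x\<bar> \<partial>lborel) \<le> ennreal (A * B)"
proof -
  note [measurable] = L43_measurable[OF f] L4_measurable[OF g]
  let ?a = "A * B * (3/4) / (A powr (4/3))" and ?b = "A * B * (1/4) / (B ^ 4)"
  have le: "\<bar>f x * g x\<bar> \<le> ?a * (\<bar>f x\<bar> powr (4/3)) + ?b * (g x ^ 4)" for x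
  proof -
    have "(\<bar>f x\<bar> / A) * (\<bar>g x\<bar> / B) \<le> (\<bar>f x\<bar> / A) powr (4/3) / (4/3) + (\<bar>g x\<bar> / B) powr 4 / 4"
      using AB by (intro Youngs_inequality) auto
    also have "(\<bar>f x\<bar> / A) powr (4/3) = \<bar>f x\<bar> powr (4/3) / A powr (4/3)"
      using AB by (simp add: powr_divide)
    also have "(\<bar>g x\<bar> / B) powr 4 = g x ^ 4 / B ^ 4"
      using AB by (simp add: power_divide)
    finally have "A * B * ((\<bar>f x\<bar> / A) * (\<bar>g x\<bar> / B)) \<le> A * B *
        (\<bar>f x\<bar> powr (4/3) / A powr (4/3) / (4/3) + g x ^ 4 / B ^ 4 / 4)"
      using AB by (intro mult_left_mono) auto
    then show ?thesis using AB by (simp add: abs_mult distrib_left)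
  qed
  have "(\<integral>\<^sup>+x. ennreal \<bar>f x * g x\<bar> \<partial>lborel) \<le>
    (\<integral>\<^sup>+x. ennreal ?a * ennreal (\<bar>f x\<bar> powr (4/3)) + ennreal ?b * ennreal (g x ^ 4) \<partial>lborel)"
    using AB le by (intro nn_integral_mono) (simp flip: ennreal_mult ennreal_plus add: ennreal_leI)
  also have "\<dots> = ennreal ?a * (\<integral>\<^sup>+x. ennreal (\<bar>f x\<bar> powr (4/3)) \<partial>lborel) + ennreal ?b *
      (\<integral>\<^sup>+x. ennreal (g x ^ 4) \<partial>lborel)"
    by (simp add: nn_integral_add nn_integral_cmult)
  also have "\<dots> \<le> ennreal ?a * ennreal (A powr (4/3)) + ennreal ?b * ennreal (B ^ 4)"
    using f g by (intro add_mono mult_left_mono) (auto simp: L43_def L4_def)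
  also have "\<dots> = ennreal (?a * A powr (4/3) + ?b * B ^ 4)"
    using AB by (simp flip: ennreal_mult ennreal_plus)
  also have "?a * A powr (4/3) + ?b * B ^ 4 = A * B"
    using AB by simp
  finally show ?thesis .
qed

text \<open>Normalization in the previous lemma divides by both bounds. Bounds that may vanish, such
  as \<open>norm4 \<psi>\<close> or the norm of the datum, are reached by enlarging them by d and
  letting d tend to 0.\<close>

lemma Holder:
  assumes f: "L43 f A" and g: "L4 g B"
  shows "(\<integral>\<^sup>+x. ennreal \<bar>f x * g x\<bar> \<partial>lborel) \<le> ennreal (A * B)"
proof (rule tendsto_lowerbound[of _ _ "at_right (0::real)"])
  have AB: "0 \<le> A" "0 \<le> B" using f g by (auto simp: L43_def L4_def)
  have "((\<lambda>d. (A + d) * (B + d)) \<longlongrightarrow> (A + 0) * (B + 0)) (at_right 0)"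
    by (intro tendsto_intros)
  then show "((\<lambda>d. ennreal ((A + d) * (B + d))) \<longlongrightarrow> ennreal (A * B)) (at_right 0)"
    by (intro tendsto_ennrealI) simp
  show "\<forall>\<^sub>F d in at_right 0. (\<integral>\<^sup>+x. ennreal \<bar>f x * g x\<bar> \<partial>lborel) \<le> ennreal ((A + d) * (B + d))"
    unfolding eventually_at_right_field
    by (intro exI[of _ 1]) (use AB in \<open>auto intro!: Holder_pos L43_mono[OF f] L4_mono[OF g]\<close>)
qed simp

lemma Holder_integrable:
  assumes "L43 f A" "L4 g B"
  shows "integrable lborel (\<lambda>x. f x * g x)" and "\<bar>LINT x|lborel. f x * g x\<bar> \<le> A * B"
proof -
  note [measurable] = L43_measurable[OF assms(1)] L4_measurable[OF assms(2)]
  have *: "(\<integral>\<^sup>+x. ennreal (norm (f x * g x)) \<partial>lborel) \<le> ennreal (A * B)"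
    using Holder[OF assms] by simp
  then show i: "integrable lborel (\<lambda>x. f x * g x)"
    by (intro integrableI_bounded) (auto simp: le_less_trans)
  have AB: "0 \<le> A * B" using assms by (auto simp: L43_def L4_def)
  have "ennreal (norm (LINT x|lborel. f x * g x)) \<le> ennreal (A * B)"
    by (rule order_trans[OF integral_norm_bound_ennreal[OF i] *])
  then show "\<bar>LINT x|lborel. f x * g x\<bar> \<le> A * B"
    using AB by (simp add: ennreal_le_iff)
qed

subsection \<open>Duality\<close>

text \<open>Integrability is part of the definition because a divergent pairing has the value 0 and
  would satisfy the inequality vacuously.\<close>

definition dual_bounded :: "(real^2 \<Rightarrow> real) \<Rightarrow> real \<Rightarrow> bool" where
  "dual_bounded h A \<longleftrightarrow> h \<in> borel_measurable borel \<and> 0 \<le> A \<and>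
     (\<forall>\<psi>\<in>schwartz. integrable lborel (\<lambda>x. h x * \<psi> x) \<and> \<bar>LINT x|lborel. h x * \<psi> x\<bar> \<le> A * norm4 \<psi>)"

lemma first_moment_heat_kernel:
  obtains D where "D > 0" "\<And>t. 0 < t \<Longrightarrow> t \<le> 1 \<Longrightarrow> integrable lborel (\<lambda>x. heat_kernel t x * norm x)"
    "\<And>t. 0 < t \<Longrightarrow> t \<le> 1 \<Longrightarrow> (LINT x|lborel. heat_kernel t x * norm x) \<le> D * sqrt t"
proof -
  obtain D where D: "D > 0" "\<And>t x. 0 < t \<Longrightarrow> t \<le> 1 \<Longrightarrow> norm x * (1 + norm x) ^ 0 * heat_kernel t x \<le> D * sqrt t
      * heat_kernel (4 * t) x"
    using heat_kernel_first_moment[of 0] by blast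
  show thesis
  proof (rule that[OF D(1)])
    fix t :: real assume t: "0 < t" "t \<le> 1"
    have le: "heat_kernel t x * norm x \<le> D * sqrt t * heat_kernel (4 * t) x" for x
      using D(2)[OF t, of x] by (simp add: mult.commute)
    have i: "integrable lborel (\<lambda>x. D * sqrt t * heat_kernel (4 * t) x)"
      using t by (intro integrable_mult_right integrable_heat_kernel) auto
    show i2: "integrable lborel (\<lambda>x. heat_kernel t x * norm x)"
      by (rule Bochner_Integration.integrable_bound[OF i])
        (use t D(1) in \<open>auto intro!: AE_I2 order_trans[OF le]\<close>)
    have "(LINT x|lborel. heat_kernel t x * norm x) \<le> (LINT x|lborel. D * sqrt t * heat_kernel (4 * t) x)"
      by (rule integral_mono[OF i2 i le])
    then show "(LINT x|lborel. heat_kernel t x * norm x) \<le> D * sqrt t"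
      using t by (simp add: integral_heat_kernel)
  qed
qed

lemma heat_test_tendsto_pointwise:
  fixes \<tau> :: "nat \<Rightarrow> real"
  assumes g: "continuous_on UNIV g" "\<And>x. \<bar>g x\<bar> \<le> R"
    and \<tau>: "\<And>n. 0 < \<tau> n" "\<And>n. \<tau> n \<le> 1" "\<tau> \<longlonglongrightarrow> 0"
  shows "(\<lambda>n. heat_test (\<tau> n) g y) \<longlonglongrightarrow> g y"
proof (rule tendstoI)
  fix e :: real assume e: "0 < e"
  have [measurable]: "g \<in> borel_measurable borel" using g by (intro borel_measurable_continuous_onI)
  have R: "0 \<le> R" using g(2)[of 0] by linarith
  obtain D where D: "D > 0" "\<And>t. 0 < t \<Longrightarrow> t \<le> 1 \<Longrightarrow> integrable lborel (\<lambda>x. heat_kernel t x * norm x)"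
    "\<And>t. 0 < t \<Longrightarrow> t \<le> 1 \<Longrightarrow> (LINT x|lborel. heat_kernel t x * norm x) \<le> D * sqrt t"
    using first_moment_heat_kernel by blast
  obtain d where d: "0 < d" "\<And>x. dist x y < d \<Longrightarrow> dist (g x) (g y) < e / 2"
    using g(1) e unfolding continuous_on_iff by (metis UNIV_I half_gt_zero)
  have est: "dist (heat_test t g y) (g y) \<le> e / 2 + (2 * R / d) * (D * sqrt t)" if t: "0 < t" "t \<le> 1" for t
  proof -
    have i: "integrable lborel (\<lambda>x. heat_kernel t x * g (y - x))"
      using integrable_mult_bounded[OF integrable_heat_kernel[OF t(1)], of "\<lambda>x. g (y - x)" R] g by simp
    \<comment> \<open>Near and far increments share one bound: beyond distance d the factor
      \<open>norm x\<close> / d is at least 1, so the linear term alone covers 2R. Only the first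
      moment of the kernel is then needed.\<close>
    have pt: "\<bar>g (y - x) - g y\<bar> \<le> e / 2 + (2 * R / d) * norm x" for x
    proof (cases "norm x < d")
      case True
      have "0 \<le> (2 * R / d) * norm x" using R d by simp
      with True d(2)[of "y - x"] show ?thesis by (simp add: dist_norm)
    next
      case False
      have "2 * R * d \<le> 2 * R * norm x" using False R by (intro mult_left_mono) auto
      then have "2 * R \<le> (2 * R / d) * norm x" using d by (simp add: field_simps)
      then show ?thesis using g(2)[of "y - x"] g(2)[of y] e by linarith
    qed
    have "heat_test t g y - g y = (LINT x|lborel. heat_kernel t x * g (y - x) - heat_kernel t x * g y)"
      using i t by (simp add: heat_test_eq_conv integrable_heat_kernel integral_heat_kernel)
    also have "norm \<dots> \<le> (LINT x|lborel. heat_kernel t x * (e / 2) + (2 * R / d) *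
        (heat_kernel t x * norm x))"
    proof (rule integral_norm_le)
      fix x
      have "norm (heat_kernel t x * g (y - x) - heat_kernel t x * g y) = heat_kernel t x * \<bar>g (y - x) - g
          y\<bar>"
        using t by (simp add: abs_mult right_diff_distrib[symmetric])
      also have "\<dots> \<le> heat_kernel t x * (e / 2 + (2 * R / d) * norm x)"
        using t by (intro mult_left_mono pt) auto
      finally show "norm (heat_kernel t x * g (y - x) - heat_kernel t x * g y) \<le>
         heat_kernel t x * (e / 2) + (2 * R / d) * (heat_kernel t x * norm x)" by (simp add: algebra_simps)
    next
      show "integrable lborel (\<lambda>x. heat_kernel t x * (e / 2) + (2 * R / d) * (heat_kernel t x * norm x))"
        by (intro Bochner_Integration.integrable_add integrable_mult_left integrable_mult_right
            integrable_heat_kernel D t)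
    qed
    also have "\<dots> = e / 2 + (2 * R / d) * (LINT x|lborel. heat_kernel t x * norm x)"
      using t D(2)[OF t] by (simp add: integrable_heat_kernel integral_heat_kernel)
    also have "\<dots> \<le> e / 2 + (2 * R / d) * (D * sqrt t)"
      using R d t by (intro add_left_mono mult_left_mono D) auto
    finally show ?thesis by (simp add: dist_norm)
  qed
  have "(\<lambda>n. (2 * R / d) * (D * sqrt (\<tau> n))) \<longlonglongrightarrow> (2 * R / d) * (D * sqrt 0)"
    by (intro tendsto_intros \<tau>)
  then have "\<forall>\<^sub>F n in sequentially. (2 * R / d) * (D * sqrt (\<tau> n)) < e / 2"
    using e by (intro order_tendstoD) auto
  then show "\<forall>\<^sub>F n in sequentially. dist (heat_test (\<tau> n) g y) (g y) < e"
  proof eventually_elim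
    case (elim n)
    with est[OF \<tau>(1)[of n] \<tau>(2)[of n]] show ?case by linarith
  qed
qed

text \<open>Jensen's inequality for the fourth power, from the tangent line at the mean m; the
  kernel is a probability density.\<close>

lemma heat_test_pow4_le:
  assumes t: "0 < t" and [measurable]: "g \<in> borel_measurable borel" and R: "\<And>x. \<bar>g x\<bar> \<le> R"
  shows "heat_test t g y ^ 4 \<le> (LINT x|lborel. heat_kernel t (x - y) * g x ^ 4)"
proof -
  define m where "m = heat_test t g y"
  have G: "integrable lborel (\<lambda>x. heat_kernel t (x - y))" "(LINT x|lborel. heat_kernel t (x - y)) = 1"
  proof -
    have *: "(\<integral>\<^sup>+x. ennreal (heat_kernel t (x - y)) \<partial>lborel) = 1"
      using nn_integral_lborel_minus[of "\<lambda>x. ennreal (heat_kernel t x)" y] t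
          by (simp add: nn_integral_heat_kernel)
    then show "integrable lborel (\<lambda>x. heat_kernel t (x - y))"
      using t by (intro integrableI_nonneg) auto
    show "(LINT x|lborel. heat_kernel t (x - y)) = 1"
      using * t by (subst integral_eq_nn_integral) auto
  qed
  have i1: "integrable lborel (\<lambda>x. heat_kernel t (x - y) * g x)"
    using integrable_mult_bounded[OF G(1), of g R] R by simp
  have "\<bar>g x ^ 4\<bar> \<le> R ^ 4" for x
    unfolding power_abs by (intro power_mono R) auto
  then have i4: "integrable lborel (\<lambda>x. heat_kernel t (x - y) * g x ^ 4)"
    using integrable_mult_bounded[OF G(1), of "\<lambda>x. g x ^ 4" "R ^ 4"] by simp
  have conv: "4 * m ^ 3 * z - 3 * m ^ 4 \<le> z ^ 4" for z
  proof -
    have "z ^ 4 - (4 * m ^ 3 * z - 3 * m ^ 4) = (z - m)\<^sup>2 * ((z + m)\<^sup>2 + 2 * m\<^sup>2)"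
      by (simp add: power2_eq_square power3_eq_cube power4_eq_xxxx algebra_simps)
    also have "\<dots> \<ge> 0" by simp
    finally show ?thesis by simp
  qed
  have "m ^ 4 = 4 * m ^ 3 * m - 3 * m ^ 4" by (simp add: power3_eq_cube power4_eq_xxxx)
  also have "\<dots> = 4 * m ^ 3 * (LINT x|lborel. heat_kernel t (x - y) * g x) - 3 * m ^ 4 *
      (LINT x|lborel. heat_kernel t (x - y))"
    using G by (simp add: m_def heat_test_def)
  also have "\<dots> = (LINT x|lborel. 4 * m ^ 3 * (heat_kernel t (x - y) * g x) - 3 * m ^ 4 * heat_kernel t
      (x - y))"
    using i1 G by simp
  also have "\<dots> \<le> (LINT x|lborel. heat_kernel t (x - y) * g x ^ 4)"
  proof (rule integral_mono)
    fix x
    have "heat_kernel t (x - y) * (4 * m ^ 3 * g x - 3 * m ^ 4) \<le> heat_kernel t (x - y) * g x ^ 4"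
      using t by (intro mult_left_mono conv) auto
    then show "4 * m ^ 3 * (heat_kernel t (x - y) * g x) - 3 * m ^ 4 * heat_kernel t (x - y) \<le> heat_kernel
        t (x - y) * g x ^ 4"
      by (simp add: algebra_simps)
  qed (use i1 i4 G in auto)
  finally show ?thesis by (simp add: m_def)
qed

lemma heat_test_norm4_le:
  assumes t: "0 < t" and [measurable]: "g \<in> borel_measurable borel" and R: "\<And>x. \<bar>g x\<bar> \<le> R"
    and i: "integrable lborel (\<lambda>x. g x ^ 4)"
  shows "norm4 (heat_test t g) \<le> norm4 g"
proof -
  have [measurable]: "heat_test t g \<in> borel_measurable borel"
    unfolding heat_test_def by measurable
  have "(\<integral>\<^sup>+y. ennreal (heat_test t g y ^ 4) \<partial>lborel) \<le>
    (\<integral>\<^sup>+y. \<integral>\<^sup>+x. ennreal (heat_kernel t (x - y)) * ennreal (g x ^ 4) \<partial>lborel \<partial>lborel)"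
  proof (rule nn_integral_mono)
    fix y
    have "ennreal (heat_test t g y ^ 4) \<le> ennreal (LINT x|lborel. heat_kernel t (x - y) * g x ^ 4)"
      by (intro ennreal_leI heat_test_pow4_le[OF t _ R]) measurable
    \<comment> \<open>An infinite value is sent to 0 by \<open>enn2real\<close>, so the inequality
      holds whether or not the integral is finite.\<close>
    also have "\<dots> \<le> (\<integral>\<^sup>+x. ennreal (heat_kernel t (x - y) * g x ^ 4) \<partial>lborel)"
      using t by (subst integral_eq_nn_integral) (auto simp: ennreal_enn2real_if)
    finally show "ennreal (heat_test t g y ^ 4) \<le>
        (\<integral>\<^sup>+x. ennreal (heat_kernel t (x - y)) * ennreal (g x ^ 4) \<partial>lborel)"
      using t by (simp add: ennreal_mult)
  qed
  also have "\<dots> = (\<integral>\<^sup>+x. \<integral>\<^sup>+y. ennreal (heat_kernel t (x - y)) * ennreal (g x ^ 4) \<partial>lborel \<partial>lborel)"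
    by (rule lborel_pair.Fubini') measurable
  also have "\<dots> = (\<integral>\<^sup>+x. ennreal (g x ^ 4) \<partial>lborel)"
    using t by (simp add: nn_integral_multc nn_integral_lborel_reflect[of "\<lambda>x. ennreal (heat_kernel t x)"]
        nn_integral_heat_kernel)
  also have "\<dots> = ennreal (LINT x|lborel. g x ^ 4)"
    using i by (intro nn_integral_eq_integral) auto
  finally have le: "(\<integral>\<^sup>+y. ennreal (heat_test t g y ^ 4) \<partial>lborel) \<le> ennreal (LINT x|lborel. g x ^ 4)" .
  then have "integrable lborel (\<lambda>y. heat_test t g y ^ 4)"
    by (intro integrableI_nonneg) (auto simp: le_less_trans)
  from nn_integral_eq_integral[OF this] le have "(LINT y|lborel. heat_test t g y ^ 4) \<le>
      (LINT x|lborel. g x ^ 4)"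
    by (simp add: ennreal_le_iff integral_nonneg_AE)
  then show ?thesis unfolding norm4_def by (intro real_root_le_mono) auto
qed

text \<open>A Gaussian is a Schwartz function that majorizes the indicator of a ball. Integrability
  of h against it therefore gives local integrability of h.\<close>

lemma ball_le_heat_kernel: "\<exists>C>0. \<forall>x. norm x \<le> r \<longrightarrow> 1 \<le> C * heat_kernel 1 x \<and> 1 \<le> C * heat_kernel 2 x"
proof -
  let ?C = "8 * pi * exp (r\<^sup>2)"
  have "1 \<le> ?C * heat_kernel 1 x \<and> 1 \<le> ?C * heat_kernel 2 x" if "norm x \<le> r" for x :: "real^2"
  proof -
    have "(norm x)\<^sup>2 \<le> r\<^sup>2" using that by (intro power_mono) auto
    then have "0 \<le> r\<^sup>2 - (norm x)\<^sup>2 / 4" "0 \<le> r\<^sup>2 - (norm x)\<^sup>2 / 8"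
      using zero_le_power2[of "norm x"] by linarith+
    then have "1 \<le> exp (r\<^sup>2 - (norm x)\<^sup>2 / 4)" "1 \<le> exp (r\<^sup>2 - (norm x)\<^sup>2 / 8)"
      by (simp_all only: one_le_exp_iff)
    moreover have "?C * heat_kernel 1 x = 2 * exp (r\<^sup>2 - (norm x)\<^sup>2 / 4)"
      "?C * heat_kernel 2 x = exp (r\<^sup>2 - (norm x)\<^sup>2 / 8)"
      by (simp_all add: heat_kernel_def mult_exp_exp)
    ultimately show ?thesis by linarith
  qed
  then show ?thesis by (intro exI[of _ ?C]) auto
qed

text \<open>Mollification by the heat flow produces admissible test functions whose L^4 norm does
  not exceed that of g and which are all dominated by one Gaussian, so the pairings with h
  converge.\<close>

lemma dual_bounded_continuous:
  assumes h: "dual_bounded h A" and g: "continuous_on UNIV g" "\<And>x. \<bar>g x\<bar> \<le> R" "\<And>x. r < norm x \<Longrightarrow> g x = 0"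
  shows "\<bar>LINT x|lborel. h x * g x\<bar> \<le> A * norm4 g"
proof -
  have [measurable]: "h \<in> borel_measurable borel" using h by (simp add: dual_bounded_def)
  have [measurable]: "g \<in> borel_measurable borel" using g by (intro borel_measurable_continuous_onI)
  have R: "0 \<le> R" using g(2)[of 0] by linarith
  obtain C where C: "C > 0" "\<And>x::real^2. norm x \<le> r \<Longrightarrow> 1 \<le> C * heat_kernel 1 x"
    using ball_le_heat_kernel[of r] by blast
  have gC: "\<bar>g x\<bar> \<le> R * C * heat_kernel 1 x" for x
  proof (cases "norm x \<le> r")
    case True
    then have "R * 1 \<le> R * (C * heat_kernel 1 x)" using C R by (intro mult_left_mono) auto
    with g(2)[of x] show ?thesis by (simp add: mult.assoc)
  next
    case False
    then show ?thesis using g(3)[of x] R C by simp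
  qed
  have ig: "integrable lborel (\<lambda>x. (1 + norm x) ^ k * \<bar>g x\<bar>)" for k
  proof (rule Bochner_Integration.integrable_bound)
    show "integrable lborel (\<lambda>x. R * C * ((1 + norm x) ^ k * heat_kernel 1 x))"
      by (intro integrable_mult_right integrable_heat_kernel_moment) simp
    have "(1 + norm x) ^ k * \<bar>g x\<bar> \<le> (1 + norm x) ^ k * (R * C * heat_kernel 1 x)" for x
      by (intro mult_left_mono gC) auto
    then show "AE x in lborel. norm ((1 + norm x) ^ k * \<bar>g x\<bar>) \<le> norm
        (R * C * ((1 + norm x) ^ k * heat_kernel 1 x))"
      using R C by (intro AE_I2) (auto simp: abs_mult mult_ac)
  qed measurable
  have ig1: "integrable lborel g" using ig[of 0] by (simp add: integrable_abs_iff)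
  have i4: "integrable lborel (\<lambda>x. g x ^ 4)"
  proof -
    have "\<bar>g x ^ 3\<bar> \<le> R ^ 3" for x
      unfolding power_abs by (intro power_mono g) auto
    then have "integrable lborel (\<lambda>x. g x *\<^sub>R g x ^ 3)"
      by (intro integrable_mult_bounded[OF ig1, of _ "R ^ 3"]) auto
    then show ?thesis by (simp add: power3_eq_cube power4_eq_xxxx mult.assoc)
  qed
  define \<tau> where "\<tau> n = inverse (real (Suc n))" for n
  have \<tau>: "0 < \<tau> n" "\<tau> n \<le> 1" "\<tau> \<longlonglongrightarrow> 0" for n
    using LIMSEQ_inverse_real_of_nat by (auto simp: \<tau>_def[abs_def] field_simps)
  have S: "heat_test (\<tau> n) g \<in> schwartz" for n
    unfolding heat_test_eq_conv' by (intro conv_schwartz ig schwartz_heat_kernel \<tau>) measurable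
  have b: "\<bar>heat_test (\<tau> n) g y\<bar> \<le> 2 * R * C * heat_kernel 2 y" for n y
  proof -
    have "norm (heat_test (\<tau> n) g y) \<le> (LINT x|lborel. R * C *
        (heat_kernel (\<tau> n) (y - x) * heat_kernel 1 x))"
      unfolding heat_test_def
    proof (rule integral_norm_le)
      show "integrable lborel (\<lambda>x. R * C * (heat_kernel (\<tau> n) (y - x) * heat_kernel 1 x))"
        using \<tau> by (intro integrable_mult_right integrable_heat_kernel_conv) auto
      show "norm (heat_kernel (\<tau> n) (x - y) * g x) \<le> R * C * (heat_kernel (\<tau> n) (y - x) * heat_kernel 1 x)"
          for x
        using mult_left_mono[OF gC[of x], of "heat_kernel (\<tau> n) (x - y)"] \<tau>(1)[of n]
        by (simp add: abs_mult heat_kernel_commute[of _ x y] mult.left_commute)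
    qed
    also have "\<dots> = R * C * heat_kernel (1 + \<tau> n) y"
      using \<tau>(1)[of n] by (simp add: integral_heat_kernel_conv)
    \<comment> \<open>The mollification times are at most 1, so the total time 1 +
      \<open>\<tau> n\<close> lies between 1 and 2 and the kernel at time 2 dominates with factor 2,
      uniformly in n.\<close>
    also have "\<dots> \<le> R * C * (2 * heat_kernel 2 y)"
    proof (intro mult_left_mono)
      have "heat_kernel (1 + \<tau> n) y / 2 \<le> ((1 + \<tau> n) / 2) * heat_kernel (1 + \<tau> n) y"
        using \<tau>(1)[of n] heat_kernel_nonneg[of "1 + \<tau> n" y] by (simp add: algebra_simps)
      also have "\<dots> \<le> heat_kernel 2 y"
        using \<tau>(1,2)[of n] by (intro heat_kernel_compare) auto
      finally show "heat_kernel (1 + \<tau> n) y \<le> 2 * heat_kernel 2 y" by simp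
    qed (use R C in auto)
    finally show ?thesis by (simp add: mult_ac)
  qed
  have "(\<lambda>n. LINT x|lborel. h x * heat_test (\<tau> n) g x) \<longlonglongrightarrow> (LINT x|lborel. h x * g x)"
  proof (rule integral_dominated_convergence)
    show "integrable lborel (\<lambda>x. 2 * R * C * \<bar>h x * heat_kernel 2 x\<bar>)"
      using h schwartz_heat_kernel[of 2]
          by (intro integrable_mult_right integrable_abs) (auto simp: dual_bounded_def)
    show "AE x in lborel. (\<lambda>n. h x * heat_test (\<tau> n) g x) \<longlonglongrightarrow> h x * g x"
      by (intro AE_I2 tendsto_mult_left heat_test_tendsto_pointwise[OF g(1,2) \<tau>])
    show "AE x in lborel. norm (h x * heat_test (\<tau> n) g x) \<le> 2 * R * C * \<bar>h x * heat_kernel 2 x\<bar>" for n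
    proof (rule AE_I2)
      fix x
      have "\<bar>h x\<bar> * \<bar>heat_test (\<tau> n) g x\<bar> \<le> \<bar>h x\<bar> * (2 * R * C * heat_kernel 2 x)"
        by (intro mult_left_mono b) auto
      then show "norm (h x * heat_test (\<tau> n) g x) \<le> 2 * R * C * \<bar>h x * heat_kernel 2 x\<bar>"
        by (simp add: abs_mult mult_ac)
    qed
    show "(\<lambda>x. h x * heat_test (\<tau> n) g x) \<in> borel_measurable lborel" for n
      using schwartz_measurable[OF S] by measurable
  qed measurable
  then have "(\<lambda>n. \<bar>LINT x|lborel. h x * heat_test (\<tau> n) g x\<bar>) \<longlonglongrightarrow> \<bar>LINT x|lborel. h x * g x\<bar>"
    by (rule tendsto_rabs)
  moreover have "\<bar>LINT x|lborel. h x * heat_test (\<tau> n) g x\<bar> \<le> A * norm4 g" for n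
  proof -
    have "\<bar>LINT x|lborel. h x * heat_test (\<tau> n) g x\<bar> \<le> A * norm4 (heat_test (\<tau> n) g)"
      using h S by (auto simp: dual_bounded_def)
    also have "\<dots> \<le> A * norm4 g"
      using h by (intro mult_left_mono heat_test_norm4_le[OF \<tau>(1) _ g(2) i4]) (auto simp: dual_bounded_def)
    finally show ?thesis .
  qed
  ultimately show ?thesis by (intro LIMSEQ_le_const2) auto
qed

lemma dual_bounded_integrable_ball:
  assumes h: "dual_bounded h A" and [measurable]: "\<phi> \<in> borel_measurable borel"
    and R: "\<And>x. \<bar>\<phi> x\<bar> \<le> R" "\<And>x. r < norm x \<Longrightarrow> \<phi> x = 0"
  shows "integrable lborel (\<lambda>x. h x * \<phi> x)"
proof -
  have [measurable]: "h \<in> borel_measurable borel" using h by (simp add: dual_bounded_def)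
  obtain C where C: "C > 0" "\<And>x::real^2. norm x \<le> r \<Longrightarrow> 1 \<le> C * heat_kernel 2 x"
    using ball_le_heat_kernel[of r] by blast
  have R0: "0 \<le> R" using R(1)[of 0] by linarith
  show ?thesis
  proof (rule Bochner_Integration.integrable_bound)
    show "integrable lborel (\<lambda>x. R * C * \<bar>h x * heat_kernel 2 x\<bar>)"
      using h schwartz_heat_kernel[of 2]
          by (intro integrable_mult_right integrable_abs) (auto simp: dual_bounded_def)
    have "\<bar>h x * \<phi> x\<bar> \<le> R * C * \<bar>h x * heat_kernel 2 x\<bar>" for x
    proof (cases "norm x \<le> r")
      case True
      have "\<bar>\<phi> x\<bar> * 1 \<le> R * (C * heat_kernel 2 x)" using R(1) C(2)[OF True] R0 by (intro mult_mono) auto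
      then have "\<bar>h x\<bar> * \<bar>\<phi> x\<bar> \<le> \<bar>h x\<bar> * (R * (C * heat_kernel 2 x))" by (intro mult_left_mono) auto
      then show ?thesis by (simp add: abs_mult mult_ac)
    qed (use R R0 C in auto)
    then show "AE x in lborel. norm (h x * \<phi> x) \<le> norm (R * C * \<bar>h x * heat_kernel 2 x\<bar>)"
      using R0 C by (intro AE_I2) auto
  qed measurable
qed

text \<open>Lebesgue measurability provides continuous functions converging to \<open>\<phi>\<close>
  off a null set. Modified to be bounded with bounded support, they fall under the continuous case,
  and dominated convergence carries both sides to the limit.\<close>

lemma dual_bounded_ball:
  assumes h: "dual_bounded h A" and \<phi>[measurable]: "\<phi> \<in> borel_measurable borel"
    and R: "\<And>x. \<bar>\<phi> x\<bar> \<le> R" "\<And>x. r < norm x \<Longrightarrow> \<phi> x = 0"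
  shows "\<bar>LINT x|lborel. h x * \<phi> x\<bar> \<le> A * norm4 \<phi>"
proof -
  have [measurable]: "h \<in> borel_measurable borel" using h by (simp add: dual_bounded_def)
  have R0: "0 \<le> R" using R(1)[of 0] by linarith
  have "\<phi> \<in> borel_measurable (lebesgue_on UNIV)"
    unfolding lebesgue_on_UNIV_eq by (rule measurable_completion) simp
  then have "\<phi> measurable_on UNIV" by (subst measurable_on_iff_borel_measurable) auto
  then obtain N g where N: "negligible N" and cg: "\<And>n. continuous_on UNIV (g n)"
    and lim: "\<And>x. x \<notin> N \<Longrightarrow> (\<lambda>n::nat. g n x) \<longlonglongrightarrow> \<phi> x"
    unfolding measurable_on_def by auto
  \<comment> \<open>\<open>g n\<close> is clipped to height R and cut off linearly between the radii
    r and r + 1. Neither operation alters the limit, because \<open>\<phi>\<close> is bounded by R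
    and vanishes beyond r.\<close>
  define k where "k n x = max (-R) (min R (g n x)) * max 0 (min 1 (r + 1 - norm x))" for n x
  have ck: "continuous_on UNIV (k n)" for n
    unfolding k_def[abs_def] by (intro continuous_intros cg)
  have [measurable]: "k n \<in> borel_measurable borel" for n
    by (intro borel_measurable_continuous_onI ck)
  have kR: "\<bar>k n x\<bar> \<le> R" for n x
  proof -
    have "\<bar>max (-R) (min R (g n x))\<bar> * \<bar>max 0 (min 1 (r + 1 - norm x))\<bar> \<le> R * 1"
      using R0 by (intro mult_mono) auto
    then show ?thesis by (simp add: k_def abs_mult)
  qed
  have k0: "k n x = 0" if "r + 1 < norm x" for n x using that by (simp add: k_def)
  have klim: "(\<lambda>n. k n x) \<longlonglongrightarrow> \<phi> x" if "x \<notin> N" for x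
  proof -
    have "(\<lambda>n. k n x) \<longlonglongrightarrow> max (-R) (min R (\<phi> x)) * max 0 (min 1 (r + 1 - norm x))"
      unfolding k_def by (intro tendsto_intros lim that)
    moreover have "max (-R) (min R (\<phi> x)) * max 0 (min 1 (r + 1 - norm x)) = \<phi> x"
      using R(1)[of x] R(2)[of x] by (cases "norm x \<le> r") (auto simp: max_def min_def)
    ultimately show ?thesis by simp
  qed
  have "AE x in lebesgue. x \<notin> N"
    using N by (intro AE_not_in) (simp add: negligible_iff_null_sets)
  then have AE: "AE x in lborel. x \<notin> N"
    by (simp add: AE_completion_iff)
  have ib: "integrable lborel (\<lambda>x. R * \<bar>h x\<bar> * indicator (cball 0 (r + 1)) x)"
  proof -
    have "integrable lborel (\<lambda>x. h x * indicator (cball 0 (r + 1)) x)"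
      by (rule dual_bounded_integrable_ball[OF h, of _ 1 "r + 1"]) (auto simp: indicator_def)
    then have "integrable lborel (\<lambda>x. R * \<bar>h x * indicator (cball 0 (r + 1)) x\<bar>)" by simp
    then show ?thesis by (simp add: abs_mult mult.assoc)
  qed
  have "(\<lambda>n. LINT x|lborel. h x * k n x) \<longlonglongrightarrow> (LINT x|lborel. h x * \<phi> x)"
  proof (rule integral_dominated_convergence[OF _ _ ib])
    show "AE x in lborel. (\<lambda>n. h x * k n x) \<longlonglongrightarrow> h x * \<phi> x"
      using AE by eventually_elim (intro tendsto_mult_left klim)
    show "AE x in lborel. norm (h x * k n x) \<le> R * \<bar>h x\<bar> * indicator (cball 0 (r + 1)) x" for n
    proof (rule AE_I2)
      fix x
      have "\<bar>h x\<bar> * \<bar>k n x\<bar> \<le> \<bar>h x\<bar> * (R * indicator (cball 0 (r + 1)) x)"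
        using kR[of n x] k0[of x n] by (intro mult_left_mono) (auto simp: indicator_def)
      then show "norm (h x * k n x) \<le> R * \<bar>h x\<bar> * indicator (cball 0 (r + 1)) x"
        by (simp add: abs_mult mult_ac)
    qed
  qed measurable
  then have l1: "(\<lambda>n. \<bar>LINT x|lborel. h x * k n x\<bar>) \<longlonglongrightarrow> \<bar>LINT x|lborel. h x * \<phi> x\<bar>"
    by (rule tendsto_rabs)
  have "(\<lambda>n. LINT x|lborel. k n x ^ 4) \<longlonglongrightarrow> (LINT x|lborel. \<phi> x ^ 4)"
  proof (rule integral_dominated_convergence)
    show "integrable lborel (\<lambda>x::real^2. R ^ 4 * indicator (cball 0 (r + 1)) x)"
      by (intro integrable_mult_right integrable_real_indicator emeasure_lborel_cball_finite) simp
    show "AE x in lborel. (\<lambda>n. k n x ^ 4) \<longlonglongrightarrow> \<phi> x ^ 4"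
      using AE by eventually_elim (intro tendsto_power klim)
    show "AE x in lborel. norm (k n x ^ 4) \<le> R ^ 4 * indicator (cball 0 (r + 1)) x" for n
    proof (rule AE_I2)
      fix x
      show "norm (k n x ^ 4) \<le> R ^ 4 * indicator (cball 0 (r + 1)) x"
        using power_mono[OF kR[of n x], of 4] k0[of x n] by (auto simp: indicator_def power_abs)
    qed
  qed measurable
  then have "(\<lambda>n. norm4 (k n)) \<longlonglongrightarrow> norm4 \<phi>"
    unfolding norm4_def by (intro tendsto_real_root)
  then have l2: "(\<lambda>n. A * norm4 (k n)) \<longlonglongrightarrow> A * norm4 \<phi>"
    by (intro tendsto_mult_left)
  show ?thesis
    by (rule LIMSEQ_le[OF l1 l2]) (use dual_bounded_continuous[OF h ck kR k0] in auto)
qed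

text \<open>The test function is \<open>sgn h * \<bar>h\<bar> powr (1/3)\<close>, truncated in height and in space.\<close>

theorem L43_dual:
  assumes h: "dual_bounded h A"
  shows "L43 h A"
proof -
  have [measurable]: "h \<in> borel_measurable borel" and A: "0 \<le> A" using h by (auto simp: dual_bounded_def)
  define m where "m n x = min \<bar>h x\<bar> (real n) * indicator (cball 0 (real n)) x" for n x
  have m0: "0 \<le> m n x" for n x by (simp add: m_def)
  have mn: "m n x \<le> real n" for n x by (simp add: m_def indicator_def)
  have mh: "m n x \<le> \<bar>h x\<bar>" for n x by (simp add: m_def indicator_def)
  have mo: "m n x = 0" if "real n < norm x" for n x using that by (simp add: m_def)
  have [measurable]: "m n \<in> borel_measurable borel" for n
  proof -
    have [measurable]: "cball (0::real^2) (real n) \<in> sets borel" by simp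
    show ?thesis unfolding m_def[abs_def] by measurable
  qed
  have bound: "(\<integral>\<^sup>+x. ennreal (m n x powr (4/3)) \<partial>lborel) \<le> ennreal (A powr (4/3))" for n
  proof -
    define \<phi> where "\<phi> x = sgn (h x) * m n x powr (1/3)" for x
    have [measurable]: "\<phi> \<in> borel_measurable borel" unfolding \<phi>_def[abs_def] by measurable
    have \<phi>R: "\<bar>\<phi> x\<bar> \<le> real n powr (1/3)" for x
    proof -
      have "\<bar>sgn (h x)\<bar> * m n x powr (1/3) \<le> 1 * real n powr (1/3)"
        using m0 mn by (intro mult_mono powr_mono2) (auto simp: abs_sgn_eq)
      then show ?thesis by (simp add: \<phi>_def abs_mult)
    qed
    have \<phi>0: "\<phi> x = 0" if "real n < norm x" for x using mo[OF that] by (simp add: \<phi>_def)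
    have i1: "integrable lborel (\<lambda>x. h x * \<phi> x)"
      by (rule dual_bounded_integrable_ball[OF h _ \<phi>R \<phi>0]) measurable
    define I where "I = (LINT x|lborel. m n x powr (4/3))"
    have m43: "m n x powr (4/3) = m n x * m n x powr (1/3)" for x
      using m0[of n x] powr_add[of "m n x" 1 "1/3"] by (cases "m n x = 0") auto
    have le: "m n x powr (4/3) \<le> h x * \<phi> x" for x
    proof -
      have "m n x * m n x powr (1/3) \<le> \<bar>h x\<bar> * m n x powr (1/3)" by (intro mult_right_mono mh) auto
      then show ?thesis by (simp add: m43 \<phi>_def mult.assoc[symmetric] abs_sgn[symmetric])
    qed
    have i2: "integrable lborel (\<lambda>x. m n x powr (4/3))"
      by (rule Bochner_Integration.integrable_bound[OF i1])
          (auto intro!: AE_I2 order_trans[OF le abs_ge_self])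
    have I0: "0 \<le> I" unfolding I_def by (rule integral_nonneg_AE) simp
    have p4: "\<phi> x ^ 4 = m n x powr (4/3)" for x
    proof (cases "h x = 0 \<or> m n x = 0")
      case False
      then have "\<phi> x ^ 4 = (m n x powr (1/3)) ^ 4" by (simp add: \<phi>_def power_mult_distrib sgn_if)
      also have "\<dots> = m n x powr (4/3)" using False m0[of n x] by (simp add: powr_powr flip: powr_numeral)
      finally show ?thesis .
    qed (auto simp: \<phi>_def m_def)
    have n4: "norm4 \<phi> = I powr (1/4)"
      using I0 by (simp add: norm4_def p4 I_def root_powr_inverse)
    have "I \<le> (LINT x|lborel. h x * \<phi> x)"
      unfolding I_def by (rule integral_mono[OF i2 i1 le])
    also have "\<dots> \<le> A * norm4 \<phi>"
      by (rule order_trans[OF abs_ge_self dual_bounded_ball[OF h _ \<phi>R \<phi>0]]) measurable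
    finally have I: "I \<le> A * I powr (1/4)" by (simp add: n4)
    \<comment> \<open>The truncation makes I finite, which is what permits division by its fourth
      root.\<close>
    have "I \<le> A powr (4/3)"
    proof (cases "I = 0")
      case False
      then have pos: "0 < I" using I0 by simp
      have "I = I powr (3/4) * I powr (1/4)" using pos by (simp flip: powr_add)
      with I have "I powr (3/4) * I powr (1/4) \<le> A * I powr (1/4)" by simp
      then have "I powr (3/4) \<le> A" using pos by (simp add: mult_le_cancel_right)
      then have "(I powr (3/4)) powr (4/3) \<le> A powr (4/3)" by (intro powr_mono2) auto
      then show ?thesis using pos by (simp add: powr_powr)
    qed simp
    then have "ennreal I \<le> ennreal (A powr (4/3))" by (rule ennreal_leI)
    then show ?thesis
      unfolding I_def using nn_integral_eq_integral[OF i2] by simp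
  qed
  have lim: "(\<lambda>n. ennreal (m n x powr (4/3))) \<longlonglongrightarrow> ennreal (\<bar>h x\<bar> powr (4/3))" for x
  proof (rule tendsto_eventually)
    obtain N where N: "\<bar>h x\<bar> \<le> real N" "norm x \<le> real N"
      by (metis max.bounded_iff real_arch_simple)
    have "m n x = \<bar>h x\<bar>" if "N \<le> n" for n
      using that N by (auto simp: m_def indicator_def min_def)
    then show "\<forall>\<^sub>F n in sequentially. ennreal (m n x powr (4/3)) = ennreal (\<bar>h x\<bar> powr (4/3))"
      unfolding eventually_sequentially by (intro exI[of _ N]) simp
  qed
  have "(\<integral>\<^sup>+x. ennreal (\<bar>h x\<bar> powr (4/3)) \<partial>lborel) = (\<integral>\<^sup>+x. liminf (\<lambda>n. ennreal (m n x powr (4/3))) \<partial>lborel)"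
    by (intro nn_integral_cong) (simp add: lim_imp_Liminf[OF sequentially_bot lim])
  also have "\<dots> \<le> liminf (\<lambda>n. \<integral>\<^sup>+x. ennreal (m n x powr (4/3)) \<partial>lborel)"
    by (intro nn_integral_liminf) measurable
  also have "\<dots> \<le> ennreal (A powr (4/3))"
    using Liminf_le[of sequentially "\<lambda>n. \<integral>\<^sup>+x. ennreal (m n x powr (4/3)) \<partial>lborel"] bound
    by (intro Liminf_le) (auto intro: always_eventually)
  finally show ?thesis using A by (simp add: L43_def)
qed

subsection \<open>Regular distributions and norms\<close>

lemma L43_zero_AE:
  assumes "L43 f 0"
  shows "AE x in lborel. f x = 0"
proof -
  note [measurable] = L43_measurable[OF assms]
  have "(\<integral>\<^sup>+x. ennreal (\<bar>f x\<bar> powr (4/3)) \<partial>lborel) = 0"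
    using assms by (simp add: L43_def)
  then have "AE x in lborel. ennreal (\<bar>f x\<bar> powr (4/3)) = 0"
    by (subst (asm) nn_integral_0_iff_AE) auto
  then show ?thesis by eventually_elim (auto simp: ennreal_eq_0_iff)
qed

lemma L43_cong_AE:
  assumes "L43 f A" "AE x in lborel. f x = g x" "g \<in> borel_measurable borel"
  shows "L43 g A"
proof -
  have "(\<integral>\<^sup>+x. ennreal (\<bar>f x\<bar> powr (4/3)) \<partial>lborel) = (\<integral>\<^sup>+x. ennreal (\<bar>g x\<bar> powr (4/3)) \<partial>lborel)"
    by (rule nn_integral_cong_AE) (use assms(2) in eventually_elim, simp)
  with assms show ?thesis by (simp add: L43_def)
qed

lemma representsD:
  assumes "represents g T"
  shows "g \<in> borel_measurable borel" "\<psi> \<in> schwartz \<Longrightarrow> integrable lborel (\<lambda>x. g x * \<psi> x)"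
    "\<psi> \<in> schwartz \<Longrightarrow> T \<psi> = (LINT x|lborel. g x * \<psi> x)"
  using assms by (auto simp: represents_def)

lemma represents_L43:
  assumes "represents g T" "0 \<le> A" "\<And>\<psi>. \<psi> \<in> schwartz \<Longrightarrow> \<bar>T \<psi>\<bar> \<le> A * norm4 \<psi>"
  shows "L43 g A"
  using assms by (intro L43_dual) (auto simp: dual_bounded_def represents_def)

lemma represents_minus:
  assumes "represents f S" "represents g T"
  shows "represents (\<lambda>x. f x - g x) (\<lambda>\<psi>. S \<psi> - T \<psi>)"
  using assms by (auto simp: represents_def left_diff_distrib)

lemma represents_add:
  assumes "represents f S" "represents g T"
  shows "represents (\<lambda>x. f x + g x) (\<lambda>\<psi>. S \<psi> + T \<psi>)"
  using assms by (auto simp: represents_def distrib_right)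

lemma represents_unique_AE:
  assumes "represents f T" "represents g T"
  shows "AE x in lborel. f x = g x"
proof -
  have "L43 (\<lambda>x. f x - g x) 0"
    by (rule represents_L43[OF represents_minus[OF assms]]) auto
  from L43_zero_AE[OF this] show ?thesis by eventually_elim simp
qed

lemma represents_density_of: "represents g T \<Longrightarrow> represents (density_of T) T"
  unfolding density_of_def by (rule someI[where P = "\<lambda>g. represents g T"])

definition distr_of :: "(real^2 \<Rightarrow> real) \<Rightarrow> distr" where
  "distr_of g = (\<lambda>\<psi>. if \<psi> \<in> schwartz then LINT x|lborel. g x * \<psi> x else 0)"

lemma L43_represents: "L43 g A \<Longrightarrow> represents g (distr_of g)"
  by (auto simp: represents_def distr_of_def intro: Holder_integrable(1) L4_schwartz L43_measurable)

lemma L43_distr_bound: "L43 g A \<Longrightarrow> \<psi> \<in> schwartz \<Longrightarrow> \<bar>distr_of g \<psi>\<bar> \<le> A * norm4 \<psi>"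
  by (auto simp: distr_of_def intro: Holder_integrable(2) L4_schwartz)

lemma represents_distr_of:
  "represents g T \<Longrightarrow> (\<And>\<psi>. \<psi> \<notin> schwartz \<Longrightarrow> T \<psi> = 0) \<Longrightarrow> T = distr_of g"
  by (auto simp: represents_def distr_of_def fun_eq_iff)

text \<open>Minkowski's inequality by duality: the bounds on the pairings simply add.\<close>

lemma L43_add:
  assumes "L43 f A" "L43 g B"
  shows "L43 (\<lambda>x. f x + g x) (A + B)"
proof (rule represents_L43[OF represents_add[OF L43_represents[OF assms(1)] L43_represents[OF assms(2)]]])
  show "0 \<le> A + B" using L43_nonneg[OF assms(1)] L43_nonneg[OF assms(2)] by simp
  show "\<bar>distr_of f \<psi> + distr_of g \<psi>\<bar> \<le> (A + B) * norm4 \<psi>" if "\<psi> \<in> schwartz" for \<psi>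
    using L43_distr_bound[OF assms(1) that] L43_distr_bound[OF assms(2) that]
    by (simp add: distrib_right)
qed

lemma L43_uminus: "L43 f A \<Longrightarrow> L43 (\<lambda>x. - f x) A"
  by (auto simp: L43_def)

lemma L43_diff:
  assumes "L43 f A" "L43 g B"
  shows "L43 (\<lambda>x. f x - g x) (A + B)"
  using L43_add[OF assms(1) L43_uminus[OF assms(2)]] by simp

text \<open>A function below s/(1 + \<open>norm x\<close>) has its fourth power below an integrable
  weight in the plane. This makes every function in L^(4/3) a tempered distribution.\<close>

lemma norm4_seminorm:
  obtains K where "K \<ge> 0" "\<And>\<psi>. \<psi> \<in> schwartz \<Longrightarrow> norm4 \<psi> \<le> K * schwartz_seminorm 1 [] \<psi>"
proof
  let ?J = "LINT (x::real^2)|lborel. 1 / (1 + norm x) ^ 4"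
  show "0 \<le> root 4 ?J" by (simp add: integral_nonneg_AE)
  fix \<psi> :: "real^2 \<Rightarrow> real" assume \<psi>: "\<psi> \<in> schwartz"
  let ?s = "schwartz_seminorm 1 [] \<psi>"
  have s0: "0 \<le> ?s" by (rule schwartz_seminorm_nonneg[OF \<psi>])
  have le: "\<psi> x ^ 4 \<le> ?s ^ 4 * (1 / (1 + norm x) ^ 4)" for x
  proof -
    have p: "0 < 1 + norm x" by (simp add: add_pos_nonneg)
    have "(1 + norm x) * \<bar>\<psi> x\<bar> \<le> ?s" using schwartz_seminorm_upper[OF \<psi>, of x 1 "[]"] by simp
    then have "\<bar>\<psi> x\<bar> \<le> ?s / (1 + norm x)" using p by (simp add: le_divide_eq mult.commute)
    then have "\<bar>\<psi> x\<bar> ^ 4 \<le> (?s / (1 + norm x)) ^ 4" by (intro power_mono) auto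
    then show ?thesis by (simp add: power_divide power_even_abs)
  qed
  have "(LINT x|lborel. \<psi> x ^ 4) \<le> (LINT (x::real^2)|lborel. ?s ^ 4 * (1 / (1 + norm x) ^ 4))"
    by (intro integral_mono schwartz_integrable_pow4[OF \<psi>] integrable_mult_right integrable_plane_decay le)
  then have "(LINT x|lborel. \<psi> x ^ 4) \<le> ?s ^ 4 * ?J"
    by (simp only: integral_mult_right_zero)
  then have "norm4 \<psi> \<le> root 4 (?s ^ 4 * ?J)"
    unfolding norm4_def by (intro real_root_le_mono) auto
  also have "\<dots> = root 4 ?J * ?s"
    using s0 by (simp add: real_root_mult real_root_power_cancel)
  finally show "norm4 \<psi> \<le> root 4 ?J * ?s" .
qed

lemma L43_tempered:
  assumes "L43 g A"
  shows "distr_of g \<in> tempered"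
proof -
  have i: "integrable lborel (\<lambda>x. g x * \<psi> x)" if "\<psi> \<in> schwartz" for \<psi>
    using Holder_integrable(1)[OF assms L4_schwartz[OF that]] .
  obtain K where K: "K \<ge> 0" "\<And>\<psi>. \<psi> \<in> schwartz \<Longrightarrow> norm4 \<psi> \<le> K * schwartz_seminorm 1 [] \<psi>"
    using norm4_seminorm by blast
  have A: "0 \<le> A" using assms by (rule L43_nonneg)
  have "\<bar>distr_of g \<psi>\<bar> \<le> (A * K) * (\<Sum>is | length is \<le> 1. schwartz_seminorm 1 is \<psi>)" if \<psi>: "\<psi> \<in> schwartz"
      for \<psi>
  proof -
    have "\<bar>distr_of g \<psi>\<bar> \<le> A * norm4 \<psi>" by (rule L43_distr_bound[OF assms \<psi>])
    also have "\<dots> \<le> A * (K * schwartz_seminorm 1 [] \<psi>)" by (intro mult_left_mono K \<psi> A)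
    also have "\<dots> \<le> A * (K * (\<Sum>is | length is \<le> 1. schwartz_seminorm 1 is \<psi>))"
      by (intro mult_left_mono member_le_sum K A finite_multi_indices schwartz_seminorm_nonneg \<psi>) auto
    finally show ?thesis by (simp add: mult.assoc)
  qed
  moreover have "(\<lambda>x. \<psi> x + \<eta> x) \<in> schwartz" "(\<lambda>x. c * \<psi> x) \<in> schwartz"
    if "\<psi> \<in> schwartz" "\<eta> \<in> schwartz" for \<psi> \<eta> and c :: real
    using schwartz_lincomb[OF that, of 1 1] schwartz_lincomb[OF that, of c 0] by auto
  ultimately show ?thesis
    unfolding tempered_def mem_Collect_eq
    by (intro conjI ballI allI impI exI[of _ "A * K"] exI[of _ "1::nat"])
      (auto simp: distr_of_def distrib_left mult.left_commute i)
qed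

section \<open>The norms of the statement expressed through \<open>L43\<close>\<close>

lemma Lp_norm_fun_le_iff:
  assumes [measurable]: "g \<in> borel_measurable borel" and A: "0 \<le> A"
  shows "Lp_norm_fun (4/3) g \<le> ennreal A \<longleftrightarrow> L43 g A"
proof (cases "integrable lborel (\<lambda>x. \<bar>g x\<bar> powr (4/3))")
  case True
  let ?I = "LINT x|lborel. \<bar>g x\<bar> powr (4/3)"
  have I: "0 \<le> ?I" by (rule integral_nonneg_AE) simp
  have "?I powr (3/4) \<le> A \<longleftrightarrow> ?I \<le> A powr (4/3)"
  proof
    assume "?I powr (3/4) \<le> A"
    then have "(?I powr (3/4)) powr (4/3) \<le> A powr (4/3)" by (intro powr_mono2) auto
    then show "?I \<le> A powr (4/3)" using I by (simp add: powr_powr)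
  next
    assume "?I \<le> A powr (4/3)"
    then have "?I powr (3/4) \<le> (A powr (4/3)) powr (3/4)" using I by (intro powr_mono2) auto
    then show "?I powr (3/4) \<le> A" using A by (simp add: powr_powr)
  qed
  then show ?thesis
    using True nn_integral_eq_integral[OF True] A by (simp add: Lp_norm_fun_def L43_def ennreal_le_iff)
next
  case False
  have "\<not> L43 g A"
  proof
    assume "L43 g A"
    then have "(\<integral>\<^sup>+x. ennreal (\<bar>g x\<bar> powr (4/3)) \<partial>lborel) < \<infinity>"
      by (auto simp: L43_def le_less_trans)
    with False show False by (auto intro!: integrableI_nonneg)
  qed
  with False show ?thesis by (simp add: Lp_norm_fun_def top_unique)
qed

text \<open>The version selected by \<open>density_of\<close> is harmless: representing functions
  agree almost everywhere, and \<open>L43\<close> does not see null sets.\<close>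

lemma Lp_norm_le_represents:
  assumes g: "represents g T" and A: "0 \<le> A"
  shows "Lp_norm (4/3) T \<le> ennreal A \<longleftrightarrow> L43 g A"
proof -
  have d: "represents (density_of T) T" by (rule represents_density_of[OF g])
  have "Lp_norm (4/3) T \<le> ennreal A \<longleftrightarrow> L43 (density_of T) A"
    using g Lp_norm_fun_le_iff[OF representsD(1)[OF d] A] by (auto simp: Lp_norm_def)
  also have "\<dots> \<longleftrightarrow> L43 g A"
    using L43_cong_AE[OF _ represents_unique_AE[OF d g]] L43_cong_AE[OF _ represents_unique_AE[OF g d]]
      representsD(1)[OF g] representsD(1)[OF d] by blast
  finally show ?thesis .
qed

lemma Lp_norm_le_iff:
  assumes A: "0 \<le> A"
  shows "Lp_norm (4/3) T \<le> ennreal A \<longleftrightarrow> (\<exists>g. represents g T \<and> L43 g A)"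
proof (cases "\<exists>g. represents g T")
  case True
  with Lp_norm_le_represents[OF _ A] show ?thesis by blast
next
  case False
  then show ?thesis by (auto simp: Lp_norm_def top_unique)
qed

lemma ennreal_mult_le_iff:
  assumes "0 < c" "0 \<le> M"
  shows "ennreal c * L \<le> ennreal M \<longleftrightarrow> L \<le> ennreal (M / c)"
proof (cases L)
  case (real l)
  with assms show ?thesis by (simp add: ennreal_le_iff pos_le_divide_eq mult.commute flip: ennreal_mult)
next
  case top
  with assms show ?thesis by (simp add: ennreal_mult_top top_unique)
qed

lemma weight_le_iff:
  assumes "0 \<le> M"
  shows "(SUP t\<in>{0<..}. ennreal (t powr (1/4)) * Lp_norm (4/3) (f t)) \<le> ennreal M \<longleftrightarrow>
    (\<forall>t>0. Lp_norm (4/3) (f t) \<le> ennreal (M * t powr (-1/4)))"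
proof -
  have "ennreal (t powr (1/4)) * L \<le> ennreal M \<longleftrightarrow> L \<le> ennreal (M * t powr (-1/4))" if "0 < t" for t :: real
      and L
  proof -
    have "t powr (-1/4) = 1 / t powr (1/4)" using powr_minus_divide[of t "1/4"] by simp
    then show ?thesis using ennreal_mult_le_iff[of "t powr (1/4)" M L] that assms by simp
  qed
  then show ?thesis by (auto simp: SUP_le_iff)
qed

lemma BX_norm_le_iff:
  "0 \<le> M \<Longrightarrow> BX_norm T \<le> ennreal M \<longleftrightarrow> (\<forall>t>0. Lp_norm (4/3) (heat t T) \<le> ennreal (M * t powr (-1/4)))"
  unfolding BX_norm_def by (rule weight_le_iff)

lemma weighted_norm_le_iff:
  "0 \<le> M \<Longrightarrow> weighted_norm f \<le> ennreal M \<longleftrightarrow> (\<forall>t>0. Lp_norm (4/3) (f t) \<le> ennreal (M * t powr (-1/4)))"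
  unfolding weighted_norm_def by (rule weight_le_iff)

subsection \<open>Pairings with convolutions\<close>

lemma ennreal_norm_integral_le:
  fixes f :: "'a \<Rightarrow> 'b::{banach, second_countable_topology}"
  shows "ennreal (norm (integral\<^sup>L M f)) \<le> (\<integral>\<^sup>+x. ennreal (norm (f x)) \<partial>M)"
  by (cases "integrable M f") (auto simp: integral_norm_bound_ennreal not_integrable_integral_eq)

lemma abs_integral_le_ennreal:
  fixes f :: "'a \<Rightarrow> 'b::{banach, second_countable_topology}"
  assumes "(\<integral>\<^sup>+x. ennreal (norm (f x)) \<partial>M) \<le> ennreal C" "0 \<le> C"
  shows "norm (integral\<^sup>L M f) \<le> C"
  using order_trans[OF ennreal_norm_integral_le assms(1)] assms(2) by (simp add: ennreal_le_iff)

lemma L4_translate: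
  assumes "L4 g B" shows "L4 (\<lambda>y. g (z + y)) B"
proof -
  note [measurable] = L4_measurable[OF assms]
  show ?thesis
    using assms nn_integral_lborel_plus[of "\<lambda>x. ennreal (g x ^ 4)" z] by (simp add: L4_def)
qed

lemma L43_reflect:
  assumes "L43 g B" shows "L43 (\<lambda>y. g (z - y)) B"
proof -
  note [measurable] = L43_measurable[OF assms]
  show ?thesis
    using assms nn_integral_lborel_reflect[of "\<lambda>x. ennreal (\<bar>g x\<bar> powr (4/3))" z] by (simp add: L43_def)
qed

text \<open>Young's convolution inequality in dual form: after the substitution x = y + z, Hoelder's
  inequality applies for each fixed z, and integration of k in z remains.\<close>

lemma trilinear_bound:
  fixes k :: "real^2 \<Rightarrow> real"
  assumes f: "L43 f A" and g: "L4 g B" and [measurable]: "k \<in> borel_measurable borel"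
    and K: "(\<integral>\<^sup>+x. ennreal \<bar>k x\<bar> \<partial>lborel) \<le> ennreal K" "0 \<le> K"
  shows "(\<integral>\<^sup>+y. \<integral>\<^sup>+x. ennreal \<bar>f y * k (x - y) * g x\<bar> \<partial>lborel \<partial>lborel) \<le> ennreal (A * K * B)"
proof -
  note [measurable] = L43_measurable[OF f] L4_measurable[OF g]
  have AB: "0 \<le> A" "0 \<le> B" using f g by (auto simp: L43_def L4_def)
  have "(\<integral>\<^sup>+y. \<integral>\<^sup>+x. ennreal \<bar>f y * k (x - y) * g x\<bar> \<partial>lborel \<partial>lborel) =
    (\<integral>\<^sup>+y. \<integral>\<^sup>+z. ennreal \<bar>f y * k z * g (y + z)\<bar> \<partial>lborel \<partial>lborel)"
  proof (rule nn_integral_cong)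
    fix y
    show "(\<integral>\<^sup>+x. ennreal \<bar>f y * k (x - y) * g x\<bar> \<partial>lborel) = (\<integral>\<^sup>+z. ennreal \<bar>f y * k z * g (y + z)\<bar> \<partial>lborel)"
      using nn_integral_lborel_plus[of "\<lambda>x. ennreal \<bar>f y * k (x - y) * g x\<bar>" y] by simp
  qed
  also have "\<dots> = (\<integral>\<^sup>+z. \<integral>\<^sup>+y. ennreal \<bar>f y * k z * g (y + z)\<bar> \<partial>lborel \<partial>lborel)"
    by (rule lborel_pair.Fubini') measurable
  also have "\<dots> = (\<integral>\<^sup>+z. ennreal \<bar>k z\<bar> * (\<integral>\<^sup>+y. ennreal \<bar>f y * g (z + y)\<bar> \<partial>lborel) \<partial>lborel)"
    by (intro nn_integral_cong) (simp add: abs_mult mult_ac add.commute flip: nn_integral_cmult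
        ennreal_mult)
  also have "\<dots> \<le> (\<integral>\<^sup>+z. ennreal \<bar>k z\<bar> * ennreal (A * B) \<partial>lborel)"
    by (intro nn_integral_mono mult_left_mono Holder[OF f L4_translate[OF g]]) auto
  also have "\<dots> \<le> ennreal K * ennreal (A * B)"
    by (simp add: nn_integral_multc mult_right_mono K)
  also have "\<dots> = ennreal (A * K * B)"
    using AB K by (simp add: mult_ac flip: ennreal_mult)
  finally show ?thesis .
qed

lemma integrable_pair_measureI:
  fixes f :: "'a \<Rightarrow> 'b \<Rightarrow> 'c::{banach, second_countable_topology}"
  assumes "sigma_finite_measure M2" and [measurable]: "case_prod f \<in> borel_measurable (M1 \<Otimes>\<^sub>M M2)"
    and "(\<integral>\<^sup>+y. \<integral>\<^sup>+x. ennreal (norm (f y x)) \<partial>M2 \<partial>M1) < \<infinity>"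
  shows "integrable (M1 \<Otimes>\<^sub>M M2) (case_prod f)"
proof (rule integrableI_bounded)
  interpret sigma_finite_measure M2 by fact
  have "(\<integral>\<^sup>+p. ennreal (norm (case p of (y, x) \<Rightarrow> f y x)) \<partial>(M1 \<Otimes>\<^sub>M M2)) =
    (\<integral>\<^sup>+y. \<integral>\<^sup>+x. ennreal (norm (f y x)) \<partial>M2 \<partial>M1)"
    by (subst nn_integral_fst[symmetric]) auto
  with assms(3) show "(\<integral>\<^sup>+p. ennreal (norm (case p of (y, x) \<Rightarrow> f y x)) \<partial>(M1 \<Otimes>\<^sub>M M2)) < \<infinity>" by simp
qed measurable

text \<open>Fubini. The explicit formula for the density is what later makes the linear orbit
  measurable jointly in time and space.\<close>

lemma represents_heat:
  assumes f: "L43 f A" and s: "0 < s"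
  shows "represents (\<lambda>x. LINT y|lborel. f y * heat_kernel s (x - y)) (heat s (distr_of f))"
  unfolding represents_def
proof (intro conjI ballI)
  note [measurable] = L43_measurable[OF f]
  show "(\<lambda>x. LINT y|lborel. f y * heat_kernel s (x - y)) \<in> borel_measurable borel" by measurable
  fix \<psi> assume \<psi>: "\<psi> \<in> schwartz"
  note [measurable] = schwartz_measurable[OF \<psi>]
  have nn: "(\<integral>\<^sup>+x. ennreal \<bar>heat_kernel s x\<bar> \<partial>lborel) \<le> ennreal 1"
    using s by (simp add: nn_integral_heat_kernel)
  have int: "integrable (lborel \<Otimes>\<^sub>M lborel) (\<lambda>(y, x). f y * heat_kernel s (x - y) * \<psi> x)"
    using trilinear_bound[OF f L4_schwartz[OF \<psi>] _ nn]
    by (intro integrable_pair_measureI sigma_finite_lborel) (auto simp: le_less_trans)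
  show "integrable lborel (\<lambda>x. (LINT y|lborel. f y * heat_kernel s (x - y)) * \<psi> x)"
    using lborel_pair.integrable_snd[OF int] by simp
  have "heat s (distr_of f) \<psi> = (LINT y|lborel. f y * heat_test s \<psi> y)"
    using \<psi> s by (simp add: heat_eq distr_of_def schwartz_heat_test)
  also have "\<dots> = (LINT y|lborel. LINT x|lborel. f y * heat_kernel s (x - y) * \<psi> x)"
    by (simp add: heat_test_def mult.assoc)
  also have "\<dots> = (LINT x|lborel. LINT y|lborel. f y * heat_kernel s (x - y) * \<psi> x)"
    by (rule lborel_pair.Fubini_integral[OF int, symmetric])
  finally show "heat s (distr_of f) \<psi> = (LINT x|lborel. (LINT y|lborel. f y * heat_kernel s (x - y)) * \<psi> x)"
    by simp
qed

text \<open>The second, absolute form is there for pairings with vector fields, where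
  \<open>f\<close> is replaced by the norm of the field.\<close>

lemma pairing_conv_bound:
  fixes k :: "real^2 \<Rightarrow> real"
  assumes f: "L43 f A" and g: "L4 g B" and [measurable]: "k \<in> borel_measurable borel"
    and K: "(\<integral>\<^sup>+x. ennreal \<bar>k x\<bar> \<partial>lborel) \<le> ennreal K" "0 \<le> K"
  shows "\<bar>LINT y|lborel. f y * (LINT x|lborel. k (x - y) * g x)\<bar> \<le> A * K * B"
    and "(\<integral>\<^sup>+y. ennreal (\<bar>f y\<bar> * \<bar>LINT x|lborel. k (x - y) * g x\<bar>) \<partial>lborel) \<le> ennreal (A * K * B)"
proof -
  note [measurable] = L43_measurable[OF f] L4_measurable[OF g]
  have AB: "0 \<le> A" "0 \<le> B" using f g by (auto simp: L43_def L4_def)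
  have "(\<integral>\<^sup>+y. ennreal (\<bar>f y\<bar> * \<bar>LINT x|lborel. k (x - y) * g x\<bar>) \<partial>lborel) \<le>
     (\<integral>\<^sup>+y. \<integral>\<^sup>+x. ennreal \<bar>f y * k (x - y) * g x\<bar> \<partial>lborel \<partial>lborel)"
  proof (rule nn_integral_mono)
    fix y
    have "\<bar>f y\<bar> * \<bar>LINT x|lborel. k (x - y) * g x\<bar> = norm (LINT x|lborel. f y * k (x - y) * g x)"
      by (simp add: abs_mult mult.assoc)
    then show "ennreal (\<bar>f y\<bar> * \<bar>LINT x|lborel. k (x - y) * g x\<bar>) \<le>
        (\<integral>\<^sup>+x. ennreal \<bar>f y * k (x - y) * g x\<bar> \<partial>lborel)"
      using ennreal_norm_integral_le[of lborel "\<lambda>x. f y * k (x - y) * g x"] by simp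
  qed
  also note trilinear_bound[OF f g _ K]
  finally show *: "(\<integral>\<^sup>+y. ennreal (\<bar>f y\<bar> * \<bar>LINT x|lborel. k (x - y) * g x\<bar>) \<partial>lborel) \<le> ennreal (A * K * B)"
    by simp
  then have "norm (LINT y|lborel. f y * (LINT x|lborel. k (x - y) * g x)) \<le> A * K * B"
    using AB K by (intro abs_integral_le_ennreal) (auto simp: abs_mult)
  then show "\<bar>LINT y|lborel. f y * (LINT x|lborel. k (x - y) * g x)\<bar> \<le> A * K * B" by simp
qed

lemma heat_test_diff:
  assumes "0 < r" "0 < r'" "\<psi> \<in> schwartz"
  shows "heat_test r' \<psi> y - heat_test r \<psi> y = (LINT
      x|lborel. (heat_kernel r' (x - y) - heat_kernel r (x - y)) * \<psi> x)"
proof -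
  note [measurable] = schwartz_measurable[OF assms(3)]
  have "integrable lborel (\<lambda>x. heat_kernel t (x - y) * \<psi> x)" if "0 < t" for t
    using integrable_mult_bounded[OF schwartz_integrable[OF assms(3)], of "\<lambda>x. heat_kernel t (x - y)" "1 /
        (4 * pi * t)"]
      heat_kernel_le[OF that] heat_kernel_nonneg[OF that] by (simp add: mult.commute)
  with assms show ?thesis by (simp add: heat_test_def left_diff_distrib)
qed

lemma heat_diff_bound:
  assumes f: "L43 f A" and r: "0 < r" "r \<le> r'" and \<psi>: "\<psi> \<in> schwartz"
  shows "\<bar>heat r' (distr_of f) \<psi> - heat r (distr_of f) \<psi>\<bar> \<le> A * (2 * (r' - r) / r') * norm4 \<psi>"
proof -
  have S: "heat_test r \<psi> \<in> schwartz" "heat_test r' \<psi> \<in> schwartz" using r \<psi>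
      by (auto intro: schwartz_heat_test)
  have "heat r' (distr_of f) \<psi> - heat r (distr_of f) \<psi> =
      (LINT y|lborel. f y * (heat_test r' \<psi> y - heat_test r \<psi> y))"
    using \<psi> S Holder_integrable(1)[OF f L4_schwartz[OF S(1)]]
        Holder_integrable(1)[OF f L4_schwartz[OF S(2)]]
    by (simp add: heat_eq distr_of_def right_diff_distrib)
  also have "\<bar>\<dots>\<bar> \<le> A * (2 * (r' - r) / r') * norm4 \<psi>"
    using r \<psi> by (simp add: heat_test_diff
      pairing_conv_bound(1)[OF f L4_schwartz[OF \<psi>] _ nn_integral_heat_kernel_diff[OF r], simplified])
  finally show ?thesis .
qed

subsection \<open>The gradient of the heat kernel\<close>

text \<open>Pointwise the gradient is at most a constant times t^(-1/2) and the kernel at time 2t.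
  Its power 4/3 is then one factor of the kernel, of mass 1, times the cube root of the supremum, of
  order t^(-1/3); the total t^(-1) becomes t^(-3/4) after the root.\<close>

lemma L43_grad_heat_kernel:
  "\<exists>C>0. \<forall>t>0. L43 (\<lambda>x. norm (grad (heat_kernel t) x)) (C * t powr (-3/4))"
proof -
  have c8: "0 < (1/8::real)" by simp
  obtain c where c: "c > 0" "\<And>u::real. u \<ge> 0 \<Longrightarrow> (1 + u) ^ 1 * exp (- (1/8) * u\<^sup>2) \<le> c"
    using power_gaussian_bounded[OF c8, of 1] by blast
  have pt: "norm (grad (heat_kernel t) x) \<le> c * t powr (-1/2) * heat_kernel (2 * t) x" if t: "0 < t" for t x
  proof -
    have "(norm x / sqrt t) * exp (- (norm x)\<^sup>2 / (8 * t)) \<le> (1 + norm x / sqrt t) * exp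
        (- (norm x)\<^sup>2 / (8 * t))"
      by (rule mult_right_mono) auto
    also have "\<dots> = (1 + norm x / sqrt t) ^ 1 * exp (- (1/8) * (norm x / sqrt t)\<^sup>2)"
      using t by (simp add: power_divide)
    also have "\<dots> \<le> c" using t by (intro c) auto
    finally have 1: "norm x * exp (- (norm x)\<^sup>2 / (8 * t)) \<le> c * sqrt t"
      using t by (simp add: field_simps)
    have "norm (grad (heat_kernel t) x) = (norm x * exp (- (norm x)\<^sup>2 / (8 * t))) *
        (heat_kernel (2 * t) x / t)"
      using t by (simp add: grad_heat_kernel heat_kernel_double[of t x])
    also have "\<dots> \<le> (c * sqrt t) * (heat_kernel (2 * t) x / t)"
      using t by (intro mult_right_mono 1) auto
    also have "\<dots> = c * (sqrt t / t) * heat_kernel (2 * t) x" by simp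
    also have "sqrt t / t = t powr (-1/2)"
    proof -
      have "t powr (-1/2) = 1 / sqrt t" using t powr_minus_divide[of t "1/2"] by (simp add: powr_half_sqrt)
      moreover have "sqrt t / t = 1 / sqrt t" using t by (simp add: frac_eq_eq)
      ultimately show ?thesis by simp
    qed
    finally show ?thesis .
  qed
  let ?C = "(c powr (4/3) / (8 * pi) powr (1/3)) powr (3/4)"
  have C: "?C > 0" using c by simp
  have "L43 (\<lambda>x. norm (grad (heat_kernel t) x)) (?C * t powr (-3/4))" if t: "0 < t" for t
  proof -
    have [measurable]: "grad (heat_kernel t) \<in> borel_measurable borel"
      using t by (intro schwartz_grad_measurable schwartz_heat_kernel)
    have pw: "\<bar>norm (grad (heat_kernel t) x)\<bar> powr (4/3) \<le> c powr (4/3) / (8 * pi) powr (1/3) * t powr -1 *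
        heat_kernel (2 * t) x" for x
    proof -
      let ?G = "heat_kernel (2 * t) x"
      have G: "0 < ?G" "?G \<le> 1 / (8 * pi * t)"
          using t heat_kernel_pos[of "2*t" x] heat_kernel_le[of "2 * t" x] by auto
      have "\<bar>norm (grad (heat_kernel t) x)\<bar> powr (4/3) \<le> (c * t powr (-1/2) * ?G) powr (4/3)"
        using pt[OF t, of x] by (intro powr_mono2) auto
      also have "\<dots> = c powr (4/3) * t powr (-2/3) * (?G powr (1/3) * ?G)"
        using c t G powr_add[of ?G "1/3" 1] by (simp add: powr_mult powr_powr)
      also have "\<dots> \<le> c powr (4/3) * t powr (-2/3) * ((1 / (8 * pi * t)) powr (1/3) * ?G)"
        using G t by (intro mult_left_mono mult_right_mono powr_mono2) auto
      also have "(1 / (8 * pi * t)) powr (1/3) = t powr (-1/3) / (8 * pi) powr (1/3)"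
      proof -
        have "t powr (-1/3) = 1 / t powr (1/3)" using powr_minus_divide[of t "1/3"] by simp
        then show ?thesis using t by (simp add: powr_divide powr_mult)
      qed
      also have "c powr (4/3) * t powr (-2/3) * (t powr (-1/3) / (8 * pi) powr (1/3) * ?G) =
        c powr (4/3) / (8 * pi) powr (1/3) * (t powr (-2/3) * t powr (-1/3)) * ?G" by simp
      also have "t powr (-2/3) * t powr (-1/3) = t powr -1"
        by (simp flip: powr_add)
      finally show ?thesis .
    qed
    have "(\<integral>\<^sup>+x. ennreal (\<bar>norm (grad (heat_kernel t) x)\<bar> powr (4/3)) \<partial>lborel) \<le>
      (\<integral>\<^sup>+x. ennreal (c powr (4/3) / (8 * pi) powr (1/3) * t powr -1) * ennreal (heat_kernel (2 * t) x)
          \<partial>lborel)"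
      using pw t by (intro nn_integral_mono) (simp flip: ennreal_mult add: ennreal_leI)
    also have "\<dots> = ennreal (c powr (4/3) / (8 * pi) powr (1/3) * t powr -1)"
      using t by (simp add: nn_integral_cmult nn_integral_heat_kernel)
    also have "c powr (4/3) / (8 * pi) powr (1/3) * t powr -1 = (?C * t powr (-3/4)) powr (4/3)"
      using c t by (simp add: powr_mult powr_powr)
    finally show ?thesis using C t by (simp add: L43_def)
  qed
  with C show ?thesis by blast
qed

lemma norm_grad_heat_test_le_nn:
  assumes "0 < t" "\<psi> \<in> schwartz"
  shows "ennreal (norm (grad (heat_test t \<psi>) y)) \<le>
      (\<integral>\<^sup>+x. ennreal \<bar>norm (grad (heat_kernel t) (y - x)) * \<psi> x\<bar> \<partial>lborel)"
  unfolding grad_heat_test[OF assms]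
  by (rule order_trans[OF ennreal_norm_integral_le]) (simp add: abs_mult mult.commute)

text \<open>The first clause bounds the integral of the absolute value, not merely the gradient,
  because the Fubini argument for the Duhamel term needs absolute convergence. The second trades a
  power 1/4 of r for Hoelder continuity in time of order 1/4.\<close>

definition grad_bounds :: "real \<Rightarrow> bool" where
  "grad_bounds C \<longleftrightarrow> C > 0 \<and>
    (\<forall>t \<psi> y. 0 < t \<longrightarrow> \<psi> \<in> schwartz \<longrightarrow>
       (\<integral>\<^sup>+x. ennreal \<bar>norm (grad (heat_kernel t) (y - x)) * \<psi> x\<bar> \<partial>lborel) \<le> ennreal
           (C * t powr (-3/4) * norm4 \<psi>)) \<and>
    (\<forall>r h \<psi> y. 0 < r \<longrightarrow> 0 < h \<longrightarrow> \<psi> \<in> schwartz \<longrightarrow>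
       norm (grad (heat_test (r + h) \<psi>) y - grad (heat_test r \<psi>) y) \<le> C * (r powr -1 * h powr (1/4)) *
           norm4 \<psi>)"

text \<open>For the increment in time, half of the evolution is spent on the gradient and the other half on
  the difference of heat kernels in \<open>L\<^sup>1\<close>.\<close>

lemma grad_bounds_exists: "\<exists>C. grad_bounds C"
proof -
  obtain C where C: "C > 0" "\<And>t. 0 < t \<Longrightarrow> L43 (\<lambda>x. norm (grad (heat_kernel t) x)) (C * t powr (-3/4))"
    using L43_grad_heat_kernel by blast
  have 2: "norm (grad (heat_test (r + h) \<psi>) y - grad (heat_test r \<psi>) y) \<le> (8 * C) *
      (r powr -1 * h powr (1/4)) * norm4 \<psi>"
    if r: "0 < r" "0 < h" and \<psi>: "\<psi> \<in> schwartz" for r h \<psi> y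
  proof -
    let ?q = "r / 2"
    define k where "k z = heat_kernel (?q + h) z - heat_kernel ?q z" for z
    have [measurable]: "k \<in> borel_measurable borel" unfolding k_def[abs_def] by measurable
    let ?\<psi>1 = "heat_test (?q + h) \<psi>" and ?\<psi>0 = "heat_test ?q \<psi>"
    have S: "?\<psi>1 \<in> schwartz" "?\<psi>0 \<in> schwartz" using r \<psi> by (auto intro: schwartz_heat_test)
    have [measurable]: "grad (heat_kernel ?q) \<in> borel_measurable borel"
      using r by (intro schwartz_grad_measurable schwartz_heat_kernel) auto
    have e1: "heat_test (r + h) \<psi> = heat_test ?q ?\<psi>1"
      using r \<psi> heat_test_heat_test[of ?q "?q + h" \<psi>]
          by (simp add: schwartz_integrable add.assoc[symmetric])
    have e0: "heat_test r \<psi> = heat_test ?q ?\<psi>0"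
      using r \<psi> heat_test_heat_test[of ?q ?q \<psi>] by (simp add: schwartz_integrable)
    obtain B where B: "\<And>x. norm (grad (heat_kernel ?q) x) \<le> B"
      using schwartz_grad_bound[OF schwartz_heat_kernel[of ?q], of 0] r by auto
    have int: "integrable lborel (\<lambda>x. \<eta> x *\<^sub>R grad (heat_kernel ?q) (y - x))" if "\<eta> \<in> schwartz" for \<eta>
      by (rule integrable_mult_bounded[OF schwartz_integrable[OF that], of _ B]) (use B in auto)
    have "grad (heat_test (r + h) \<psi>) y - grad (heat_test r \<psi>) y =
      (LINT x|lborel. (?\<psi>1 x - ?\<psi>0 x) *\<^sub>R grad (heat_kernel ?q) (y - x))"
      unfolding e1 e0 using r S int by (simp add: grad_heat_test scaleR_left_diff_distrib)
    also have "\<dots> = (LINT x|lborel. (LINT z|lborel. k (z - x) * \<psi> z) *\<^sub>R grad (heat_kernel ?q) (y - x))"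
      using r \<psi> by (simp add: heat_test_diff k_def)
    also have "norm \<dots> \<le> (C * ?q powr (-3/4)) * (2 * h / (?q + h)) * norm4 \<psi>"
    proof (rule abs_integral_le_ennreal)
      have "(\<integral>\<^sup>+x. ennreal (norm ((LINT z|lborel. k (z - x) * \<psi> z) *\<^sub>R grad (heat_kernel ?q) (y - x)))
          \<partial>lborel) =
        (\<integral>\<^sup>+x. ennreal (\<bar>norm (grad (heat_kernel ?q) (y - x))\<bar> * \<bar>LINT z|lborel. k (z - x) * \<psi> z\<bar>) \<partial>lborel)"
        by (simp add: mult.commute)
      also have "\<dots> \<le> ennreal ((C * ?q powr (-3/4)) * (2 * h / (?q + h)) * norm4 \<psi>)"
      proof (rule pairing_conv_bound(2)[OF L43_reflect[OF C(2)] L4_schwartz[OF \<psi>]])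
        show "(\<integral>\<^sup>+x. ennreal \<bar>k x\<bar> \<partial>lborel) \<le> ennreal (2 * h / (?q + h))"
          using nn_integral_heat_kernel_diff[of ?q "?q + h"] r by (simp add: k_def)
      qed (use r in auto)
      finally show "(\<integral>\<^sup>+x. ennreal (norm ((LINT z|lborel. k (z - x) * \<psi> z) *\<^sub>R grad (heat_kernel ?q)
          (y - x))) \<partial>lborel) \<le>
         ennreal ((C * ?q powr (-3/4)) * (2 * h / (?q + h)) * norm4 \<psi>)" .
      show "0 \<le> (C * ?q powr (-3/4)) * (2 * h / (?q + h)) * norm4 \<psi>"
        using C(1) r norm4_nonneg by auto
    qed
    also have "\<dots> \<le> (C * (2 * r powr (-3/4))) * (4 * (h / r) powr (1/4)) * norm4 \<psi>"
    proof (intro mult_right_mono mult_mono mult_left_mono)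
      have "?q powr (-3/4) = r powr (-3/4) * 2 powr (3/4)"
      proof -
        have "2 powr (-3/4) = 1 / (2::real) powr (3/4)" using powr_minus_divide[of 2 "3/4"] by simp
        then show ?thesis using r by (simp add: powr_divide)
      qed
      also have "\<dots> \<le> r powr (-3/4) * 2 powr 1"
        by (intro mult_left_mono powr_mono) auto
      finally show "?q powr (-3/4) \<le> 2 * r powr (-3/4)" by simp
      \<comment> \<open>The left side is of order min(1, h/r). Weakening it to the power 1/4 leaves
        the total singularity r^(-1), which can later be split as s^(-1/4) (t - tau)^(-3/4) and
        stays integrable in tau.\<close>
      show "2 * h / (?q + h) \<le> 4 * (h / r) powr (1/4)"
      proof (cases "h \<le> r")
        case True
        have "2 * h / (?q + h) \<le> 2 * h / ?q" using r by (intro divide_left_mono) auto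
        also have "\<dots> = 4 * (h / r) powr 1" using r by simp
        also have "\<dots> \<le> 4 * (h / r) powr (1/4)"
          using r True by (intro mult_left_mono powr_mono') auto
        finally show ?thesis .
      next
        case False
        have "2 * h / (?q + h) \<le> 4 * 1" using r by (simp add: field_simps)
        also have "1 \<le> (h / r) powr (1/4)" using False r by (intro ge_one_powr_ge_zero) auto
        finally show ?thesis by simp
      qed
    qed (use C(1) r norm4_nonneg in auto)
    also have "\<dots> = (8 * C) * (r powr -1 * h powr (1/4)) * norm4 \<psi>"
    proof -
      have "r powr (-3/4) * (h / r) powr (1/4) = (r powr (-3/4) * r powr (-1/4)) * h powr (1/4)"
      proof -
        have "r powr (-1/4) = 1 / r powr (1/4)" using powr_minus_divide[of r "1/4"] by simp
        then show ?thesis using r by (simp add: powr_divide)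
      qed
      also have "r powr (-3/4) * r powr (-1/4) = r powr -1" by (simp flip: powr_add)
      finally show ?thesis by simp
    qed
    finally show ?thesis .
  qed
  have "grad_bounds (8 * C)"
    unfolding grad_bounds_def
  proof (intro conjI allI impI)
    fix t \<psi> y assume t: "0 < (t::real)" and \<psi>: "\<psi> \<in> schwartz"
    have "L43 (\<lambda>x. norm (grad (heat_kernel t) x)) (8 * C * t powr (-3/4))"
      using C(1) t by (intro L43_mono[OF C(2)] mult_right_mono) auto
    from Holder[OF L43_reflect[OF this] L4_schwartz[OF \<psi>]]
    show "(\<integral>\<^sup>+x. ennreal \<bar>norm (grad (heat_kernel t) (y - x)) * \<psi> x\<bar> \<partial>lborel) \<le> ennreal
        (8 * C * t powr (-3/4) * norm4 \<psi>)" .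
  qed (use C(1) 2 in auto)
  then show ?thesis ..
qed

subsection \<open>The diagonal Hardy-Littlewood-Sobolev inequality\<close>

text \<open>The substitution tau = t s. Besides all singular time integrals, the case a = 1 supplies
  the integral of x^(-1/2) used for the planar kernel.\<close>

lemma nn_integral_Beta:
  fixes a b t :: real
  assumes "0 < a" "0 < b" "0 < t"
  shows "(\<integral>\<^sup>+\<tau>. indicator {0<..<t} \<tau> * ennreal ((t - \<tau>) powr (a - 1) * \<tau> powr (b - 1)) \<partial>lborel) =
    ennreal (Beta a b * t powr (a + b - 1))"
proof -
  let ?f = "\<lambda>s::real. (1 - s) powr (a - 1) * s powr (b - 1)"
  have eq: "indicator {0<..<t} (t * s) * ennreal ((t - t * s) powr (a - 1) * (t * s) powr (b - 1)) =
      ennreal (t powr (a + b - 2)) * (indicator {0<..<1} s * ennreal (?f s))" for s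
  proof (cases "s \<in> {0<..<1}")
    case True
    have "t - t * s = t * (1 - s)" by (simp add: algebra_simps)
    then have "(t - t * s) powr (a - 1) * (t * s) powr (b - 1) = (t powr (a - 1) * t powr (b - 1)) * ?f s"
      using assms True by (simp add: powr_mult)
    also have "t powr (a - 1) * t powr (b - 1) = t powr (a + b - 2)"
      by (simp flip: powr_add)
    finally show ?thesis using True assms by (simp add: ennreal_mult)
  next
    case False
    then have "t * s \<notin> {0<..<t}" using assms by (auto simp: zero_less_mult_iff)
    with False show ?thesis by simp
  qed
  have "((\<lambda>s. s powr (b - 1) * (1 - s) powr (a - 1)) has_integral Beta b a) {0..1}"
    by (rule has_integral_Beta_real) (use assms in auto)
  then have "(?f has_integral Beta a b) {0<..<1}"
    by (simp add: has_integral_Icc_iff_Ioo mult.commute Beta_commute)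
  then have B: "(\<integral>\<^sup>+s. indicator {0<..<1} s * ennreal (?f s) \<partial>lborel) = ennreal (Beta a b)"
    using nn_integral_has_integral_lebesgue[of "{0<..<1}" ?f "Beta a b"]
    by (simp add: nn_integral_completion mult.commute indicator_mult_ennreal)
  have "(\<integral>\<^sup>+\<tau>. indicator {0<..<t} \<tau> * ennreal ((t - \<tau>) powr (a - 1) * \<tau> powr (b - 1)) \<partial>lborel) =
    ennreal t * (\<integral>\<^sup>+s. indicator {0<..<t} (0 + t * s) * ennreal
        ((t - (0 + t * s)) powr (a - 1) * (0 + t * s) powr (b - 1)) \<partial>lborel)"
    using assms by (subst nn_integral_real_affine[where c = t and t = 0]) auto
  also have "\<dots> = ennreal t * (ennreal (t powr (a + b - 2)) * ennreal (Beta a b))"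
    unfolding add_0 eq by (subst nn_integral_cmult) (auto simp: B)
  also have "\<dots> = ennreal (t * t powr (a + b - 2) * Beta a b)"
    using assms by (simp add: ennreal_mult[symmetric] ennreal_mult'' mult.assoc Beta_def Gamma_real_pos
        less_imp_le)
  also have "t * t powr (a + b - 2) = t powr (a + b - 1)"
    using assms powr_add[of t 1 "a + b - 2"] by (simp add: algebra_simps)
  finally show ?thesis by (simp add: mult.commute)
qed

section \<open>Planar integrals of the kernel near and far from its singularity\<close>

lemma nn_integral_inverse_norm_ball:
  obtains c where "c > 0"
    "\<And>\<rho>. 0 < \<rho> \<Longrightarrow> (\<integral>\<^sup>+(z::real^2). indicator (ball 0 \<rho>) z * ennreal (1 / norm z) \<partial>lborel) \<le> ennreal (c * \<rho>)"
proof -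
  define b where "b = Beta 1 (1/2 :: real)"
  have b: "0 < b" by (simp add: b_def Beta_def Gamma_real_pos)
  have main: "(\<integral>\<^sup>+(z::real^2). indicator (ball 0 \<rho>) z * ennreal (1 / norm z) \<partial>lborel) \<le> ennreal (4 * b\<^sup>2 * \<rho>)"
    if \<rho>: "0 < \<rho>" for \<rho>
  proof -
    \<comment> \<open>Instead of polar coordinates, 1/\<open>norm z\<close> is bounded by the
      product of the inverse square roots of the two coordinates. As 0 raised to a negative power is
      0 here, that bound would fail on the axes; the value \<open>\<top>\<close> at 0 repairs it
      without changing the integral.\<close>
    define f where "f x = (if x = 0 then \<top> else indicator {-\<rho><..<\<rho>} x * ennreal (\<bar>x\<bar> powr (-1/2)))" for x
        :: real
    have [measurable]: "f \<in> borel_measurable borel" unfolding f_def[abs_def] by measurable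
    \<comment> \<open>The factor with exponent 1 - 1 equals 1 on the interval and only brings the
      function into the form of \<open>nn_integral_Beta\<close>.\<close>
    define g where "g x = indicator {0<..<\<rho>} x * ennreal ((\<rho> - x) powr (1 - 1) * x powr (1/2 - 1))" for x
        :: real
    have [measurable]: "g \<in> borel_measurable borel" unfolding g_def[abs_def] by measurable
    have g: "(\<integral>\<^sup>+x. g x \<partial>lborel) = ennreal (b * \<rho> powr (1/2))"
      using nn_integral_Beta[of 1 "1/2" \<rho>] \<rho> by (simp add: g_def b_def)
    have "(\<integral>\<^sup>+x. f x \<partial>lborel) = (\<integral>\<^sup>+x. g x + g (0 - x) \<partial>lborel)"
    proof (rule nn_integral_cong_AE)
      have "AE x in lborel. x \<noteq> (0::real)" by (rule AE_lborel_singleton)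
      then show "AE x in lborel. f x = g x + g (0 - x)"
      proof eventually_elim
        case (elim x)
        then show ?case by (cases "x > 0") (auto simp: f_def g_def indicator_def)
      qed
    qed
    also have "\<dots> = (\<integral>\<^sup>+x. g x \<partial>lborel) + (\<integral>\<^sup>+x. g x \<partial>lborel)"
      by (simp add: nn_integral_add nn_integral_lborel_reflect[of g 0, simplified])
    also have "\<dots> = ennreal (2 * b * \<rho> powr (1/2))"
      using b by (simp add: g flip: ennreal_plus)
    finally have F: "(\<integral>\<^sup>+x. f x \<partial>lborel) = ennreal (2 * b * \<rho> powr (1/2))" .
    have le: "indicator (ball 0 \<rho>) z * ennreal (1 / norm z) \<le> f (z$1) * f (z$2)" for z :: "real^2"
    proof (cases "z \<in> ball 0 \<rho>")
      case True
      then have nz: "norm z < \<rho>" by simp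
      have c: "\<bar>z$1\<bar> < \<rho>" "\<bar>z$2\<bar> < \<rho>" using component_le_norm_cart[of z 1] component_le_norm_cart[of z 2]
          nz by auto
      have pos: "0 < f (z$1)" "0 < f (z$2)" using c by (auto simp: f_def indicator_def)
      show ?thesis
      proof (cases "z$1 = 0 \<or> z$2 = 0")
        case True
        then have "f (z$1) * f (z$2) = \<top>"
          using pos by (auto simp: f_def[of 0] ennreal_top_mult ennreal_mult_top)
        then show ?thesis by simp
      next
        case False
        have "(sqrt (\<bar>z$1\<bar> * \<bar>z$2\<bar>))\<^sup>2 \<le> (norm z)\<^sup>2"
        proof -
          have "\<bar>z$1\<bar> * \<bar>z$2\<bar> \<le> (z$1)\<^sup>2 + (z$2)\<^sup>2"
            using sum_squares_bound[of "\<bar>z$1\<bar>" "\<bar>z$2\<bar>"] mult_nonneg_nonneg[of "\<bar>z$1\<bar>" "\<bar>z$2\<bar>"]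
            unfolding power2_abs mult.assoc by linarith
          then show ?thesis by (simp add: norm_plane)
        qed
        then have "sqrt (\<bar>z$1\<bar> * \<bar>z$2\<bar>) \<le> norm z" by (rule power2_le_imp_le) simp
        then have "1 / norm z \<le> 1 / sqrt (\<bar>z$1\<bar> * \<bar>z$2\<bar>)"
          using False by (intro divide_left_mono) (auto intro!: mult_pos_pos)
        also have "\<dots> = \<bar>z$1\<bar> powr (-1/2) * \<bar>z$2\<bar> powr (-1/2)"
          using powr_minus_divide[of "\<bar>z$1\<bar>" "1/2"] powr_minus_divide[of "\<bar>z$2\<bar>" "1/2"]
          by (simp add: powr_half_sqrt real_sqrt_mult)
        finally have "ennreal (1 / norm z) \<le> ennreal (\<bar>z$1\<bar> powr (-1/2)) * ennreal (\<bar>z$2\<bar> powr (-1/2))"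
          by (simp add: ennreal_leI flip: ennreal_mult)
        with False True c show ?thesis by (simp add: f_def indicator_def abs_less_iff)
      qed
    qed simp
    have "(\<integral>\<^sup>+(z::real^2). indicator (ball 0 \<rho>) z * ennreal (1 / norm z) \<partial>lborel) \<le>
        (\<integral>\<^sup>+(z::real^2). f (z$1) * f (z$2) \<partial>lborel)"
      by (intro nn_integral_mono le)
    also have "\<dots> = ennreal (2 * b * \<rho> powr (1/2)) * ennreal (2 * b * \<rho> powr (1/2))"
      by (simp add: nn_integral_plane_prod F)
    also have "\<dots> = ennreal (4 * b\<^sup>2 * (\<rho> powr (1/2) * \<rho> powr (1/2)))"
      using b by (simp add: power2_eq_square mult_ac flip: ennreal_mult)
    also have "\<rho> powr (1/2) * \<rho> powr (1/2) = \<rho>"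
      using \<rho> by (simp flip: powr_add)
    finally show ?thesis .
  qed
  show thesis by (rule that[OF _ main]) (use b in auto)
qed

text \<open>For \<open>norm z\<close> at least \<open>\<rho>\<close>, 4 \<open>norm z\<close>^4
  dominates the product of \<open>\<rho>\<^sup>2\<close> plus the square of each coordinate. Each
  one-dimensional integral scales like 1/\<open>\<rho>\<close>; the summand 1 in the constant makes
  it positive knowing only I \<ge> 0.\<close>

lemma nn_integral_norm_pow4_far:
  obtains c where "c > 0"
    "\<And>\<rho>. 0 < \<rho> \<Longrightarrow> (\<integral>\<^sup>+(z::real^2). indicator (- ball 0 \<rho>) z * ennreal (1 / norm z ^ 4) \<partial>lborel) \<le> ennreal
        (c / \<rho>\<^sup>2)"
proof -
  have int: "integrable lborel (\<lambda>x::real. 1 / (1 + x\<^sup>2))"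
    using integrable_inverse_1_plus_square
    by (simp add: set_integrable_def divide_inverse einterval_def)
  define I where "I = (LINT (x::real)|lborel. 1 / (1 + x\<^sup>2))"
  have I0: "0 \<le> I" unfolding I_def by (rule integral_nonneg_AE) simp
  have I: "(\<integral>\<^sup>+(x::real). ennreal (1 / (1 + x\<^sup>2)) \<partial>lborel) = ennreal I"
    unfolding I_def by (rule nn_integral_eq_integral[OF int]) simp
  have main: "(\<integral>\<^sup>+(z::real^2). indicator (- ball 0 \<rho>) z * ennreal (1 / norm z ^ 4) \<partial>lborel) \<le> ennreal
      ((4 * I\<^sup>2 + 1) / \<rho>\<^sup>2)"
    if \<rho>: "0 < \<rho>" for \<rho>
  proof -
    have J: "(\<integral>\<^sup>+(x::real). ennreal (1 / (\<rho>\<^sup>2 + x\<^sup>2)) \<partial>lborel) = ennreal (I / \<rho>)"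
    proof -
      have eq: "1 / (\<rho>\<^sup>2 + (0 + \<rho> * x)\<^sup>2) = (1 / \<rho>\<^sup>2) * (1 / (1 + x\<^sup>2))" for x
      proof -
        have "\<rho>\<^sup>2 + (0 + \<rho> * x)\<^sup>2 = \<rho>\<^sup>2 * (1 + x\<^sup>2)" by (simp add: power_mult_distrib distrib_left)
        then show ?thesis by simp
      qed
      have "(\<integral>\<^sup>+(x::real). ennreal (1 / (\<rho>\<^sup>2 + x\<^sup>2)) \<partial>lborel) = ennreal \<rho> *
          (\<integral>\<^sup>+x. ennreal (1 / (\<rho>\<^sup>2 + (0 + \<rho> * x)\<^sup>2)) \<partial>lborel)"
        using \<rho> by (subst nn_integral_real_affine[where c = \<rho> and t = 0]) auto
      also have "\<dots> = ennreal \<rho> * (ennreal (1 / \<rho>\<^sup>2) * ennreal I)"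
      proof -
        have "ennreal (1 / (\<rho>\<^sup>2 + (0 + \<rho> * x)\<^sup>2)) = ennreal (1 / \<rho>\<^sup>2) * ennreal (1 / (1 + x\<^sup>2))" for x
          unfolding eq by (rule ennreal_mult) auto
        then show ?thesis by (simp only:) (subst nn_integral_cmult, auto simp: I)
      qed
      also have "\<dots> = ennreal (\<rho> * (1 / \<rho>\<^sup>2 * I))"
        using \<rho> I0 by (simp flip: ennreal_mult)
      also have "\<rho> * (1 / \<rho>\<^sup>2 * I) = I / \<rho>" using \<rho> by (simp add: power2_eq_square)
      finally show ?thesis .
    qed
    have le: "indicator (- ball 0 \<rho>) z * ennreal (1 / norm z ^ 4) \<le>
        ennreal 4 * (ennreal (1 / (\<rho>\<^sup>2 + (z$1)\<^sup>2)) * ennreal (1 / (\<rho>\<^sup>2 + (z$2)\<^sup>2)))" for z :: "real^2"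
    proof (cases "z \<in> ball 0 \<rho>")
      case False
      then have nz: "\<rho>\<^sup>2 \<le> (norm z)\<^sup>2" "0 < norm z" using \<rho> by (auto intro!: power_mono)
      have p: "0 < \<rho>\<^sup>2 + (z$1)\<^sup>2" "0 < \<rho>\<^sup>2 + (z$2)\<^sup>2" using \<rho> by (auto intro: add_pos_nonneg)
      have "(\<rho>\<^sup>2 + (z$1)\<^sup>2) * (\<rho>\<^sup>2 + (z$2)\<^sup>2) \<le> (2 * (norm z)\<^sup>2) * (2 * (norm z)\<^sup>2)"
      proof -
        have "(z$1)\<^sup>2 \<le> (norm z)\<^sup>2" "(z$2)\<^sup>2 \<le> (norm z)\<^sup>2" by (simp_all add: norm_plane)
        with nz have "\<rho>\<^sup>2 + (z$1)\<^sup>2 \<le> 2 * (norm z)\<^sup>2" "\<rho>\<^sup>2 + (z$2)\<^sup>2 \<le> 2 * (norm z)\<^sup>2" by linarith+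
        then show ?thesis using p by (intro mult_mono) auto
      qed
      also have "\<dots> = 4 * norm z ^ 4" by (simp add: power2_eq_square power4_eq_xxxx)
      finally have le: "1 / norm z ^ 4 \<le> 4 * (1 / (\<rho>\<^sup>2 + (z$1)\<^sup>2) * (1 / (\<rho>\<^sup>2 + (z$2)\<^sup>2)))"
        using nz p by (simp add: divide_simps)
      have "ennreal (4 * (1 / (\<rho>\<^sup>2 + (z$1)\<^sup>2) * (1 / (\<rho>\<^sup>2 + (z$2)\<^sup>2)))) =
          ennreal 4 * (ennreal (1 / (\<rho>\<^sup>2 + (z$1)\<^sup>2)) * ennreal (1 / (\<rho>\<^sup>2 + (z$2)\<^sup>2)))"
        using p by (subst ennreal_mult, simp, simp, subst ennreal_mult, auto)
      from this[symmetric] show ?thesis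
        using ennreal_leI[OF le] by (simp only:) (auto simp: indicator_def)
    qed simp
    have "(\<integral>\<^sup>+(z::real^2). indicator (- ball 0 \<rho>) z * ennreal (1 / norm z ^ 4) \<partial>lborel) \<le>
      ennreal 4 * (\<integral>\<^sup>+(z::real^2). ennreal (1 / (\<rho>\<^sup>2 + (z$1)\<^sup>2)) * ennreal (1 / (\<rho>\<^sup>2 + (z$2)\<^sup>2)) \<partial>lborel)"
    proof -
      have m: "(\<lambda>z::real^2. ennreal (1 / (\<rho>\<^sup>2 + (z$1)\<^sup>2)) * ennreal (1 / (\<rho>\<^sup>2 + (z$2)\<^sup>2))) \<in> borel_measurable
          lborel"
        by measurable
      show ?thesis unfolding nn_integral_cmult[OF m, symmetric] by (intro nn_integral_mono le)
    qed
    also have "\<dots> = ennreal 4 * (ennreal (I / \<rho>) * ennreal (I / \<rho>))"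
      using nn_integral_plane_prod[of "\<lambda>x. ennreal (1 / (\<rho>\<^sup>2 + x\<^sup>2))" "\<lambda>x. ennreal (1 / (\<rho>\<^sup>2 + x\<^sup>2))"]
          by (simp add: J)
    also have "\<dots> = ennreal (4 * (I / \<rho> * (I / \<rho>)))"
    proof -
      have i: "0 \<le> I / \<rho>" using I0 \<rho> by simp
      show ?thesis
        by (simp only: ennreal_mult[OF zero_le_numeral mult_nonneg_nonneg[OF i i]] ennreal_mult[OF i i])
    qed
    also have "4 * (I / \<rho> * (I / \<rho>)) = 4 * I\<^sup>2 / \<rho>\<^sup>2"
      by (simp add: power2_eq_square)
    also have "\<dots> \<le> ennreal ((4 * I\<^sup>2 + 1) / \<rho>\<^sup>2)"
      by (intro ennreal_leI divide_right_mono) auto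
    finally show ?thesis .
  qed
  show thesis by (rule that[OF _ main]) (auto intro: add_nonneg_pos)
qed

text \<open>On the part where \<open>g y \<le> f x = a\<close> the kernel is split at distance \<open>a powr (-2/3)\<close>: near \<open>x\<close> the
  bound \<open>g \<le> a\<close> is used, and far from \<open>x\<close> Young's inequality against \<open>norm z ^ (-4)\<close>.\<close>

lemma riesz_half:
  obtains C where "C > 0" "\<And>f g. L43 f 1 \<Longrightarrow> L43 g 1 \<Longrightarrow>
    (\<integral>\<^sup>+x. \<integral>\<^sup>+y. indicator {y. \<bar>g y\<bar> \<le> \<bar>f x\<bar>} y * ennreal (\<bar>f x\<bar> * (\<bar>g y\<bar> / norm (x - y))) \<partial>lborel \<partial>lborel) \<le>
        ennreal C"
proof -
  obtain c where c: "c > 0"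
    "\<And>\<rho>. 0 < \<rho> \<Longrightarrow> (\<integral>\<^sup>+(z::real^2). indicator (ball 0 \<rho>) z * ennreal (1 / norm z) \<partial>lborel) \<le> ennreal (c * \<rho>)"
    using nn_integral_inverse_norm_ball by blast
  obtain d where d: "d > 0"
    "\<And>\<rho>. 0 < \<rho> \<Longrightarrow> (\<integral>\<^sup>+(z::real^2). indicator (- ball 0 \<rho>) z * ennreal (1 / norm z ^ 4) \<partial>lborel) \<le> ennreal
        (d / \<rho>\<^sup>2)"
    using nn_integral_norm_pow4_far by blast
  show thesis
  proof (rule that[of "c + 1 + d"])
    fix f g assume f: "L43 f 1" and g: "L43 g 1"
    note [measurable] = L43_measurable[OF f] L43_measurable[OF g]
    have inner: "(\<integral>\<^sup>+y. indicator {y. \<bar>g y\<bar> \<le> \<bar>f x\<bar>} y * ennreal (\<bar>f x\<bar> * (\<bar>g y\<bar> / norm (x - y))) \<partial>lborel) \<le>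
       ennreal (c + 1 + d) * ennreal (\<bar>f x\<bar> powr (4/3))" for x
    proof (cases "f x = 0")
      case False
      define a where "a = \<bar>f x\<bar>"
      have a: "0 < a" using False by (simp add: a_def)
      define \<rho> where "\<rho> = a powr (-2/3)"
      have \<rho>: "0 < \<rho>" using a by (simp add: \<rho>_def)
      \<comment> \<open>The radius balances the two regions: the near part a \<open>\<rho>\<close>
        and the far part 1/(a \<open>\<rho>\<^sup>2\<close>) both equal a^(1/3). Multiplied by
        \<bar>f x\<bar> = a, each part becomes \<bar>f x\<bar>^(4/3), which is integrable.\<close>
      have ra: "a * \<rho> = a powr (1/3)" using a powr_add[of a 1 "-2/3"] by (simp add: \<rho>_def)
      have rb: "(1 / a) * (1 / \<rho>\<^sup>2) = a powr (1/3)"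
      proof -
        have "\<rho>\<^sup>2 = a powr (-4/3)" by (simp add: \<rho>_def power2_eq_square flip: powr_add)
        then have "a * \<rho>\<^sup>2 = a powr (-1/3)" using a powr_add[of a 1 "-4/3"] by simp
        moreover have "a powr (-1/3) = 1 / a powr (1/3)" using powr_minus_divide[of a "1/3"] by simp
        ultimately have "1 / (a * \<rho>\<^sup>2) = a powr (1/3)" by simp
        then show ?thesis by simp
      qed
      have pt: "indicator {y. \<bar>g y\<bar> \<le> \<bar>f x\<bar>} y * ennreal (\<bar>g y\<bar> / norm (x - y)) \<le>
          (ennreal a * (indicator (ball 0 \<rho>) (x - y) * ennreal (1 / norm (x - y))) + ennreal (a powr (1/3))
              * ennreal (\<bar>g y\<bar> powr (4/3)))
          + ennreal (1 / a) * (indicator (- ball 0 \<rho>) (x - y) * ennreal (1 / norm (x - y) ^ 4))"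
              (is "?l \<le> (?A + ?B) + ?D") for y
      proof (cases "\<bar>g y\<bar> \<le> a")
        case le: True
        show ?thesis
        proof (cases "x - y \<in> ball 0 \<rho>")
          case True
          have "\<bar>g y\<bar> / norm (x - y) \<le> a * (1 / norm (x - y))"
            using le by (simp add: divide_right_mono)
          then have "?l \<le> ?A"
            using True le a by (simp add: a_def[symmetric] ennreal_leI flip: ennreal_mult)
          also have "?A \<le> (?A + ?B) + ?D" by (simp add: add.assoc)
          finally show ?thesis .
        next
          case far: False
          let ?k = "1 / norm (x - y)"
          \<comment> \<open>The factors a^(1/4) and a^(-1/4) cancel in the product; under the powers
            4/3 and 4 they become a^(1/3) and 1/a, the sizes required by the balance above.\<close>
          have "(a powr (1/4) * \<bar>g y\<bar>) * (a powr (-1/4) * ?k) \<le>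
            (a powr (1/4) * \<bar>g y\<bar>) powr (4/3) / (4/3) + (a powr (-1/4) * ?k) powr 4 / 4"
            by (intro Youngs_inequality) auto
          also have "(a powr (1/4) * \<bar>g y\<bar>) powr (4/3) = a powr (1/3) * \<bar>g y\<bar> powr (4/3)"
            by (simp add: powr_mult powr_powr)
          also have "(a powr (-1/4) * ?k) powr 4 = (1 / a) * (1 / norm (x - y) ^ 4)"
          proof -
            have "(a powr (-1/4) * ?k) powr 4 = a powr -1 * ?k powr 4"
              by (simp only: powr_mult powr_powr) simp
            also have "?k powr 4 = ?k ^ 4" by simp
            also have "a powr -1 = 1 / a" using a powr_minus_divide[of a 1] by simp
            finally show ?thesis by (simp add: power_divide)
          qed
          also have "(a powr (1/4) * \<bar>g y\<bar>) * (a powr (-1/4) * ?k) = (a powr (1/4) * a powr (-1/4)) *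
              (\<bar>g y\<bar> / norm (x - y))"
            by simp
          also have "a powr (1/4) * a powr (-1/4) = 1" using a by (simp flip: powr_add)
          finally have "1 * (\<bar>g y\<bar> / norm (x - y)) \<le> a powr (1/3) * \<bar>g y\<bar> powr (4/3) / (4/3) + 1 / a *
              (1 / norm (x - y) ^ 4) / 4" .
          also have "\<dots> \<le> a powr (1/3) * \<bar>g y\<bar> powr (4/3) + 1 / a * (1 / norm (x - y) ^ 4)"
          proof -
            have "0 \<le> a powr (1/3) * \<bar>g y\<bar> powr (4/3)" "0 \<le> 1 / a * (1 / norm (x - y) ^ 4)" using a by auto
            moreover have "u / (4/3) + v / 4 \<le> u + v" if "0 \<le> u" "0 \<le> v" for u v :: real
              using that by (simp add: field_simps)
            ultimately show ?thesis by blast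
          qed
          finally have "ennreal (\<bar>g y\<bar> / norm (x - y)) \<le> ennreal
              (a powr (1/3) * \<bar>g y\<bar> powr (4/3) + 1 / a * (1 / norm (x - y) ^ 4))"
            by (simp add: ennreal_leI)
          also have "\<dots> = ?B + ?D"
            using far a by (simp flip: ennreal_mult ennreal_plus)
          finally have "?l \<le> ?B + ?D" by (auto simp: indicator_def)
          also have "?B + ?D \<le> (?A + ?B) + ?D" by (simp add: add.assoc add.left_commute[of ?A])
          finally show ?thesis .
        qed
      qed (simp add: a_def)
      have "(\<integral>\<^sup>+y. indicator {y. \<bar>g y\<bar> \<le> \<bar>f x\<bar>} y * ennreal (\<bar>f x\<bar> * (\<bar>g y\<bar> / norm (x - y))) \<partial>lborel) =
        ennreal a * (\<integral>\<^sup>+y. indicator {y. \<bar>g y\<bar> \<le> \<bar>f x\<bar>} y * ennreal (\<bar>g y\<bar> / norm (x - y)) \<partial>lborel)"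
      proof -
        have "indicator {y. \<bar>g y\<bar> \<le> \<bar>f x\<bar>} y * ennreal (\<bar>f x\<bar> * (\<bar>g y\<bar> / norm (x - y))) =
          ennreal a * (indicator {y. \<bar>g y\<bar> \<le> \<bar>f x\<bar>} y * ennreal (\<bar>g y\<bar> / norm (x - y)))" for y
          unfolding a_def by (subst ennreal_mult) (auto simp: mult.left_commute)
        then show ?thesis by (simp only:) (rule nn_integral_cmult, measurable)
      qed
      also have "\<dots> \<le> ennreal a * (\<integral>\<^sup>+y. (ennreal a *
          (indicator (ball 0 \<rho>) (x - y) * ennreal (1 / norm (x - y))) + ennreal (a powr (1/3)) * ennreal
          (\<bar>g y\<bar> powr (4/3)))
          + ennreal (1 / a) * (indicator (- ball 0 \<rho>) (x - y) * ennreal (1 / norm (x - y) ^ 4)) \<partial>lborel)"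
        by (intro mult_left_mono nn_integral_mono pt) auto
      also have "\<dots> = ennreal a * ((ennreal a * (\<integral>\<^sup>+(z::real^2). indicator (ball 0 \<rho>) z * ennreal
          (1 / norm z) \<partial>lborel)
          + ennreal (a powr (1/3)) * (\<integral>\<^sup>+y. ennreal (\<bar>g y\<bar> powr (4/3)) \<partial>lborel))
          + ennreal (1 / a) * (\<integral>\<^sup>+(z::real^2). indicator (- ball 0 \<rho>) z * ennreal (1 / norm z ^ 4) \<partial>lborel))"
      proof -
        let ?p = "\<lambda>z::real^2. indicator (ball 0 \<rho>) z * ennreal (1 / norm z)"
        let ?q = "\<lambda>z::real^2. indicator (- ball 0 \<rho>) z * ennreal (1 / norm z ^ 4)"
        have [measurable]: "ball (0::real^2) \<rho> \<in> sets borel" "- ball (0::real^2) \<rho> \<in> sets borel" by auto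
        have [measurable]: "?p \<in> borel_measurable borel" "?q \<in> borel_measurable borel"
          by (intro borel_measurable_times_ennreal borel_measurable_indicator; simp)+
        have lin: "(\<integral>\<^sup>+y. (u * P y + v * Q y) + w * R y \<partial>lborel) =
            (u * (\<integral>\<^sup>+y. P y \<partial>lborel) + v * (\<integral>\<^sup>+y. Q y \<partial>lborel)) + w * (\<integral>\<^sup>+y. R y \<partial>lborel)"
          if [measurable]: "P \<in> borel_measurable borel" "Q \<in> borel_measurable borel" "R \<in> borel_measurable
              borel"
          for P Q R :: "real^2 \<Rightarrow> ennreal" and u v w
          by (simp add: nn_integral_add nn_integral_cmult)
        have m: "(\<lambda>y. ?p (x - y)) \<in> borel_measurable borel" "(\<lambda>y. ?q (x - y)) \<in> borel_measurable borel"
          "(\<lambda>y. ennreal (\<bar>g y\<bar> powr (4/3))) \<in> borel_measurable borel"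
          using measurable_compose[of "\<lambda>y. x - y" borel borel ?p borel]
              measurable_compose[of "\<lambda>y. x - y" borel borel ?q borel] by auto
        have "(\<integral>\<^sup>+y. ?p (x - y) \<partial>lborel) = (\<integral>\<^sup>+z. ?p z \<partial>lborel)" "(\<integral>\<^sup>+y. ?q (x - y) \<partial>lborel) =
            (\<integral>\<^sup>+z. ?q z \<partial>lborel)"
          by (rule nn_integral_lborel_reflect, measurable)+
        then show ?thesis by (simp only: lin[OF m(1) m(3) m(2)])
      qed
      also have "\<dots> \<le> ennreal a * ((ennreal a * ennreal (c * \<rho>) + ennreal (a powr (1/3)) * ennreal 1) +
          ennreal (1 / a) * ennreal (d / \<rho>\<^sup>2))"
        using g by (intro mult_left_mono add_mono c d \<rho>) (auto simp: L43_def)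
      also have "\<dots> = ennreal (a * ((a * (c * \<rho>) + a powr (1/3) * 1) + (1 / a) * (d / \<rho>\<^sup>2)))"
        using a c(1) d(1) \<rho> by (simp flip: ennreal_mult ennreal_plus)
      also have "a * ((a * (c * \<rho>) + a powr (1/3) * 1) + (1 / a) * (d / \<rho>\<^sup>2)) =
         a * (c * (a * \<rho>) + a powr (1/3) + d * ((1 / a) * (1 / \<rho>\<^sup>2)))" by simp
      also have "\<dots> = (c + 1 + d) * (a * a powr (1/3))"
        unfolding ra rb by (simp add: algebra_simps)
      also have "a * a powr (1/3) = a powr (4/3)"
        using a powr_add[of a 1 "1/3"] by simp
      finally show ?thesis using c(1) d(1) by (simp add: a_def ennreal_mult)
    qed simp
    have "(\<integral>\<^sup>+x. \<integral>\<^sup>+y. indicator {y. \<bar>g y\<bar> \<le> \<bar>f x\<bar>} y * ennreal (\<bar>f x\<bar> * (\<bar>g y\<bar> / norm (x - y))) \<partial>lborel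
        \<partial>lborel) \<le>
      (\<integral>\<^sup>+x. ennreal (c + 1 + d) * ennreal (\<bar>f x\<bar> powr (4/3)) \<partial>lborel)"
      by (intro nn_integral_mono inner)
    also have "\<dots> \<le> ennreal (c + 1 + d) * ennreal 1"
    proof -
      have m: "(\<lambda>x. ennreal (\<bar>f x\<bar> powr (4/3))) \<in> borel_measurable lborel" by measurable
      show ?thesis using f unfolding nn_integral_cmult[OF m] L43_def by (intro mult_left_mono) auto
    qed
    finally show "(\<integral>\<^sup>+x. \<integral>\<^sup>+y. indicator {y. \<bar>g y\<bar> \<le> \<bar>f x\<bar>} y * ennreal (\<bar>f x\<bar> * (\<bar>g y\<bar> / norm (x - y)))
        \<partial>lborel \<partial>lborel) \<le> ennreal (c + 1 + d)"
      by simp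
  qed (use c d in auto)
qed

lemma L43_scale:
  assumes "L43 f A" "0 < c"
  shows "L43 (\<lambda>x. f x / c) (A / c)"
proof -
  note [measurable] = L43_measurable[OF assms(1)]
  have "(\<integral>\<^sup>+x. ennreal (\<bar>f x / c\<bar> powr (4/3)) \<partial>lborel) =
      (\<integral>\<^sup>+x. ennreal (1 / c powr (4/3)) * ennreal (\<bar>f x\<bar> powr (4/3)) \<partial>lborel)"
    using assms by (simp add: powr_divide flip: ennreal_mult)
  also have "\<dots> \<le> ennreal (1 / c powr (4/3)) * ennreal (A powr (4/3))"
    using assms by (subst nn_integral_cmult) (auto simp: L43_def intro!: mult_left_mono)
  also have "\<dots> = ennreal ((A / c) powr (4/3))"
    using assms by (simp add: L43_def powr_divide flip: ennreal_mult)
  finally show ?thesis using assms by (simp add: L43_def)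
qed

definition HLS_bound :: "real \<Rightarrow> bool" where
  "HLS_bound C \<longleftrightarrow> C > 0 \<and> (\<forall>f g A B. L43 f A \<longrightarrow> L43 g B \<longrightarrow> 0 < A \<longrightarrow> 0 < B \<longrightarrow>
    (\<integral>\<^sup>+x. \<integral>\<^sup>+y. ennreal (\<bar>f x\<bar> * (\<bar>g y\<bar> / norm (x - y))) \<partial>lborel \<partial>lborel) \<le> ennreal (C * A * B))"

text \<open>For each pair of points one of \<bar>f x\<bar>, \<bar>g y\<bar> is the larger; the two
  cases are the half estimate for (f, g) and for (g, f), as the kernel is symmetric. General bounds
  follow by homogeneity, whence the positivity of A and B.\<close>

theorem Hardy_Littlewood_Sobolev: "\<exists>C. HLS_bound C"
proof -
  obtain C where C: "C > 0" "\<And>f g. L43 f 1 \<Longrightarrow> L43 g 1 \<Longrightarrow>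
    (\<integral>\<^sup>+x. \<integral>\<^sup>+y. indicator {y. \<bar>g y\<bar> \<le> \<bar>f x\<bar>} y * ennreal (\<bar>f x\<bar> * (\<bar>g y\<bar> / norm (x - y))) \<partial>lborel \<partial>lborel) \<le>
        ennreal C"
    using riesz_half by blast
  have unit: "(\<integral>\<^sup>+x. \<integral>\<^sup>+y. ennreal (\<bar>f x\<bar> * (\<bar>g y\<bar> / norm (x - y))) \<partial>lborel \<partial>lborel) \<le> ennreal (2 * C)"
    if f: "L43 f 1" and g: "L43 g 1" for f g
  proof -
    note [measurable] = L43_measurable[OF f] L43_measurable[OF g]
    let ?H = "\<lambda>f g x y. indicator {y. \<bar>g y\<bar> \<le> \<bar>f x\<bar>} y * ennreal (\<bar>f x\<bar> * (\<bar>g y\<bar> / norm (x - y)))"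
    have "(\<integral>\<^sup>+x. \<integral>\<^sup>+y. ennreal (\<bar>f x\<bar> * (\<bar>g y\<bar> / norm (x - y))) \<partial>lborel \<partial>lborel) \<le>
      (\<integral>\<^sup>+x. \<integral>\<^sup>+y. ?H f g x y + ?H g f y x \<partial>lborel \<partial>lborel)"
      by (intro nn_integral_mono) (auto simp: indicator_def norm_minus_commute mult.commute)
    also have "\<dots> = (\<integral>\<^sup>+x. (\<integral>\<^sup>+y. ?H f g x y \<partial>lborel) + (\<integral>\<^sup>+y. ?H g f y x \<partial>lborel) \<partial>lborel)"
      by (intro nn_integral_cong nn_integral_add) measurable
    also have "\<dots> = (\<integral>\<^sup>+x. \<integral>\<^sup>+y. ?H f g x y \<partial>lborel \<partial>lborel) + (\<integral>\<^sup>+x. \<integral>\<^sup>+y. ?H g f y x \<partial>lborel \<partial>lborel)"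
      by (intro nn_integral_add) measurable
    also have "(\<integral>\<^sup>+x. \<integral>\<^sup>+y. ?H g f y x \<partial>lborel \<partial>lborel) = (\<integral>\<^sup>+y. \<integral>\<^sup>+x. ?H g f y x \<partial>lborel \<partial>lborel)"
      by (rule lborel_pair.Fubini') measurable
    also have "(\<integral>\<^sup>+x. \<integral>\<^sup>+y. ?H f g x y \<partial>lborel \<partial>lborel) + \<dots> \<le> ennreal C + ennreal C"
      by (intro add_mono C f g)
    finally show ?thesis using C(1) by (simp flip: ennreal_plus)
  qed
  show ?thesis
    unfolding HLS_bound_def
  proof (intro exI[of _ "2 * C"] conjI allI impI)
    fix f g A B assume f: "L43 f A" and g: "L43 g B" and AB: "0 < A" "0 < (B::real)"
    note [measurable] = L43_measurable[OF f] L43_measurable[OF g]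
    have "(\<integral>\<^sup>+x. \<integral>\<^sup>+y. ennreal (\<bar>f x\<bar> * (\<bar>g y\<bar> / norm (x - y))) \<partial>lborel \<partial>lborel) =
      (\<integral>\<^sup>+x. \<integral>\<^sup>+y. ennreal (A * B) * ennreal (\<bar>f x / A\<bar> * (\<bar>g y / B\<bar> / norm (x - y))) \<partial>lborel \<partial>lborel)"
      using AB by (simp flip: ennreal_mult)
    also have "\<dots> = ennreal (A * B) * (\<integral>\<^sup>+x. \<integral>\<^sup>+y. ennreal (\<bar>f x / A\<bar> * (\<bar>g y / B\<bar> / norm (x - y))) \<partial>lborel
        \<partial>lborel)"
      by (simp add: nn_integral_cmult)
    also have "\<dots> \<le> ennreal (A * B) * ennreal (2 * C)"
      using L43_scale[OF f AB(1)] L43_scale[OF g AB(2)] AB by (intro mult_left_mono unit) auto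
    also have "\<dots> = ennreal (2 * C * A * B)" using AB C by (simp add: mult_ac flip: ennreal_mult)
    finally show "(\<integral>\<^sup>+x. \<integral>\<^sup>+y. ennreal (\<bar>f x\<bar> * (\<bar>g y\<bar> / norm (x - y))) \<partial>lborel \<partial>lborel) \<le> ennreal
        (2 * C * A * B)" .
  qed (use C in auto)
qed

subsection \<open>The nonlinearity\<close>

definition nl :: "(real^2 \<Rightarrow> real) \<Rightarrow> real^2 \<Rightarrow> real^2" where
  "nl g x = g x *\<^sub>R grad_phi g x"

lemma debye_nonlin_eq: "debye_nonlin T = div_distr (nl (density_of T))"
  by (simp add: debye_nonlin_def nl_def[abs_def])

lemma norm_grad_phi_kernel: "norm ((g y / (norm (x - y))\<^sup>2) *\<^sub>R (x - y)) = \<bar>g y\<bar> / norm (x - y)"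
  by (cases "x = y") (auto simp: power2_eq_square)

lemma norm_grad_phi_le: "ennreal (norm (grad_phi g x)) \<le> (\<integral>\<^sup>+y. ennreal (\<bar>g y\<bar> / norm (x - y)) \<partial>lborel)"
proof -
  let ?v = "LINT y|lborel. (g y / (norm (x - y))\<^sup>2) *\<^sub>R (x - y)"
  have "1 / (2 * pi) \<le> 1" using pi_gt3 by simp
  then have "1 / (2 * pi) * norm ?v \<le> 1 * norm ?v" by (intro mult_right_mono) auto
  then have "norm (grad_phi g x) \<le> norm ?v"
    by (simp add: grad_phi_def)
  then have "ennreal (norm (grad_phi g x)) \<le> ennreal (norm ?v)" by (rule ennreal_leI)
  also have "\<dots> \<le> (\<integral>\<^sup>+y. ennreal (\<bar>g y\<bar> / norm (x - y)) \<partial>lborel)"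
    using ennreal_norm_integral_le[of lborel "\<lambda>y. (g y / (norm (x - y))\<^sup>2) *\<^sub>R (x - y)"]
    unfolding norm_grad_phi_kernel .
  finally show ?thesis .
qed

lemma grad_phi_measurable_pair:
  assumes [measurable]: "case_prod u \<in> borel_measurable (M \<Otimes>\<^sub>M borel)"
  shows "(\<lambda>(\<tau>, x). grad_phi (u \<tau>) x) \<in> borel_measurable (M \<Otimes>\<^sub>M borel)"
proof -
  have "(\<lambda>p. LINT y|lborel. (u (fst p) y / (norm (snd p - y))\<^sup>2) *\<^sub>R (snd p - y)) \<in> borel_measurable
      (M \<Otimes>\<^sub>M borel)"
    by measurable
  then show ?thesis
    unfolding grad_phi_def[abs_def] split_beta' by measurable
qed

lemma nl_measurable_pair:
  assumes [measurable]: "case_prod u \<in> borel_measurable (M \<Otimes>\<^sub>M borel)"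
  shows "(\<lambda>(\<tau>, x). nl (u \<tau>) x) \<in> borel_measurable (M \<Otimes>\<^sub>M borel)"
proof -
  note [measurable] = grad_phi_measurable_pair[OF assms]
  show ?thesis unfolding nl_def by measurable
qed

lemma grad_phi_measurable:
  assumes [measurable]: "g \<in> borel_measurable borel"
  shows "grad_phi g \<in> borel_measurable borel"
  unfolding grad_phi_def[abs_def] by measurable

lemma nl_measurable:
  assumes [measurable]: "g \<in> borel_measurable borel"
  shows "nl g \<in> borel_measurable borel"
proof -
  note [measurable] = grad_phi_measurable[OF assms]
  show ?thesis unfolding nl_def[abs_def] by measurable
qed

text \<open>A strictly positive function with bound 1. Testing the Hardy-Littlewood-Sobolev
  inequality against it shows that the field integral converges absolutely almost
  everywhere.\<close>

lemma L43_heat_kernel_one: "L43 (heat_kernel 1) 1"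
proof -
  have "\<bar>heat_kernel 1 x\<bar> powr (4/3) \<le> heat_kernel 1 x" for x
  proof -
    have "heat_kernel 1 x \<le> 1" using heat_kernel_le[of 1 x] pi_gt3 by (simp add: divide_le_eq order_trans)
    then have "heat_kernel 1 x powr (4/3) \<le> heat_kernel 1 x powr 1"
      using heat_kernel_pos[of 1 x] by (intro powr_mono') auto
    then show ?thesis using heat_kernel_pos[of 1 x] by simp
  qed
  then have "(\<integral>\<^sup>+x. ennreal (\<bar>heat_kernel 1 x\<bar> powr (4/3)) \<partial>lborel) \<le>
      (\<integral>\<^sup>+x. ennreal (heat_kernel 1 x) \<partial>lborel)"
    by (intro nn_integral_mono ennreal_leI)
  then show ?thesis by (simp add: L43_def nn_integral_heat_kernel)
qed

text \<open>A fixed global choice of the constant, so that the smallness threshold can be named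
  before any datum is given.\<close>

definition nl_const :: real where
  "nl_const = (SOME C. HLS_bound C)"

lemma nl_const: "HLS_bound nl_const"
  unfolding nl_const_def by (rule someI_ex[OF Hardy_Littlewood_Sobolev])

lemmas nl_const_pos = nl_const[unfolded HLS_bound_def, THEN conjunct1]
  and nl_const_HLS = nl_const[unfolded HLS_bound_def, THEN conjunct2, rule_format]

lemma nn_integral_cmult_real:
  fixes g :: "'a \<Rightarrow> real"
  assumes "0 \<le> c" "\<And>y. 0 \<le> g y" and [measurable]: "g \<in> borel_measurable M"
  shows "(\<integral>\<^sup>+y. ennreal (c * g y) \<partial>M) = ennreal c * (\<integral>\<^sup>+y. ennreal (g y) \<partial>M)"
  unfolding ennreal_mult[OF assms(1,2)] by (rule nn_integral_cmult) measurable

lemma riesz_finite_AE: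
  assumes f: "L43 f A" and A: "0 < A"
  shows "AE x in lborel. (\<integral>\<^sup>+y. ennreal (\<bar>f y\<bar> / norm (x - y)) \<partial>lborel) < \<infinity>"
proof -
  note [measurable] = L43_measurable[OF f]
  note C = nl_const_HLS[OF L43_heat_kernel_one f zero_less_one A]
  have "AE x in lborel. (\<integral>\<^sup>+y. ennreal (\<bar>heat_kernel 1 x\<bar> * (\<bar>f y\<bar> / norm (x - y))) \<partial>lborel) \<noteq> \<infinity>"
    by (rule nn_integral_noteq_infinite) (use C in \<open>auto simp: top_unique\<close>)
  then show ?thesis
  proof eventually_elim
    case (elim x)
    have "(\<integral>\<^sup>+y. ennreal (\<bar>heat_kernel 1 x\<bar> * (\<bar>f y\<bar> / norm (x - y))) \<partial>lborel) =
      ennreal \<bar>heat_kernel 1 x\<bar> * (\<integral>\<^sup>+y. ennreal (\<bar>f y\<bar> / norm (x - y)) \<partial>lborel)"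
      by (rule nn_integral_cmult_real) auto
    then have "ennreal \<bar>heat_kernel 1 x\<bar> * (\<integral>\<^sup>+y. ennreal (\<bar>f y\<bar> / norm (x - y)) \<partial>lborel) \<noteq> \<top>"
      using elim by simp
    moreover have "ennreal \<bar>heat_kernel 1 x\<bar> \<noteq> 0"
      using heat_kernel_pos[of 1 x] by simp
    ultimately show ?case
      by (cases "\<integral>\<^sup>+y. ennreal (\<bar>f y\<bar> / norm (x - y)) \<partial>lborel") (auto simp: ennreal_mult_top)
  qed
qed

lemma bilinear_field_bound:
  assumes f: "L43 f A" and g: "L43 g B" and "0 < A" "0 < B"
  shows "(\<integral>\<^sup>+x. ennreal (\<bar>f x\<bar> * norm (grad_phi g x)) \<partial>lborel) \<le> ennreal (nl_const * A * B)"
proof -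
  note [measurable] = L43_measurable[OF f] L43_measurable[OF g]
  have "(\<integral>\<^sup>+x. ennreal (\<bar>f x\<bar> * norm (grad_phi g x)) \<partial>lborel) \<le>
      (\<integral>\<^sup>+x. \<integral>\<^sup>+y. ennreal (\<bar>f x\<bar> * (\<bar>g y\<bar> / norm (x - y))) \<partial>lborel \<partial>lborel)"
  proof (rule nn_integral_mono)
    fix x
    have "ennreal (\<bar>f x\<bar> * norm (grad_phi g x)) \<le> ennreal \<bar>f x\<bar> *
        (\<integral>\<^sup>+y. ennreal (\<bar>g y\<bar> / norm (x - y)) \<partial>lborel)"
      by (simp add: ennreal_mult mult_left_mono norm_grad_phi_le)
    also have "\<dots> = (\<integral>\<^sup>+y. ennreal \<bar>f x\<bar> * ennreal (\<bar>g y\<bar> / norm (x - y)) \<partial>lborel)"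
      by (rule nn_integral_cmult[symmetric]) measurable
    also have "\<dots> = (\<integral>\<^sup>+y. ennreal (\<bar>f x\<bar> * (\<bar>g y\<bar> / norm (x - y))) \<partial>lborel)"
      by (intro nn_integral_cong ennreal_mult[symmetric]) auto
    finally show "ennreal (\<bar>f x\<bar> * norm (grad_phi g x)) \<le>
        (\<integral>\<^sup>+y. ennreal (\<bar>f x\<bar> * (\<bar>g y\<bar> / norm (x - y))) \<partial>lborel)" .
  qed
  also have "\<dots> \<le> ennreal (nl_const * A * B)" by (rule nl_const_HLS[OF assms])
  finally show ?thesis .
qed

lemma nl_bound:
  assumes "L43 f A" "0 < A"
  shows "(\<integral>\<^sup>+x. ennreal (norm (nl f x)) \<partial>lborel) \<le> ennreal (nl_const * A * A)"
  using bilinear_field_bound[OF assms(1,1) assms(2,2)] by (simp add: nl_def)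

text \<open>Additivity of the field is available where both integrals converge absolutely, hence
  almost everywhere; elsewhere the default value 0 of a divergent integral could break it.\<close>

lemma grad_phi_minus_AE:
  assumes f: "L43 f A" "0 < A" and g: "L43 g B" "0 < B"
  shows "AE x in lborel. grad_phi f x - grad_phi g x = grad_phi (\<lambda>y. f y - g y) x"
  using riesz_finite_AE[OF f] riesz_finite_AE[OF g]
proof eventually_elim
  case (elim x)
  note [measurable] = L43_measurable[OF f(1)] L43_measurable[OF g(1)]
  have i: "integrable lborel (\<lambda>y. (f y / (norm (x - y))\<^sup>2) *\<^sub>R (x - y))" "integrable lborel
      (\<lambda>y. (g y / (norm (x - y))\<^sup>2) *\<^sub>R (x - y))"
    by (rule integrableI_bounded; use elim in \<open>simp add: norm_grad_phi_kernel del: norm_scaleR\<close>)+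
  have "(LINT y|lborel. (f y / (norm (x - y))\<^sup>2) *\<^sub>R (x - y)) -
      (LINT y|lborel. (g y / (norm (x - y))\<^sup>2) *\<^sub>R (x - y)) =
    (LINT y|lborel. ((f y - g y) / (norm (x - y))\<^sup>2) *\<^sub>R (x - y))"
    unfolding Bochner_Integration.integral_diff[OF i, symmetric]
        by (simp only: diff_divide_distrib scaleR_left_diff_distrib)
  then show ?case
    unfolding grad_phi_def by (simp only: scaleR_diff_right[symmetric])
qed

text \<open>With d = f - g the difference of the products is d grad phi_f + g grad phi_d, two
  bilinear terms of equal size; hence the factor 2.\<close>

lemma nl_diff_bound:
  assumes f: "L43 f A" and g: "L43 g A" and A: "0 < A" and d: "L43 (\<lambda>x. f x - g x) D" and D: "0 < D"
  shows "(\<integral>\<^sup>+x. ennreal (norm (nl f x - nl g x)) \<partial>lborel) \<le> ennreal (2 * nl_const * A * D)"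
proof -
  note [measurable] = L43_measurable[OF f] L43_measurable[OF g]
  note [measurable] = grad_phi_measurable[of f] grad_phi_measurable[of g]
      grad_phi_measurable[of "\<lambda>x. f x - g x"]
  have "(\<integral>\<^sup>+x. ennreal (norm (nl f x - nl g x)) \<partial>lborel) \<le>
    (\<integral>\<^sup>+x. ennreal (\<bar>f x - g x\<bar> * norm (grad_phi f x)) + ennreal (\<bar>g x\<bar> * norm (grad_phi (\<lambda>y. f y - g y) x))
        \<partial>lborel)"
  proof (rule nn_integral_mono_AE)
    show "AE x in lborel. ennreal (norm (nl f x - nl g x)) \<le>
      ennreal (\<bar>f x - g x\<bar> * norm (grad_phi f x)) + ennreal (\<bar>g x\<bar> * norm (grad_phi (\<lambda>y. f y - g y) x))"
      using grad_phi_minus_AE[OF f A g A]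
    proof eventually_elim
      case (elim x)
      have "nl f x - nl g x = (f x - g x) *\<^sub>R grad_phi f x + g x *\<^sub>R (grad_phi f x - grad_phi g x)"
        by (simp add: nl_def algebra_simps)
      also have "norm \<dots> \<le> \<bar>f x - g x\<bar> * norm (grad_phi f x) + \<bar>g x\<bar> * norm (grad_phi f x - grad_phi g x)"
        by (rule order_trans[OF norm_triangle_ineq]) simp
      finally show ?case
        by (simp add: elim ennreal_leI flip: ennreal_plus)
    qed
  qed
  also have "\<dots> = (\<integral>\<^sup>+x. ennreal (\<bar>f x - g x\<bar> * norm (grad_phi f x)) \<partial>lborel) +
      (\<integral>\<^sup>+x. ennreal (\<bar>g x\<bar> * norm (grad_phi (\<lambda>y. f y - g y) x)) \<partial>lborel)"
    by (rule nn_integral_add) measurable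
  also have "\<dots> \<le> ennreal (nl_const * D * A) + ennreal (nl_const * A * D)"
    by (intro add_mono bilinear_field_bound f g d A D)
  also have "\<dots> = ennreal (2 * nl_const * A * D)"
    using nl_const_pos A D by (simp add: mult_ac flip: ennreal_plus)
  finally show ?thesis .
qed

lemma nl_cong_AE:
  assumes fg: "AE x in lborel. f x = g x" and [measurable]: "f \<in> borel_measurable borel" "g \<in>
      borel_measurable borel"
  shows "AE x in lborel. nl f x = nl g x"
proof -
  have "grad_phi f x = grad_phi g x" for x
    unfolding grad_phi_def
    by (intro arg_cong[where f = "\<lambda>v. - (1 / (2 * pi)) *\<^sub>R v"] integral_cong_AE)
        (use fg in \<open>auto elim: eventually_mono\<close>)
  with fg show ?thesis by (auto simp: nl_def elim: eventually_mono)
qed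

lemma div_distr_cong_AE:
  assumes "AE x in lborel. F x = G x" "F \<in> borel_measurable borel" "G \<in> borel_measurable borel"
  shows "div_distr F = div_distr G"
proof
  fix \<psi>
  show "div_distr F \<psi> = div_distr G \<psi>"
  proof (cases "\<psi> \<in> schwartz")
    case True
    note [measurable] = assms(2,3) schwartz_grad_measurable[OF True]
    have "(LINT x|lborel. F x \<bullet> grad \<psi> x) = (LINT x|lborel. G x \<bullet> grad \<psi> x)"
      by (intro integral_cong_AE) (use assms(1) in \<open>auto elim: eventually_mono\<close>)
    then show ?thesis by (simp add: div_distr_def)
  qed (simp add: div_distr_def)
qed

text \<open>Frees the nonlinearity from the version picked by \<open>density_of\<close>: another
  version leaves the field unchanged and alters the product only on a null set.\<close>

lemma debye_nonlin_represents:
  assumes "represents g T"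
  shows "debye_nonlin T = div_distr (nl g)"
  unfolding debye_nonlin_eq
  by (intro div_distr_cong_AE nl_cong_AE nl_measurable represents_unique_AE representsD(1)
      represents_density_of[OF assms] assms)
    (auto intro: representsD(1)[OF represents_density_of[OF assms]] representsD(1)[OF assms] assms
        represents_density_of)

subsection \<open>The Duhamel integral\<close>

definition grad_const :: real where
  "grad_const = (SOME C. grad_bounds C)"

lemma grad_const: "grad_bounds grad_const"
  unfolding grad_const_def by (rule someI_ex[OF grad_bounds_exists])

lemmas grad_const_pos = grad_const[unfolded grad_bounds_def, THEN conjunct1]
  and grad_const_nn = grad_const[unfolded grad_bounds_def, THEN conjunct2, THEN conjunct1, rule_format]
  and grad_const_diff = grad_const[unfolded grad_bounds_def, THEN conjunct2, THEN conjunct2, rule_format]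

lemma grad_const_bound:
  assumes "0 < t" "\<psi> \<in> schwartz"
  shows "norm (grad (heat_test t \<psi>) y) \<le> grad_const * t powr (-3/4) * norm4 \<psi>"
proof -
  have "0 \<le> grad_const * t powr (-3/4) * norm4 \<psi>"
    using grad_const_pos norm4_nonneg by simp
  with order_trans[OF norm_grad_heat_test_le_nn[OF assms] grad_const_nn[OF assms]]
  show ?thesis by (simp add: ennreal_le_iff)
qed

section \<open>The heat flow applied to divergences of integrable fields\<close>

definition L1_bounded :: "(real^2 \<Rightarrow> real^2) \<Rightarrow> real \<Rightarrow> bool" where
  "L1_bounded F N \<longleftrightarrow> F \<in> borel_measurable borel \<and> 0 \<le> N \<and> (\<integral>\<^sup>+x. ennreal (norm (F x)) \<partial>lborel) \<le> ennreal N"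

lemma L1_boundedD:
  assumes "L1_bounded F N"
  shows "integrable lborel F" "(LINT x|lborel. norm (F x)) \<le> N"
proof -
  show i: "integrable lborel F"
    using assms by (intro integrableI_bounded) (auto simp: L1_bounded_def le_less_trans)
  have "ennreal (LINT x|lborel. norm (F x)) \<le> ennreal N"
    using assms nn_integral_eq_integral[OF integrable_norm[OF i]] by (simp add: L1_bounded_def)
  then show "(LINT x|lborel. norm (F x)) \<le> N"
    using assms by (simp add: L1_bounded_def ennreal_le_iff)
qed

lemma L1_pairing:
  assumes F: "L1_bounded F N" and [measurable]: "v \<in> borel_measurable borel" and v: "\<And>x. norm (v x) \<le> C"
  shows "integrable lborel (\<lambda>x. F x \<bullet> v x)" "\<bar>LINT x|lborel. F x \<bullet> v x\<bar> \<le> N * C"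
proof -
  note i = L1_boundedD[OF F]
  have [measurable]: "F \<in> borel_measurable borel" using F by (simp add: L1_bounded_def)
  have C: "0 \<le> C" using v[of 0] norm_ge_zero order_trans by blast
  have le: "norm (F x \<bullet> v x) \<le> norm (F x) * C" for x
    by (rule order_trans[OF Cauchy_Schwarz_ineq2[folded real_norm_def]]) (intro mult_left_mono v, simp)
  show "integrable lborel (\<lambda>x. F x \<bullet> v x)"
    by (rule Bochner_Integration.integrable_bound[of _ "\<lambda>x. norm (F x) * C"])
      (use i le C in \<open>auto intro!: AE_I2\<close>)
  have "norm (LINT x|lborel. F x \<bullet> v x) \<le> (LINT x|lborel. norm (F x) * C)"
    by (rule integral_norm_le) (use i le in auto)
  also have "\<dots> \<le> N * C" using i C by (simp add: mult_right_mono)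
  finally show "\<bar>LINT x|lborel. F x \<bullet> v x\<bar> \<le> N * C" by simp
qed

lemma heat_div_distr:
  "0 < r \<Longrightarrow> \<psi> \<in> schwartz \<Longrightarrow> heat r (div_distr F) \<psi> = - (LINT x|lborel. F x \<bullet> grad (heat_test r \<psi>) x)"
  by (simp add: heat_eq div_distr_def schwartz_heat_test)

lemma heat_div_bound:
  assumes F: "L1_bounded F N" and "0 < r" "\<psi> \<in> schwartz"
  shows "\<bar>heat r (div_distr F) \<psi>\<bar> \<le> N * (grad_const * r powr (-3/4) * norm4 \<psi>)"
  using L1_pairing(2)[OF F _ grad_const_bound[OF assms(2,3)]]
      schwartz_grad_measurable[OF schwartz_heat_test[OF assms(2,3)]]
  by (simp add: heat_div_distr assms)

text \<open>The gradient is left on \<open>\<psi>\<close> and the kernel merely averages it, so the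
  bound has no singularity as r tends to 0. This is the form used for the initial limit.\<close>

lemma heat_div_bound_grad:
  assumes F: "L1_bounded F N" and "0 < r" "\<psi> \<in> schwartz" and C: "\<And>x. norm (grad \<psi> x) \<le> C"
  shows "\<bar>heat r (div_distr F) \<psi>\<bar> \<le> N * C"
  using L1_pairing(2)[OF F _ norm_grad_heat_test_le[OF assms(2,3) C]]
      schwartz_grad_measurable[OF schwartz_heat_test[OF assms(2,3)]]
  by (simp add: heat_div_distr assms)

lemma heat_div_time_diff:
  assumes F: "L1_bounded F N" and "0 < r" "0 < h" "\<psi> \<in> schwartz"
  shows "\<bar>heat (r + h) (div_distr F) \<psi> - heat r (div_distr F) \<psi>\<bar> \<le> N *
      (grad_const * (r powr -1 * h powr (1/4)) * norm4 \<psi>)"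
proof -
  have r: "0 < r + h" using assms by simp
  note m [measurable] = schwartz_grad_measurable[OF schwartz_heat_test[OF r assms(4)]]
      schwartz_grad_measurable[OF schwartz_heat_test[OF assms(2,4)]]
  have "integrable lborel (\<lambda>x. F x \<bullet> grad (heat_test (r + h) \<psi>) x)" "integrable lborel
      (\<lambda>x. F x \<bullet> grad (heat_test r \<psi>) x)"
    by (rule L1_pairing(1)[OF F m(1) grad_const_bound[OF r assms(4)]],
        rule L1_pairing(1)[OF F m(2) grad_const_bound[OF assms(2,4)]])
  then have "heat (r + h) (div_distr F) \<psi> - heat r (div_distr F) \<psi> =
     - (LINT x|lborel. F x \<bullet> (grad (heat_test (r + h) \<psi>) x - grad (heat_test r \<psi>) x))"
    using assms r by (simp add: heat_div_distr inner_diff_right)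
  then show ?thesis
    using L1_pairing(2)[OF F _ grad_const_diff[OF assms(2-4)]] by simp
qed

lemma heat_div_minus:
  assumes F: "L1_bounded F N" and G: "L1_bounded G N'" and "0 < r" "\<psi> \<in> schwartz"
  shows "heat r (div_distr (\<lambda>x. F x - G x)) \<psi> = heat r (div_distr F) \<psi> - heat r (div_distr G) \<psi>"
proof -
  note m = schwartz_grad_measurable[OF schwartz_heat_test[OF assms(3,4)]]
  show ?thesis
    using L1_pairing(1)[OF F m grad_const_bound[OF assms(3,4)]]
        L1_pairing(1)[OF G m grad_const_bound[OF assms(3,4)]] assms
    by (simp add: heat_div_distr inner_diff_left)
qed

text \<open>The weight tau^(-1/2) is the one produced by a product of two factors of size
  tau^(-1/4).\<close>

definition duhamel_admissible :: "(real \<Rightarrow> real^2 \<Rightarrow> real^2) \<Rightarrow> real \<Rightarrow> bool" where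
  "duhamel_admissible F N \<longleftrightarrow> case_prod F \<in> borel_measurable (borel \<Otimes>\<^sub>M borel) \<and> 0 \<le> N \<and>
     (\<forall>\<tau>>0. L1_bounded (F \<tau>) (N * \<tau> powr (-1/2)))"

text \<open>For \<open>r > 0\<close> this is the gradient of the heat kernel; the explicit formula makes sense for all \<open>r\<close>
  and is jointly measurable.\<close>

definition heat_field :: "real \<Rightarrow> real^2 \<Rightarrow> real^2" where
  "heat_field r z = - (heat_kernel r z / (2 * r)) *\<^sub>R z"

text \<open>One integral over space-time, so that a single exchange with the integral in x suffices.
  The minus sign of \<open>div_distr\<close> is absorbed by the oddness of the kernel gradient,
  whose argument here is x - y.\<close>

definition duhamel_density :: "(real \<Rightarrow> real^2 \<Rightarrow> real^2) \<Rightarrow> real \<Rightarrow> real^2 \<Rightarrow> real" where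
  "duhamel_density F t x = (LINT p|(lborel \<Otimes>\<^sub>M lborel). (if 0 < fst p \<and> fst p < t
     then F (fst p) (snd p) \<bullet> heat_field (t - fst p) (x - snd p) else 0))"

text \<open>For jointly measurable F the integrand in time is Borel, so \<open>lborel\<close> is
  used; the Lebesgue integral in \<open>mild_solution\<close> has the same value by
  completion.\<close>

definition duhamel :: "(real \<Rightarrow> real^2 \<Rightarrow> real^2) \<Rightarrow> real \<Rightarrow> distr" where
  "duhamel F t \<psi> = (if \<psi> \<in> schwartz then LINT \<tau>|lborel. indicator {0<..<t} \<tau> * heat (t - \<tau>)
      (div_distr (F \<tau>)) \<psi> else 0)"

lemma heat_field_measurable [measurable (raw)]:
  assumes [measurable]: "f \<in> borel_measurable M" "g \<in> borel_measurable M"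
  shows "(\<lambda>x. heat_field (f x) (g x)) \<in> borel_measurable M"
  unfolding heat_field_def by measurable

lemma sigma_finite_lborel_pair: "sigma_finite_measure
    (lborel \<Otimes>\<^sub>M lborel :: ('a::euclidean_space \<times> 'b::euclidean_space) measure)"
  unfolding lborel_prod by (rule sigma_finite_lborel)

lemma duhamel_density_measurable:
  assumes [measurable]: "case_prod F \<in> borel_measurable (borel \<Otimes>\<^sub>M borel)"
  shows "(\<lambda>(t, x). duhamel_density F t x) \<in> borel_measurable (borel \<Otimes>\<^sub>M borel)"
proof -
  interpret sigma_finite_measure "lborel \<Otimes>\<^sub>M lborel :: (real \<times> (real^2)) measure"
    by (rule sigma_finite_lborel_pair)
  show ?thesis unfolding duhamel_density_def[abs_def] split_beta' by measurable
qed

text \<open>The Beta arguments are 1 - 3/4 and 1 - 1/2, from the singularities of the kernel at tau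
  = t and of the field at tau = 0.\<close>

definition duhamel_const :: real where
  "duhamel_const = grad_const * Beta (1/4) (1/2)"

lemma duhamel_const_pos: "0 < duhamel_const"
  using grad_const_pos by (simp add: duhamel_const_def Beta_def Gamma_real_pos)

lemma nn_integral_duhamel_weight:
  assumes "0 < t"
  shows "(\<integral>\<^sup>+\<tau>. indicator {0<..<t} \<tau> * ennreal ((t - \<tau>) powr (-3/4) * \<tau> powr (-1/2)) \<partial>lborel) = ennreal
      (Beta (1/4) (1/2) * t powr (-1/4))"
  using nn_integral_Beta[of "1/4" "1/2" t] assms by simp

text \<open>The substance is absolute convergence of the integral over (tau, y, x). Fubini then
  reads that integral once as the weak time integral and once as the pairing of
  \<open>\<psi>\<close> with \<open>duhamel_density\<close>.\<close>

lemma duhamel_represents: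
  assumes adm: "duhamel_admissible F N" and t: "0 < t"
  shows "represents (duhamel_density F t) (duhamel F t)"
    and "\<psi> \<in> schwartz \<Longrightarrow> integrable lborel (\<lambda>\<tau>. indicator {0<..<t} \<tau> * heat (t - \<tau>) (div_distr (F \<tau>)) \<psi>)"
    and "\<psi> \<in> schwartz \<Longrightarrow> \<bar>duhamel F t \<psi>\<bar> \<le> duhamel_const * N * t powr (-1/4) * norm4 \<psi>"
proof -
  have m[measurable]: "case_prod F \<in> borel_measurable (borel \<Otimes>\<^sub>M borel)" and N: "0 \<le> N"
    and L1: "\<And>\<tau>. 0 < \<tau> \<Longrightarrow> L1_bounded (F \<tau>) (N * \<tau> powr (-1/2))"
    using adm by (auto simp: duhamel_admissible_def)
  let ?M = "lborel \<Otimes>\<^sub>M lborel :: (real \<times> (real^2)) measure"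
  interpret M: sigma_finite_measure ?M by (rule sigma_finite_lborel_pair)
  interpret P: pair_sigma_finite ?M "lborel :: (real^2) measure" ..
  have *: "integrable lborel (\<lambda>x. duhamel_density F t x * \<psi> x)
    \<and> integrable lborel (\<lambda>\<tau>. indicator {0<..<t} \<tau> * heat (t - \<tau>) (div_distr (F \<tau>)) \<psi>)
    \<and> duhamel F t \<psi> = (LINT x|lborel. duhamel_density F t x * \<psi> x)
    \<and> \<bar>duhamel F t \<psi>\<bar> \<le> duhamel_const * N * t powr (-1/4) * norm4 \<psi>" if \<psi>: "\<psi> \<in> schwartz" for \<psi>
  proof -
    note [measurable] = schwartz_measurable[OF \<psi>]
    define \<Phi> where "\<Phi> p x = (if 0 < fst p \<and> fst p < t then F (fst p) (snd p) \<bullet> heat_field (t - fst p)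
        (x - snd p) else 0) * \<psi> x" for p x
    have \<Phi>m[measurable]: "case_prod \<Phi> \<in> borel_measurable (?M \<Otimes>\<^sub>M lborel)"
      unfolding \<Phi>_def split_beta' by measurable
    have hf: "heat_field r (x - y) = - grad (heat_kernel r) (y - x)" if "0 < r" for r x y
      using that by (simp add: heat_field_def grad_heat_kernel heat_kernel_commute[of r x y]
          scaleR_diff_right)
    \<comment> \<open>The variable x is integrated first because the resulting bound is uniform in
      y. The L^1 norm of the field takes care of y, and the Beta integral of tau.\<close>
    have inner: "(\<integral>\<^sup>+x. ennreal (norm (\<Phi> (\<tau>, y) x)) \<partial>lborel) \<le>
        indicator {0<..<t} \<tau> * ennreal (grad_const * (t - \<tau>) powr (-3/4) * norm4 \<psi>) * ennreal
            (norm (F \<tau> y))" for \<tau> y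
    proof (cases "0 < \<tau> \<and> \<tau> < t")
      case True
      have [measurable]: "grad (heat_kernel (t - \<tau>)) \<in> borel_measurable borel"
        using True by (intro schwartz_grad_measurable schwartz_heat_kernel) auto
      have "(\<integral>\<^sup>+x. ennreal (norm (\<Phi> (\<tau>, y) x)) \<partial>lborel) \<le>
         (\<integral>\<^sup>+x. ennreal (norm (F \<tau> y)) * ennreal \<bar>norm (grad (heat_kernel (t - \<tau>)) (y - x)) * \<psi> x\<bar> \<partial>lborel)"
      proof (rule nn_integral_mono)
        fix x
        have "\<bar>F \<tau> y \<bullet> grad (heat_kernel (t - \<tau>)) (y - x)\<bar> * \<bar>\<psi> x\<bar> \<le>
            (norm (F \<tau> y) * norm (grad (heat_kernel (t - \<tau>)) (y - x))) * \<bar>\<psi> x\<bar>"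
          by (intro mult_right_mono Cauchy_Schwarz_ineq2) auto
        then show "ennreal (norm (\<Phi> (\<tau>, y) x)) \<le> ennreal (norm (F \<tau> y)) * ennreal \<bar>norm
            (grad (heat_kernel (t - \<tau>)) (y - x)) * \<psi> x\<bar>"
          using True by (simp add: \<Phi>_def hf abs_mult mult.assoc ennreal_leI flip: ennreal_mult)
      qed
      also have "\<dots> = ennreal (norm (F \<tau> y)) * (\<integral>\<^sup>+x. ennreal \<bar>norm (grad (heat_kernel (t - \<tau>)) (y - x)) * \<psi>
          x\<bar> \<partial>lborel)"
        by (rule nn_integral_cmult) measurable
      also have "\<dots> \<le> ennreal (norm (F \<tau> y)) * ennreal (grad_const * (t - \<tau>) powr (-3/4) * norm4 \<psi>)"
        using True by (intro mult_left_mono grad_const_nn \<psi>) auto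
      finally show ?thesis using True by (simp add: mult.commute)
    qed (auto simp: \<Phi>_def)
    have total: "(\<integral>\<^sup>+p. \<integral>\<^sup>+x. ennreal (norm (\<Phi> p x)) \<partial>lborel \<partial>?M) \<le> ennreal
        (duhamel_const * N * t powr (-1/4) * norm4 \<psi>)"
    proof -
      have "(\<integral>\<^sup>+p. \<integral>\<^sup>+x. ennreal (norm (\<Phi> p x)) \<partial>lborel \<partial>?M) =
          (\<integral>\<^sup>+\<tau>. \<integral>\<^sup>+y. \<integral>\<^sup>+x. ennreal (norm (\<Phi> (\<tau>, y) x)) \<partial>lborel \<partial>lborel \<partial>lborel)"
        by (rule lborel.nn_integral_fst[symmetric]) measurable
      also have "\<dots> \<le> (\<integral>\<^sup>+\<tau>. \<integral>\<^sup>+y. indicator {0<..<t} \<tau> * ennreal (grad_const * (t - \<tau>) powr (-3/4) * norm4 \<psi>)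
          * ennreal (norm (F \<tau> y)) \<partial>lborel \<partial>lborel)"
        by (intro nn_integral_mono inner)
      also have "\<dots> \<le> (\<integral>\<^sup>+\<tau>. ennreal (grad_const * norm4 \<psi> * N) *
          (indicator {0<..<t} \<tau> * ennreal ((t - \<tau>) powr (-3/4) * \<tau> powr (-1/2))) \<partial>lborel)"
      proof (rule nn_integral_mono)
        fix \<tau>
        show "(\<integral>\<^sup>+y. indicator {0<..<t} \<tau> * ennreal (grad_const * (t - \<tau>) powr (-3/4) * norm4 \<psi>) * ennreal
            (norm (F \<tau> y)) \<partial>lborel) \<le>
          ennreal (grad_const * norm4 \<psi> * N) * (indicator {0<..<t} \<tau> * ennreal
              ((t - \<tau>) powr (-3/4) * \<tau> powr (-1/2)))"
        proof (cases "0 < \<tau> \<and> \<tau> < t")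
          case True
          have [measurable]: "F \<tau> \<in> borel_measurable borel" using L1[of \<tau>] True
              by (simp add: L1_bounded_def)
          have "(\<integral>\<^sup>+y. indicator {0<..<t} \<tau> * ennreal (grad_const * (t - \<tau>) powr (-3/4) * norm4 \<psi>) * ennreal
              (norm (F \<tau> y)) \<partial>lborel) =
            ennreal (grad_const * (t - \<tau>) powr (-3/4) * norm4 \<psi>) * (\<integral>\<^sup>+y. ennreal (norm (F \<tau> y)) \<partial>lborel)"
            using True by (simp add: nn_integral_cmult)
          also have "\<dots> \<le> ennreal (grad_const * (t - \<tau>) powr (-3/4) * norm4 \<psi>) * ennreal (N * \<tau> powr (-1/2))"
            using L1[of \<tau>] True by (intro mult_left_mono) (auto simp: L1_bounded_def)
          also have "\<dots> = ennreal ((grad_const * (t - \<tau>) powr (-3/4) * norm4 \<psi>) * (N * \<tau> powr (-1/2)))"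
            using grad_const_pos norm4_nonneg N by (intro ennreal_mult[symmetric]) auto
          also have "(grad_const * (t - \<tau>) powr (-3/4) * norm4 \<psi>) * (N * \<tau> powr (-1/2)) =
              (grad_const * norm4 \<psi> * N) * ((t - \<tau>) powr (-3/4) * \<tau> powr (-1/2))"
            by simp
          also have "ennreal \<dots> = ennreal (grad_const * norm4 \<psi> * N) * ennreal
              ((t - \<tau>) powr (-3/4) * \<tau> powr (-1/2))"
            using grad_const_pos norm4_nonneg N by (intro ennreal_mult) auto
          finally show ?thesis using True by simp
        qed auto
      qed
      also have "\<dots> = ennreal (grad_const * norm4 \<psi> * N) * ennreal (Beta (1/4) (1/2) * t powr (-1/4))"
        unfolding nn_integral_duhamel_weight[OF t, symmetric] by (rule nn_integral_cmult) measurable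
      also have "\<dots> = ennreal ((grad_const * norm4 \<psi> * N) * (Beta (1/4) (1/2) * t powr (-1/4)))"
        using grad_const_pos norm4_nonneg N
            by (intro ennreal_mult[symmetric]) (auto simp: Beta_def Gamma_real_pos less_imp_le)
      also have "(grad_const * norm4 \<psi> * N) * (Beta (1/4) (1/2) * t powr (-1/4)) = duhamel_const * N * t
          powr (-1/4) * norm4 \<psi>"
        by (simp add: duhamel_const_def)
      finally show ?thesis .
    qed
    have int: "integrable (?M \<Otimes>\<^sub>M lborel) (case_prod \<Phi>)"
      by (rule integrable_pair_measureI[OF sigma_finite_lborel \<Phi>m])
          (use total in \<open>auto simp: le_less_trans\<close>)
    have 1: "integrable lborel (\<lambda>x. duhamel_density F t x * \<psi> x)"
      using P.integrable_snd[OF int] by (simp add: \<Phi>_def duhamel_density_def)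
    have \<Phi>i: "(LINT x|lborel. \<Phi> (\<tau>, y) x) = indicator {0<..<t} \<tau> * -
        (F \<tau> y \<bullet> grad (heat_test (t - \<tau>) \<psi>) y)" for \<tau> y
    proof (cases "0 < \<tau> \<and> \<tau> < t")
      case True
      obtain B where B: "\<And>x. norm (grad (heat_kernel (t - \<tau>)) x) \<le> B"
        using schwartz_grad_bound[OF schwartz_heat_kernel[of "t - \<tau>"], of 0] True by auto
      have [measurable]: "grad (heat_kernel (t - \<tau>)) \<in> borel_measurable borel"
        using True by (intro schwartz_grad_measurable schwartz_heat_kernel) auto
      have i: "integrable lborel (\<lambda>x. \<psi> x *\<^sub>R grad (heat_kernel (t - \<tau>)) (y - x))"
        by (rule integrable_mult_bounded[OF schwartz_integrable[OF \<psi>], of _ B]) (use B in auto)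
      have "(LINT x|lborel. \<Phi> (\<tau>, y) x) = (LINT x|lborel. - F \<tau> y \<bullet>
          (\<psi> x *\<^sub>R grad (heat_kernel (t - \<tau>)) (y - x)))"
        using True by (intro Bochner_Integration.integral_cong) (auto simp: \<Phi>_def hf)
      also have "\<dots> = - F \<tau> y \<bullet> (LINT x|lborel. \<psi> x *\<^sub>R grad (heat_kernel (t - \<tau>)) (y - x))"
        by (rule integral_inner_right) (rule i)
      finally show ?thesis using True \<psi> by (simp add: grad_heat_test)
    qed (auto simp: \<Phi>_def)
    have i2: "integrable (lborel \<Otimes>\<^sub>M lborel) (\<lambda>p. LINT x|lborel. \<Phi> p x)"
      using P.integrable_fst[OF int] .
    have e: "(LINT y|lborel. LINT x|lborel. \<Phi> (\<tau>, y) x) = indicator {0<..<t} \<tau> * heat (t - \<tau>)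
        (div_distr (F \<tau>)) \<psi>" for \<tau>
      unfolding \<Phi>i using \<psi> by (cases "0 < \<tau> \<and> \<tau> < t") (auto simp: heat_div_distr)
    have 2: "integrable lborel (\<lambda>\<tau>. indicator {0<..<t} \<tau> * heat (t - \<tau>) (div_distr (F \<tau>)) \<psi>)"
      using lborel_pair.integrable_fst'[OF i2] by (simp add: e)
    have "duhamel F t \<psi> = (LINT \<tau>|lborel. LINT y|lborel. LINT x|lborel. \<Phi> (\<tau>, y) x)"
      using \<psi> by (simp add: duhamel_def e)
    also have "\<dots> = (LINT p|(lborel \<Otimes>\<^sub>M lborel). LINT x|lborel. \<Phi> p x)"
      by (rule lborel_pair.integral_fst'[OF i2])
    finally have d1: "duhamel F t \<psi> = (LINT p|?M. LINT x|lborel. \<Phi> p x)" .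
    also have "\<dots> = (LINT x|lborel. LINT p|?M. \<Phi> p x)"
      by (rule P.Fubini_integral[OF int, symmetric])
    also have "\<dots> = (LINT x|lborel. duhamel_density F t x * \<psi> x)"
      by (simp add: \<Phi>_def duhamel_density_def)
    finally have 3: "duhamel F t \<psi> = (LINT x|lborel. duhamel_density F t x * \<psi> x)" .
    have "norm (LINT p|?M. LINT x|lborel. \<Phi> p x) \<le> duhamel_const * N * t powr (-1/4) * norm4 \<psi>"
    proof (rule abs_integral_le_ennreal)
      show "(\<integral>\<^sup>+p. ennreal (norm (LINT x|lborel. \<Phi> p x)) \<partial>?M) \<le> ennreal
          (duhamel_const * N * t powr (-1/4) * norm4 \<psi>)"
        by (rule order_trans[OF nn_integral_mono[OF ennreal_norm_integral_le] total])
      show "0 \<le> duhamel_const * N * t powr (-1/4) * norm4 \<psi>"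
        using duhamel_const_pos N norm4_nonneg by simp
    qed
    then have 4: "\<bar>duhamel F t \<psi>\<bar> \<le> duhamel_const * N * t powr (-1/4) * norm4 \<psi>"
      by (simp add: d1)
    from 1 2 3 4 show ?thesis by blast
  qed
  have dm: "duhamel_density F t \<in> borel_measurable borel"
    unfolding duhamel_density_def[abs_def] by measurable
  show "represents (duhamel_density F t) (duhamel F t)"
    unfolding represents_def using * dm by blast
  show "\<psi> \<in> schwartz \<Longrightarrow> integrable lborel (\<lambda>\<tau>. indicator {0<..<t} \<tau> * heat (t - \<tau>) (div_distr (F \<tau>)) \<psi>)"
    "\<psi> \<in> schwartz \<Longrightarrow> \<bar>duhamel F t \<psi>\<bar> \<le> duhamel_const * N * t powr (-1/4) * norm4 \<psi>"
    using * by blast+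
qed

subsection \<open>Picard iteration\<close>

text \<open>Fatou's lemma; it lets the bounds on Picard iterates and on their differences pass to
  the pointwise limit.\<close>

lemma L43_limit:
  assumes f: "\<And>k. L43 (f k) B" and lim: "AE x in lborel. (\<lambda>k. f k x) \<longlonglongrightarrow> g x" and [measurable]: "g \<in>
      borel_measurable borel"
  shows "L43 g B"
proof -
  note [measurable] = L43_measurable[OF f]
  have B: "0 \<le> B" using f[of 0] by (rule L43_nonneg)
  have "(\<integral>\<^sup>+x. ennreal (\<bar>g x\<bar> powr (4/3)) \<partial>lborel) =
      (\<integral>\<^sup>+x. liminf (\<lambda>k. ennreal (\<bar>f k x\<bar> powr (4/3))) \<partial>lborel)"
  proof (rule nn_integral_cong_AE)
    show "AE x in lborel. ennreal (\<bar>g x\<bar> powr (4/3)) = liminf (\<lambda>k. ennreal (\<bar>f k x\<bar> powr (4/3)))"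
      using lim
    proof eventually_elim
      case (elim x)
      have "(\<lambda>k. ennreal (\<bar>f k x\<bar> powr (4/3))) \<longlonglongrightarrow> ennreal (\<bar>g x\<bar> powr (4/3))"
        by (intro tendsto_ennrealI tendsto_powr' tendsto_rabs elim tendsto_const) auto
      then show ?case by (rule lim_imp_Liminf[OF sequentially_bot, symmetric])
    qed
  qed
  also have "\<dots> \<le> liminf (\<lambda>k. \<integral>\<^sup>+x. ennreal (\<bar>f k x\<bar> powr (4/3)) \<partial>lborel)"
    by (intro nn_integral_liminf) measurable
  also have "\<dots> \<le> ennreal (B powr (4/3))"
    using f by (intro Liminf_le) (auto intro: always_eventually simp: L43_def)
  finally show ?thesis using B by (simp add: L43_def)
qed

lemma powr_quarter_sq: "0 < (t::real) \<Longrightarrow> t powr (-1/4) * t powr (-1/4) = t powr (-1/2)"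
  by (simp flip: powr_add)

lemma L1_bounded_nl:
  assumes "L43 f (A * t powr (-1/4))" "0 < A" "0 < t"
  shows "L1_bounded (nl f) (nl_const * A * A * t powr (-1/2))"
proof -
  have "(\<integral>\<^sup>+x. ennreal (norm (nl f x)) \<partial>lborel) \<le> ennreal
      (nl_const * (A * t powr (-1/4)) * (A * t powr (-1/4)))"
    using assms by (intro nl_bound) auto
  also have "nl_const * (A * t powr (-1/4)) * (A * t powr (-1/4)) = nl_const * A * A *
      (t powr (-1/4) * t powr (-1/4))"
    by simp
  finally show ?thesis
    using assms nl_const_pos nl_measurable[OF L43_measurable[OF assms(1)]]
    unfolding powr_quarter_sq[OF assms(3)] by (simp add: L1_bounded_def)
qed

lemma L1_bounded_nl_diff:
  assumes "L43 f (A * t powr (-1/4))" "L43 g (A * t powr (-1/4))" "L43 (\<lambda>x. f x - g x) (D * t powr (-1/4))"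
    "0 < A" "0 < D" "0 < t"
  shows "L1_bounded (\<lambda>x. nl f x - nl g x) (2 * nl_const * A * D * t powr (-1/2))"
proof -
  have "(\<integral>\<^sup>+x. ennreal (norm (nl f x - nl g x)) \<partial>lborel) \<le> ennreal
      (2 * nl_const * (A * t powr (-1/4)) * (D * t powr (-1/4)))"
    using assms by (intro nl_diff_bound) auto
  also have "2 * nl_const * (A * t powr (-1/4)) * (D * t powr (-1/4)) = 2 * nl_const * A * D *
      (t powr (-1/4) * t powr (-1/4))"
    by simp
  finally show ?thesis
    using assms nl_const_pos nl_measurable[OF L43_measurable[OF assms(1)]]
        nl_measurable[OF L43_measurable[OF assms(2)]]
    unfolding powr_quarter_sq[OF assms(6)] by (simp add: L1_bounded_def)
qed

lemma duhamel_admissible_nl: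
  assumes "case_prod u \<in> borel_measurable (borel \<Otimes>\<^sub>M borel)" "0 < A"
    "\<And>t. 0 < t \<Longrightarrow> L43 (u t) (A * t powr (-1/4))"
  shows "duhamel_admissible (\<lambda>\<tau>. nl (u \<tau>)) (nl_const * A * A)"
  using assms nl_const_pos nl_measurable_pair[OF assms(1)] L1_bounded_nl[OF assms(3,2)]
  by (simp add: duhamel_admissible_def)

lemma duhamel_diff_bound:
  assumes F: "duhamel_admissible F N" and G: "duhamel_admissible G N'"
    and d: "\<And>\<tau>. 0 < \<tau> \<Longrightarrow> L1_bounded (\<lambda>x. F \<tau> x - G \<tau> x) (K * \<tau> powr (-1/2))" and K: "0 \<le> K"
    and t: "0 < t" and \<psi>: "\<psi> \<in> schwartz"
  shows "\<bar>duhamel F t \<psi> - duhamel G t \<psi>\<bar> \<le> duhamel_const * K * t powr (-1/4) * norm4 \<psi>"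
proof -
  have [measurable]: "case_prod F \<in> borel_measurable (borel \<Otimes>\<^sub>M borel)" "case_prod G \<in> borel_measurable
      (borel \<Otimes>\<^sub>M borel)"
    using F G by (auto simp: duhamel_admissible_def)
  have adm: "duhamel_admissible (\<lambda>\<tau> x. F \<tau> x - G \<tau> x) K"
    using d K by (simp add: duhamel_admissible_def)
  have "duhamel F t \<psi> - duhamel G t \<psi> = duhamel (\<lambda>\<tau> x. F \<tau> x - G \<tau> x) t \<psi>"
  proof -
    have "indicator {0<..<t} \<tau> * heat (t - \<tau>) (div_distr (F \<tau>)) \<psi> - indicator {0<..<t} \<tau> * heat (t - \<tau>)
        (div_distr (G \<tau>)) \<psi> =
      indicator {0<..<t} \<tau> * heat (t - \<tau>) (div_distr (\<lambda>x. F \<tau> x - G \<tau> x)) \<psi>" for \<tau>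
    proof (cases "0 < \<tau> \<and> \<tau> < t")
      case True
      then have "L1_bounded (F \<tau>) (N * \<tau> powr (-1/2))" "L1_bounded (G \<tau>) (N' * \<tau> powr (-1/2))"
        using F G by (auto simp: duhamel_admissible_def)
      from heat_div_minus[OF this _ \<psi>, of "t - \<tau>"] True show ?thesis by simp
    qed auto
    then show ?thesis
      using duhamel_represents(2)[OF F t \<psi>] duhamel_represents(2)[OF G t \<psi>] \<psi>
      by (simp add: duhamel_def flip: Bochner_Integration.integral_diff)
  qed
  then show ?thesis using duhamel_represents(3)[OF adm t \<psi>] by simp
qed

text \<open>The hypothesis yields a density of the orbit at each time separately, by choice and
  hence with no measurability in time. Densities are therefore chosen only at the countably many
  times 1/(n+1) and propagated by explicit convolution.\<close>

lemma heat_orbit_density: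
  assumes M: "0 \<le> M" "BX_norm u0 \<le> ennreal M"
  obtains a where "case_prod a \<in> borel_measurable (borel \<Otimes>\<^sub>M borel)"
    "\<And>t. 0 < t \<Longrightarrow> represents (a t) (heat t u0)" "\<And>t. 0 < t \<Longrightarrow> L43 (a t) (M * t powr (-1/4))"
proof -
  have "\<exists>g. represents g (heat t u0) \<and> L43 g (M * t powr (-1/4))" if "0 < t" for t
    using M that by (simp add: BX_norm_le_iff Lp_norm_le_iff)
  then have "\<forall>n. \<exists>g. represents g (heat (1 / real (Suc n)) u0) \<and> L43 g (M * (1 / real (Suc n)) powr (-1/4))"
    by simp
  then obtain g where g: "\<And>n. represents (g n) (heat (1 / real (Suc n)) u0)" "\<And>n. L43 (g n)
      (M * (1 / real (Suc n)) powr (-1/4))"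
    by metis
  \<comment> \<open>The grid time 1/(N t + 1) is strictly below t thanks to the added 1, so a
    positive time is left for the heat kernel. As N takes countably many values, measurability of
    each chosen density is enough.\<close>
  define N where "N t = nat \<lceil>1 / t\<rceil>" for t :: real
  have [measurable]: "N \<in> measurable borel (count_space UNIV)"
    unfolding N_def[abs_def] by measurable
  have [measurable]: "g n \<in> borel_measurable borel" for n using g(2) by (rule L43_measurable)
  have Nt: "1 / real (Suc (N t)) < t" if "0 < t" for t
  proof -
    have "1 / t \<le> real (N t)" using that by (simp add: N_def real_nat_ceiling_ge)
    then have "1 / t < real (Suc (N t))" by simp
    then show ?thesis using that by (simp add: field_simps)
  qed
  define a where "a t x = (LINT y|lborel. g (N t) y * heat_kernel (t - 1 / real (Suc (N t))) (x - y))" for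
      t x
  show thesis
  proof
    have [measurable]: "(\<lambda>p. g (N (fst (fst p))) (snd p)) \<in> borel_measurable
        (((borel :: real measure) \<Otimes>\<^sub>M (borel :: (real^2) measure)) \<Otimes>\<^sub>M lborel)"
      by (rule measurable_compose_countable[where f = "\<lambda>n p. g n (snd p)" and g = "\<lambda>p. N (fst (fst p))"])
          measurable
    show "case_prod a \<in> borel_measurable (borel \<Otimes>\<^sub>M borel)"
      unfolding a_def split_beta' by measurable
    show rep: "represents (a t) (heat t u0)" if t: "0 < t" for t
    proof -
      let ?s = "1 / real (Suc (N t))"
      have "heat ?s u0 = distr_of (g (N t))"
        by (rule represents_distr_of[OF g(1)]) (simp add: heat_def)
      moreover have "heat (t - ?s) (heat ?s u0) = heat t u0"
        using Nt[OF t] by (subst heat_heat) auto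
      moreover have "represents (\<lambda>x. LINT y|lborel. g (N t) y * heat_kernel (t - ?s) (x - y))
          (heat (t - ?s) (distr_of (g (N t))))"
        using Nt[OF t] by (intro represents_heat[OF g(2)]) auto
      ultimately show ?thesis by (simp add: a_def[abs_def])
    qed
    show "L43 (a t) (M * t powr (-1/4))" if t: "0 < t" for t
    proof -
      have "Lp_norm (4/3) (heat t u0) \<le> ennreal (M * t powr (-1/4))"
        using M t by (simp add: BX_norm_le_iff)
      then show ?thesis using Lp_norm_le_represents[OF rep[OF t]] M by simp
    qed
  qed
qed

primrec picard :: "(real \<Rightarrow> real^2 \<Rightarrow> real) \<Rightarrow> nat \<Rightarrow> real \<Rightarrow> real^2 \<Rightarrow> real" where
  "picard a 0 = a"
| "picard a (Suc n) = (\<lambda>t x. a t x + duhamel_density (\<lambda>\<tau>. nl (picard a n \<tau>)) t x)"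

text \<open>The constant kappa of the bilinear Duhamel term in the weighted norm: a function of size
  A produces a term of size kappa A^2.\<close>

definition contraction_const :: real where
  "contraction_const = nl_const * duhamel_const"

lemma contraction_const_pos: "0 < contraction_const"
  using nl_const_pos duhamel_const_pos by (simp add: contraction_const_def)

lemma picard_measurable:
  assumes a[measurable]: "case_prod a \<in> borel_measurable (borel \<Otimes>\<^sub>M borel)"
  shows "case_prod (picard a n) \<in> borel_measurable (borel \<Otimes>\<^sub>M borel)"
proof (induction n)
  case (Suc n)
  note [measurable] = duhamel_density_measurable[OF nl_measurable_pair[OF Suc]]
  show ?case by simp
qed (simp add: a)

text \<open>The second condition on A keeps the iterates in the ball, the third makes each step
  halve differences, since 2 kappa A \<le> 1/2. The limit is taken pointwise almost everywhere and
  the equation is checked on pairings, which pass to the limit by the uniform bounds.\<close>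

lemma picard_solution:
  assumes am: "case_prod a \<in> borel_measurable (borel \<Otimes>\<^sub>M borel)"
    and arep: "\<And>t. 0 < t \<Longrightarrow> represents (a t) (heat t u0)" and aM: "\<And>t. 0 < t \<Longrightarrow> L43 (a t) (M * t powr (-1/4))"
    and A: "0 < A" "M + contraction_const * A * A \<le> A" "4 * contraction_const * A \<le> 1"
  obtains u where "case_prod u \<in> borel_measurable (borel \<Otimes>\<^sub>M borel)"
    "\<And>t. 0 < t \<Longrightarrow> L43 (u t) (A * t powr (-1/4))"
    "\<And>t \<psi>. 0 < t \<Longrightarrow> \<psi> \<in> schwartz \<Longrightarrow> distr_of (u t) \<psi> = heat t u0 \<psi> + duhamel (\<lambda>\<tau>. nl (u \<tau>)) t \<psi>"
proof -
  let ?\<kappa> = contraction_const and ?p = "picard a"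
  let ?D = "\<lambda>v. duhamel (\<lambda>\<tau>. nl (v \<tau>))" and ?d = "\<lambda>v. duhamel_density (\<lambda>\<tau>. nl (v \<tau>))"
  have pm: "case_prod (?p n) \<in> borel_measurable (borel \<Otimes>\<^sub>M borel)" for n by (rule picard_measurable[OF am])
  have pmt: "?p n t \<in> borel_measurable borel" for n t
    using measurable_compose[OF measurable_Pair1' pm, of t n] by simp
  have w: "0 < t powr (-1/4)" if "0 < t" for t :: real using that by simp
  have dens_L43: "L43 (?d v t) (?\<kappa> * A * A * t powr (-1/4))"
    if v: "case_prod v \<in> borel_measurable (borel \<Otimes>\<^sub>M borel)" "\<And>t. 0 < t \<Longrightarrow> L43 (v t) (A * t powr (-1/4))" and
        t: "0 < t" for v t
  proof -
    note adm = duhamel_admissible_nl[OF v(1) A(1) v(2)]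
    show ?thesis
    proof (rule represents_L43[OF duhamel_represents(1)[OF adm t]])
      show "0 \<le> ?\<kappa> * A * A * t powr (-1/4)" using A contraction_const_pos by simp
      show "\<bar>?D v t \<psi>\<bar> \<le> ?\<kappa> * A * A * t powr (-1/4) * norm4 \<psi>" if "\<psi> \<in> schwartz" for \<psi>
        using duhamel_represents(3)[OF adm t that] by (simp add: contraction_const_def mult_ac)
    qed
  qed
  have pA: "L43 (?p n t) (A * t powr (-1/4))" if "0 < t" for n t
    using that
  proof (induction n arbitrary: t)
    case 0
    have "0 < ?\<kappa> * A * A" using A contraction_const_pos by simp
    then have "M \<le> A" using A(2) by linarith
    then show ?case using 0 by (auto intro!: L43_mono[OF aM] mult_right_mono)
  next
    case (Suc n)
    have "L43 (?p (Suc n) t) (M * t powr (-1/4) + ?\<kappa> * A * A * t powr (-1/4))"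
      unfolding picard.simps by (intro L43_add aM dens_L43 pm Suc)
    moreover have "M * t powr (-1/4) + ?\<kappa> * A * A * t powr (-1/4) \<le> A * t powr (-1/4)"
      using A(2) by (simp add: mult_right_mono flip: distrib_right)
    ultimately show ?case by (rule L43_mono)
  qed
  have adm: "duhamel_admissible (\<lambda>\<tau>. nl (?p n \<tau>)) (nl_const * A * A)" for n
    by (rule duhamel_admissible_nl[OF pm A(1) pA])
  have contr: "\<bar>?D v t \<psi> - ?D v' t \<psi>\<bar> \<le> (K / 2) * t powr (-1/4) * norm4 \<psi>"
    if v: "case_prod v \<in> borel_measurable (borel \<Otimes>\<^sub>M borel)" "\<And>t. 0 < t \<Longrightarrow> L43 (v t) (A * t powr (-1/4))"
      and v': "case_prod v' \<in> borel_measurable (borel \<Otimes>\<^sub>M borel)" "\<And>t. 0 < t \<Longrightarrow> L43 (v' t)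
          (A * t powr (-1/4))"
      and d: "\<And>t. 0 < t \<Longrightarrow> L43 (\<lambda>x. v t x - v' t x) (K * t powr (-1/4))" and K: "0 < K"
      and t: "0 < t" and \<psi>: "\<psi> \<in> schwartz" for v v' K t \<psi>
  proof -
    have "\<bar>?D v t \<psi> - ?D v' t \<psi>\<bar> \<le> duhamel_const * (2 * nl_const * A * K) * t powr (-1/4) * norm4 \<psi>"
      using nl_const_pos A K
      by (intro duhamel_diff_bound[OF duhamel_admissible_nl[OF v(1) A(1) v(2)]
          duhamel_admissible_nl[OF v'(1) A(1) v'(2)]]
          L1_bounded_nl_diff v v' d t \<psi>) auto
    also have "\<dots> \<le> (K / 2) * t powr (-1/4) * norm4 \<psi>"
    proof (intro mult_right_mono norm4_nonneg)
      have "duhamel_const * (2 * nl_const * A * K) = (4 * ?\<kappa> * A) * (K / 2)"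
          by (simp add: contraction_const_def)
      also have "\<dots> \<le> 1 * (K / 2)" using A K by (intro mult_right_mono) auto
      finally show "duhamel_const * (2 * nl_const * A * K) \<le> K / 2" by simp
    qed auto
    finally show ?thesis .
  qed
  have pdiff: "L43 (\<lambda>x. ?p (Suc n) t x - ?p n t x) ((1/2) ^ n * A * t powr (-1/4))" if "0 < t" for n t
    using that
  proof (induction n arbitrary: t)
    case 0
    have "0 < ?\<kappa> * A" using A contraction_const_pos by simp
    then have "?\<kappa> * A \<le> 1" using A(3) unfolding mult.assoc by linarith
    then have "?\<kappa> * A * A \<le> 1 * A" using A by (intro mult_right_mono) auto
    then have "L43 (?d a t) (A * t powr (-1/4))"
      using pA[of _ 0] 0 by (intro L43_mono[OF dens_L43[OF am]] mult_right_mono) auto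
    then show ?case by simp
  next
    case (Suc n)
    have e: "(\<lambda>x. ?p (Suc (Suc n)) t x - ?p (Suc n) t x) = (\<lambda>x. ?d (?p (Suc n)) t x - ?d (?p n) t x)"
      by (auto simp del: picard.simps simp: picard.simps(2)[of a "Suc n"] picard.simps(2)[of a n])
    show ?case
      unfolding e
    proof (rule represents_L43[OF represents_minus[OF duhamel_represents(1)[OF adm Suc.prems]
        duhamel_represents(1)[OF adm Suc.prems]]])
      show "0 \<le> (1/2) ^ Suc n * A * t powr (-1/4)" using A by simp
      fix \<psi> assume "\<psi> \<in> schwartz"
      from contr[OF pm pA pm pA Suc.IH _ Suc.prems this] A
      show "\<bar>?D (?p (Suc n)) t \<psi> - ?D (?p n) t \<psi>\<bar> \<le> (1/2) ^ Suc n * A * t powr (-1/4) * norm4 \<psi>" by simp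
    qed
  qed
  \<comment> \<open>The factor 2 - 2 (1/2)^k is the geometric sum of the first k powers of 1/2; it
    stays below 2, so the bound can be passed to the limit in k.\<close>
  have pdiff_k: "L43 (\<lambda>x. ?p (n + k) t x - ?p n t x) ((1/2) ^ n * (2 - 2 * (1/2) ^ k) * A * t powr (-1/4))"
      if t: "0 < t" for n k t
  proof (induction k)
    case 0
    then show ?case by (simp add: L43_def)
  next
    case (Suc k)
    have "L43 (\<lambda>x. (?p (Suc (n + k)) t x - ?p (n + k) t x) + (?p (n + k) t x - ?p n t x))
      ((1/2) ^ (n + k) * A * t powr (-1/4) + (1/2) ^ n * (2 - 2 * (1/2) ^ k) * A * t powr (-1/4))"
      by (intro L43_add pdiff Suc t)
    moreover have "(1/2) ^ (n + k) * A * t powr (-1/4) + (1/2) ^ n * (2 - 2 * (1/2) ^ k) * A * t powr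
        (-1/4) =
      (1/2) ^ n * (2 - 2 * (1/2) ^ Suc k) * A * t powr (-1/4)"
      by (simp add: power_add algebra_simps)
    moreover have "(\<lambda>x. (?p (Suc (n + k)) t x - ?p (n + k) t x) + (?p (n + k) t x - ?p n t x)) =
        (\<lambda>x. ?p (n + Suc k) t x - ?p n t x)"
      by (auto simp del: picard.simps)
    ultimately show ?case by (simp only:)
  qed
  \<comment> \<open>At points of divergence \<open>lim\<close> returns some value; the function is
    nevertheless jointly measurable, and for each t > 0 such points form a null set.\<close>
  define u where "u t x = lim (\<lambda>n. ?p n t x)" for t x
  have um: "case_prod u \<in> borel_measurable (borel \<Otimes>\<^sub>M borel)"
  proof -
    have [measurable]: "(\<lambda>q. ?p n (fst q) (snd q)) \<in> borel_measurable (borel \<Otimes>\<^sub>M borel)" for n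
      using pm[of n] by (simp add: split_beta')
    show ?thesis unfolding u_def split_beta' by measurable
  qed
  have umt: "u t \<in> borel_measurable borel" for t
    using measurable_compose[OF measurable_Pair1' um, of t] by simp
  \<comment> \<open>Multiplication by the positive Gaussian turns the geometric L^(4/3) bounds into
    a convergent series of integrals. The weighted series of increments is then absolutely
    convergent at almost every x, and the weight can be divided out.\<close>
  have conv: "AE x in lborel. (\<lambda>n. ?p n t x) \<longlonglongrightarrow> u t x" if t: "0 < t" for t
  proof -
    let ?G = "heat_kernel 1"
    note [measurable] = pmt
    have G: "?G \<in> schwartz" by (rule schwartz_heat_kernel) simp
    define c where "c = A * t powr (-1/4) * norm4 ?G"
    have c0: "0 \<le> c" using A norm4_nonneg by (simp add: c_def)
    have "(\<integral>\<^sup>+x. (\<Sum>n. ennreal \<bar>(?p (Suc n) t x - ?p n t x) * ?G x\<bar>) \<partial>lborel) =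
      (\<Sum>n. \<integral>\<^sup>+x. ennreal \<bar>(?p (Suc n) t x - ?p n t x) * ?G x\<bar> \<partial>lborel)"
      by (rule nn_integral_suminf) (simp del: picard.simps)
    also have "\<dots> \<le> (\<Sum>n. ennreal ((1/2) ^ n * c))"
    proof (rule suminf_le)
      fix n
      have "(\<integral>\<^sup>+x. ennreal \<bar>(?p (Suc n) t x - ?p n t x) * ?G x\<bar> \<partial>lborel) \<le> ennreal
          ((1/2) ^ n * A * t powr (-1/4) * norm4 ?G)"
        by (rule Holder[OF pdiff[OF t] L4_schwartz[OF G]])
      then show "(\<integral>\<^sup>+x. ennreal \<bar>(?p (Suc n) t x - ?p n t x) * ?G x\<bar> \<partial>lborel) \<le> ennreal ((1/2) ^ n * c)"
        by (simp add: c_def mult.assoc del: picard.simps)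
    qed auto
    also have "\<dots> = ennreal (\<Sum>n. (1/2) ^ n * c)"
      using c0 by (intro suminf_ennreal2 summable_mult2 summable_geometric) auto
    also have "\<dots> < \<infinity>" by simp
    finally have "AE x in lborel. (\<Sum>n. ennreal \<bar>(?p (Suc n) t x - ?p n t x) * ?G x\<bar>) \<noteq> \<infinity>"
      by (intro nn_integral_noteq_infinite) (auto simp del: picard.simps)
    then show ?thesis
    proof eventually_elim
      case (elim x)
      have "summable (\<lambda>n. \<bar>(?p (Suc n) t x - ?p n t x) * ?G x\<bar>)"
        using elim by (intro summable_suminf_not_top) (auto simp del: picard.simps)
      then have "summable (\<lambda>n. (?p (Suc n) t x - ?p n t x) * ?G x)"
        by (rule summable_rabs_cancel)
      then have "summable (\<lambda>n. (?p (Suc n) t x - ?p n t x) * ?G x / ?G x)"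
        by (rule summable_divide)
      then have "summable (\<lambda>n. ?p (Suc n) t x - ?p n t x)"
        using heat_kernel_pos[of 1 x] by (simp del: picard.simps)
      then obtain s where "(\<lambda>n. ?p (Suc n) t x - ?p n t x) sums s" by (auto simp: summable_def)
      then have "(\<lambda>n. (\<Sum>i<n. ?p (Suc i) t x - ?p i t x) + ?p 0 t x) \<longlonglongrightarrow> s + ?p 0 t x"
        unfolding sums_def by (intro tendsto_add tendsto_const)
      then have "(\<lambda>n. ?p n t x) \<longlonglongrightarrow> s + ?p 0 t x"
        by (simp add: sum_lessThan_telescope[of "\<lambda>i. ?p i t x"] del: picard.simps)
      then have "convergent (\<lambda>n. ?p n t x)" by (rule convergentI)
      then show ?case unfolding u_def by (simp add: convergent_LIMSEQ_iff)
    qed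
  qed
  have uA: "L43 (u t) (A * t powr (-1/4))" if "0 < t" for t
    by (rule L43_limit[OF pA[OF that] conv[OF that] umt])
  \<comment> \<open>Fatou in k for fixed n: the tail of the series bounds the distance from the n-th
    iterate to the limit.\<close>
  have up: "L43 (\<lambda>x. u t x - ?p n t x) (2 * (1/2) ^ n * A * t powr (-1/4))" if t: "0 < t" for t n
  proof (rule L43_limit[where f = "\<lambda>k x. ?p (n + k) t x - ?p n t x"])
    show "L43 (\<lambda>x. ?p (n + k) t x - ?p n t x) (2 * (1/2) ^ n * A * t powr (-1/4))" for k
      using A by (intro L43_mono[OF pdiff_k[OF t]] mult_right_mono) auto
    show "AE x in lborel. (\<lambda>k. ?p (n + k) t x - ?p n t x) \<longlonglongrightarrow> u t x - ?p n t x"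
      using conv[OF t]
    proof eventually_elim
      case (elim x)
      then have "(\<lambda>k. ?p (k + n) t x) \<longlonglongrightarrow> u t x" by (rule LIMSEQ_ignore_initial_segment)
      then show ?case by (intro tendsto_diff tendsto_const) (simp add: add.commute)
    qed
    show "(\<lambda>x. u t x - ?p n t x) \<in> borel_measurable borel" using umt pmt by (intro borel_measurable_diff)
  qed
  show thesis
  proof (rule that[OF um uA])
    fix t \<psi> assume t: "0 < (t::real)" and \<psi>: "\<psi> \<in> schwartz"
    \<comment> \<open>The iterate n + 1 satisfies the recursion exactly. Replacing it by u on the
      left and iterate n by u inside the Duhamel term costs (1/2)^n times the same quantity
      each.\<close>
    have bound: "\<bar>distr_of (u t) \<psi> - (heat t u0 \<psi> + ?D u t \<psi>)\<bar> \<le> (1/2) ^ n *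
        (2 * A * t powr (-1/4) * norm4 \<psi>)" for n
    proof -
      have "represents (?p (Suc n) t) (\<lambda>\<psi>. heat t u0 \<psi> + ?D (?p n) t \<psi>)"
        unfolding picard.simps by (intro represents_add arep t duhamel_represents(1)[OF adm])
      then have e: "distr_of (?p (Suc n) t) \<psi> = heat t u0 \<psi> + ?D (?p n) t \<psi>"
        using representsD(3)[of "?p (Suc n) t" _ \<psi>] \<psi> by (simp add: distr_of_def del: picard.simps)
      have i: "integrable lborel (\<lambda>x. u t x * \<psi> x)" "integrable lborel (\<lambda>x. ?p (Suc n) t x * \<psi> x)"
        by (rule Holder_integrable(1)[OF uA[OF t] L4_schwartz[OF \<psi>]],
            rule Holder_integrable(1)[OF pA[OF t] L4_schwartz[OF \<psi>]])
      have "distr_of (u t) \<psi> - distr_of (?p (Suc n) t) \<psi> = distr_of (\<lambda>x. u t x - ?p (Suc n) t x) \<psi>"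
        using \<psi> i by (simp add: distr_of_def left_diff_distrib del: picard.simps)
      also have "\<bar>\<dots>\<bar> \<le> 2 * (1/2) ^ Suc n * A * t powr (-1/4) * norm4 \<psi>"
        by (rule L43_distr_bound[OF up[OF t] \<psi>])
      finally have 1: "\<bar>distr_of (u t) \<psi> - (heat t u0 \<psi> + ?D (?p n) t \<psi>)\<bar> \<le> (1/2) ^ n *
          (A * t powr (-1/4) * norm4 \<psi>)"
        by (simp add: e mult.assoc del: picard.simps)
      have "\<bar>?D u t \<psi> - ?D (?p n) t \<psi>\<bar> \<le> (2 * (1/2) ^ n * A / 2) * t powr (-1/4) * norm4 \<psi>"
        using A by (intro contr[OF um uA pm pA up _ t \<psi>]) auto
      then have 2: "\<bar>?D u t \<psi> - ?D (?p n) t \<psi>\<bar> \<le> (1/2) ^ n * (A * t powr (-1/4) * norm4 \<psi>)"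
        by (simp add: mult.assoc)
      have "(1/2) ^ n * (2 * A * t powr (-1/4) * norm4 \<psi>) = (1/2) ^ n * (A * t powr (-1/4) * norm4 \<psi>) +
          (1/2) ^ n * (A * t powr (-1/4) * norm4 \<psi>)"
        by simp
      with 1 2 show ?thesis by linarith
    qed
    have "(\<lambda>n. (1/2) ^ n * (2 * A * t powr (-1/4) * norm4 \<psi>)) \<longlonglongrightarrow> 0"
      by (intro tendsto_mult_left_zero LIMSEQ_realpow_zero) auto
    then have "\<bar>distr_of (u t) \<psi> - (heat t u0 \<psi> + ?D u t \<psi>)\<bar> \<le> 0"
      by (rule LIMSEQ_le_const) (use bound in auto)
    then show "distr_of (u t) \<psi> = heat t u0 \<psi> + ?D u t \<psi>" by simp
  qed
qed

subsection \<open>Estimates in time\<close>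

lemma weighted_time_bound:
  fixes f :: "real \<Rightarrow> real"
  assumes M: "M = lborel \<or> M = lebesgue" and ab: "0 < a" "0 < b" "0 < t" and K: "0 \<le> K"
    and le: "\<And>\<tau>. 0 < \<tau> \<Longrightarrow> \<tau> < t \<Longrightarrow> \<bar>f \<tau>\<bar> \<le> K * ((t - \<tau>) powr (a - 1) * \<tau> powr (b - 1))"
    and zero: "\<And>\<tau>. \<not> (0 < \<tau> \<and> \<tau> < t) \<Longrightarrow> f \<tau> = 0"
  shows "\<bar>integral\<^sup>L M f\<bar> \<le> K * (Beta a b * t powr (a + b - 1))"
    and "(\<integral>\<^sup>+\<tau>. ennreal \<bar>f \<tau>\<bar> \<partial>M) \<le> ennreal (K * (Beta a b * t powr (a + b - 1)))"
proof -
  have B: "0 \<le> Beta a b * t powr (a + b - 1)"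
    using ab by (auto simp: Beta_def Gamma_real_pos less_imp_le)
  have "(\<integral>\<^sup>+\<tau>. ennreal \<bar>f \<tau>\<bar> \<partial>M) = (\<integral>\<^sup>+\<tau>. ennreal \<bar>f \<tau>\<bar> \<partial>lborel)"
    using M by (auto simp: nn_integral_completion)
  also have "\<dots> \<le> (\<integral>\<^sup>+\<tau>. ennreal K * (indicator {0<..<t} \<tau> * ennreal ((t - \<tau>) powr (a - 1) * \<tau> powr (b - 1)))
      \<partial>lborel)"
  proof (rule nn_integral_mono)
    fix \<tau>
    show "ennreal \<bar>f \<tau>\<bar> \<le> ennreal K * (indicator {0<..<t} \<tau> * ennreal
        ((t - \<tau>) powr (a - 1) * \<tau> powr (b - 1)))"
    proof (cases "0 < \<tau> \<and> \<tau> < t")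
      case True
      then have "ennreal \<bar>f \<tau>\<bar> \<le> ennreal (K * ((t - \<tau>) powr (a - 1) * \<tau> powr (b - 1)))"
        by (intro ennreal_leI le) auto
      also have "\<dots> = ennreal K * ennreal ((t - \<tau>) powr (a - 1) * \<tau> powr (b - 1))"
        using K by (intro ennreal_mult) auto
      finally show ?thesis using True by simp
    qed (simp add: zero)
  qed
  also have "\<dots> = ennreal K * ennreal (Beta a b * t powr (a + b - 1))"
    unfolding nn_integral_Beta[OF ab, symmetric] by (rule nn_integral_cmult) measurable
  also have "\<dots> = ennreal (K * (Beta a b * t powr (a + b - 1)))"
    using K B by (rule ennreal_mult[symmetric])
  finally show *: "(\<integral>\<^sup>+\<tau>. ennreal \<bar>f \<tau>\<bar> \<partial>M) \<le> ennreal (K * (Beta a b * t powr (a + b - 1)))" .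
  then show "\<bar>integral\<^sup>L M f\<bar> \<le> K * (Beta a b * t powr (a + b - 1))"
    using abs_integral_le_ennreal[of M f] K B by simp
qed

lemma heat_heat_test:
  "0 < r \<Longrightarrow> 0 < s \<Longrightarrow> \<psi> \<in> schwartz \<Longrightarrow> heat r T (heat_test s \<psi>) = heat (s + r) T \<psi>"
  using heat_heat[of s r T] by (simp add: heat_eq schwartz_heat_test fun_eq_iff heat_test_heat_test
      schwartz_integrable add.commute)

text \<open>By the semigroup law an additional heat flow of length s moves into the kernel, whose
  time s + t - tau is now at least s: the source of the decay in s that the norm of
  \<open>BX\<close> requires.\<close>

lemma duhamel_heat_test:
  assumes "0 < s" "\<psi> \<in> schwartz"
  shows "duhamel F t (heat_test s \<psi>) = (LINT \<tau>|lborel. indicator {0<..<t} \<tau> * heat (s + t - \<tau>)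
      (div_distr (F \<tau>)) \<psi>)"
proof -
  have "indicator {0<..<t} \<tau> * heat (t - \<tau>) (div_distr (F \<tau>)) (heat_test s \<psi>) = indicator {0<..<t} \<tau> * heat
      (s + t - \<tau>) (div_distr (F \<tau>)) \<psi>" for \<tau>
    using heat_heat_test[of "t - \<tau>" s \<psi> "div_distr (F \<tau>)"] assms
    by (cases "0 < \<tau> \<and> \<tau> < t") (auto simp: algebra_simps)
  then have "(\<lambda>\<tau>. indicator {0<..<t} \<tau> * heat (t - \<tau>) (div_distr (F \<tau>)) (heat_test s \<psi>)) =
      (\<lambda>\<tau>. indicator {0<..<t} \<tau> * heat (s + t - \<tau>) (div_distr (F \<tau>)) \<psi>)"
    by (rule ext)
  then show ?thesis using schwartz_heat_test[OF assms] unfolding duhamel_def by simp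
qed

text \<open>Distributes the decay of a sum of times over its summands, in order to extract s^(-1/4)
  and leave an integrable singularity.\<close>

lemma powr_split_le:
  fixes s x p q :: real
  assumes "0 < s" "0 < x" "0 \<le> p" "0 \<le> q"
  shows "(s + x) powr (- (p + q)) \<le> s powr (- p) * x powr (- q)"
proof -
  have "(s + x) powr (- (p + q)) = (s + x) powr (- p) * (s + x) powr (- q)"
    by (simp flip: powr_add)
  also have "\<dots> \<le> s powr (- p) * x powr (- q)"
    using assms by (intro mult_mono powr_mono2') auto
  finally show ?thesis .
qed

text \<open>The kernel exponent -3/4 is split as -1/4 for s and -1/2 for t - tau. The remaining Beta
  integral with parameters 1/2, 1/2 carries the power t^0, so the bound in \<open>BX\<close> is
  uniform in t.\<close>

lemma duhamel_heat_bound: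
  assumes F: "duhamel_admissible F N" and t: "0 < t" and s: "0 < s" and \<psi>: "\<psi> \<in> schwartz"
  shows "\<bar>duhamel F t (heat_test s \<psi>)\<bar> \<le> (N * grad_const * Beta (1/2) (1/2)) * s powr (-1/4) * norm4 \<psi>"
proof -
  have N: "0 \<le> N" using F by (simp add: duhamel_admissible_def)
  have "\<bar>LINT \<tau>|lborel. indicator {0<..<t} \<tau> * heat (s + t - \<tau>) (div_distr (F \<tau>)) \<psi>\<bar> \<le>
    (N * grad_const * norm4 \<psi> * s powr (-1/4)) * (Beta (1/2) (1/2) * t powr (1/2 + 1/2 - 1))"
  proof (rule weighted_time_bound(1))
    fix \<tau> assume \<tau>: "0 < \<tau>" "\<tau> < t"
    have L: "L1_bounded (F \<tau>) (N * \<tau> powr (-1/2))" using F \<tau> by (simp add: duhamel_admissible_def)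
    have "\<bar>heat (s + t - \<tau>) (div_distr (F \<tau>)) \<psi>\<bar> \<le> (N * \<tau> powr (-1/2)) *
        (grad_const * (s + t - \<tau>) powr (-3/4) * norm4 \<psi>)"
      using \<tau> s by (intro heat_div_bound[OF L _ \<psi>]) auto
    also have "\<dots> \<le> (N * \<tau> powr (-1/2)) * (grad_const * (s powr (-1/4) * (t - \<tau>) powr (-1/2)) * norm4 \<psi>)"
      using powr_split_le[of s "t - \<tau>" "1/4" "1/2"] s \<tau> N grad_const_pos norm4_nonneg[of \<psi>]
      by (intro mult_left_mono mult_right_mono) (auto simp: algebra_simps)
    finally show "\<bar>indicator {0<..<t} \<tau> * heat (s + t - \<tau>) (div_distr (F \<tau>)) \<psi>\<bar> \<le>
       (N * grad_const * norm4 \<psi> * s powr (-1/4)) * ((t - \<tau>) powr (1/2 - 1) * \<tau> powr (1/2 - 1))"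
      using \<tau> by (simp add: mult_ac)
  qed (use t N grad_const_pos norm4_nonneg in auto)
  then show ?thesis using t by (simp add: duhamel_heat_test[OF s \<psi>] mult_ac)
qed

text \<open>With the gradient on \<open>\<psi>\<close> only the integrable weight tau^(-1/2) is
  left, and the term is of order sqrt t.\<close>

lemma duhamel_initial:
  assumes F: "duhamel_admissible F N" and \<psi>: "\<psi> \<in> schwartz"
  shows "((\<lambda>t. duhamel F t \<psi>) \<longlongrightarrow> 0) (at_right 0)"
proof -
  have N: "0 \<le> N" using F by (simp add: duhamel_admissible_def)
  obtain C where C: "C > 0" "\<And>x. norm (grad \<psi> x) \<le> C" using schwartz_grad_bound[OF \<psi>, of 0] by auto
  have b: "\<bar>duhamel F t \<psi>\<bar> \<le> (N * C) * (Beta 1 (1/2) * t powr (1 + 1/2 - 1))" if t: "0 < t" for t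
  proof -
    have "\<bar>LINT \<tau>|lborel. indicator {0<..<t} \<tau> * heat (t - \<tau>) (div_distr (F \<tau>)) \<psi>\<bar> \<le> (N * C) *
        (Beta 1 (1/2) * t powr (1 + 1/2 - 1))"
    proof (rule weighted_time_bound(1))
      fix \<tau> assume \<tau>: "0 < \<tau>" "\<tau> < t"
      have L: "L1_bounded (F \<tau>) (N * \<tau> powr (-1/2))" using F \<tau> by (simp add: duhamel_admissible_def)
      have "\<bar>heat (t - \<tau>) (div_distr (F \<tau>)) \<psi>\<bar> \<le> (N * \<tau> powr (-1/2)) * C"
        using \<tau> by (intro heat_div_bound_grad[OF L _ \<psi> C(2)]) auto
      then show "\<bar>indicator {0<..<t} \<tau> * heat (t - \<tau>) (div_distr (F \<tau>)) \<psi>\<bar> \<le> (N * C) *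
          ((t - \<tau>) powr (1 - 1) * \<tau> powr (1/2 - 1))"
        using \<tau> by (simp add: mult_ac)
    qed (use t N C in auto)
    then show ?thesis using \<psi> by (simp add: duhamel_def)
  qed
  have "((\<lambda>t. (N * C) * (Beta 1 (1/2) * t powr (1/2))) \<longlongrightarrow> (N * C) * (Beta 1 (1/2) * 0 powr (1/2)))
      (at_right 0)"
    by (intro tendsto_mult_left tendsto_powr' tendsto_const tendsto_ident_at)
        (auto simp: eventually_at_right_less intro: eventually_mono[OF eventually_at_right_less])
  then have l: "((\<lambda>t. (N * C) * (Beta 1 (1/2) * t powr (1/2))) \<longlongrightarrow> 0) (at_right 0)" by simp
  show ?thesis
    by (rule Lim_null_comparison[OF _ l]) (use b in \<open>auto simp: eventually_at_right_field intro!: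
        exI[of _ 1]\<close>)
qed

text \<open>Two contributions: on (0, t) the increment of the kernel, Hoelder of order 1/4 in h; on
  [t, t + h) the full kernel over a short interval, which gives order 1/8. Both retain the factor
  s^(-1/4).\<close>

lemma duhamel_heat_time_diff:
  assumes F: "duhamel_admissible F N" and t: "0 < t" and h: "0 < h" and s: "0 < s" and \<psi>: "\<psi> \<in> schwartz"
  shows "\<bar>duhamel F (t + h) (heat_test s \<psi>) - duhamel F t (heat_test s \<psi>)\<bar> \<le>
    (N * grad_const * (h powr (1/4) * (Beta (1/4) (1/2) * t powr (-1/4)) + h powr (1/8) *
        (Beta (3/8) (1/2) * t powr (-1/8))))
      * s powr (-1/4) * norm4 \<psi>"
proof -
  let ?H = "\<lambda>r \<tau>. heat r (div_distr (F \<tau>)) \<psi>"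
  let ?K = "N * grad_const * norm4 \<psi> * s powr (-1/4)"
  have N: "0 \<le> N" using F by (simp add: duhamel_admissible_def)
  have K: "0 \<le> ?K" using N grad_const_pos norm4_nonneg by simp
  have L: "L1_bounded (F \<tau>) (N * \<tau> powr (-1/2))" if "0 < \<tau>" for \<tau> using F that
      by (simp add: duhamel_admissible_def)
  have S: "heat_test s \<psi> \<in> schwartz" using s \<psi> by (rule schwartz_heat_test)
  have eq: "indicator {0<..<r} \<tau> * heat (r - \<tau>) (div_distr (F \<tau>)) (heat_test s \<psi>) = indicator {0<..<r} \<tau> *
      ?H (s + r - \<tau>) \<tau>" for r \<tau>
    using heat_heat_test[of "r - \<tau>" s \<psi> "div_distr (F \<tau>)"] s \<psi>
    by (cases "0 < \<tau> \<and> \<tau> < r") (auto simp: algebra_simps)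
  have int: "integrable lborel (\<lambda>\<tau>. indicator {0<..<r} \<tau> * ?H (s + r - \<tau>) \<tau>)" if "0 < r" for r
    using duhamel_represents(2)[OF F that S] by (simp add: eq)
  define f where "f \<tau> = (if 0 < \<tau> \<and> \<tau> < t then ?H (s + (t + h) - \<tau>) \<tau> - ?H (s + t - \<tau>) \<tau> else 0)" for \<tau>
  define g where "g \<tau> = (if t \<le> \<tau> \<and> \<tau> < t + h then ?H (s + (t + h) - \<tau>) \<tau> else 0)" for \<tau>
  have fg: "indicator {0<..<t + h} \<tau> * ?H (s + (t + h) - \<tau>) \<tau> - indicator {0<..<t} \<tau> * ?H (s + t - \<tau>) \<tau> = f
      \<tau> + g \<tau>" for \<tau>
    using t h by (auto simp: f_def g_def indicator_def)
  have fb: "(\<integral>\<^sup>+\<tau>. ennreal \<bar>f \<tau>\<bar> \<partial>lborel) \<le> ennreal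
      ((?K * h powr (1/4)) * (Beta (1/4) (1/2) * t powr (1/4 + 1/2 - 1)))"
  proof (rule weighted_time_bound(2))
    fix \<tau> assume \<tau>: "0 < \<tau>" "\<tau> < t"
    have "\<bar>?H ((s + t - \<tau>) + h) \<tau> - ?H (s + t - \<tau>) \<tau>\<bar> \<le> (N * \<tau> powr (-1/2)) *
        (grad_const * ((s + t - \<tau>) powr -1 * h powr (1/4)) * norm4 \<psi>)"
      using \<tau> s h by (intro heat_div_time_diff[OF L _ _ \<psi>]) auto
    also have "\<dots> \<le> (N * \<tau> powr (-1/2)) * (grad_const *
        ((s powr (-1/4) * (t - \<tau>) powr (-3/4)) * h powr (1/4)) * norm4 \<psi>)"
      using powr_split_le[of s "t - \<tau>" "1/4" "3/4"] s \<tau> N grad_const_pos norm4_nonneg[of \<psi>]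
      by (intro mult_left_mono mult_right_mono) (auto simp: algebra_simps)
    finally show "\<bar>f \<tau>\<bar> \<le> (?K * h powr (1/4)) * ((t - \<tau>) powr (1/4 - 1) * \<tau> powr (1/2 - 1))"
      using \<tau> by (simp add: f_def algebra_simps)
  qed (use t K in \<open>auto simp: f_def\<close>)
  \<comment> \<open>\<open>g\<close> lives on [t, t + h) but is bounded on all of (0, t + h), where
    the Beta integral applies; smallness in h has to come from the kernel factor.\<close>
  have gb: "(\<integral>\<^sup>+\<tau>. ennreal \<bar>g \<tau>\<bar> \<partial>lborel) \<le> ennreal
      ((?K * h powr (1/8)) * (Beta (3/8) (1/2) * (t + h) powr (3/8 + 1/2 - 1)))"
  proof (rule weighted_time_bound(2))
    fix \<tau> assume \<tau>: "0 < \<tau>" "\<tau> < t + h"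
    let ?x = "t + h - \<tau>"
    show "\<bar>g \<tau>\<bar> \<le> (?K * h powr (1/8)) * (?x powr (3/8 - 1) * \<tau> powr (1/2 - 1))"
    proof (cases "t \<le> \<tau>")
      case True
      have "\<bar>?H (s + (t + h) - \<tau>) \<tau>\<bar> \<le> (N * \<tau> powr (-1/2)) *
          (grad_const * (s + (t + h) - \<tau>) powr (-3/4) * norm4 \<psi>)"
        using \<tau> s by (intro heat_div_bound[OF L _ \<psi>]) auto
      also have "\<dots> \<le> (N * \<tau> powr (-1/2)) * (grad_const * (s powr (-1/4) * (h powr (1/8) * ?x powr (-5/8)))
          * norm4 \<psi>)"
      proof (intro mult_left_mono mult_right_mono)
        have "(s + (t + h) - \<tau>) powr (-3/4) \<le> s powr (-1/4) * ?x powr (-1/2)"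
          using powr_split_le[of s ?x "1/4" "1/2"] s \<tau> by (simp add: algebra_simps)
        \<comment> \<open>Since tau \<ge> t, the remaining time is at most h, so a power 1/8 of it
          can be released as h^(1/8). The exponent -5/8 that is left is still integrable.\<close>
        also have "?x powr (-1/2) = ?x powr (1/8) * ?x powr (-5/8)"
          by (simp flip: powr_add)
        also have "s powr (-1/4) * (?x powr (1/8) * ?x powr (-5/8)) \<le> s powr (-1/4) *
            (h powr (1/8) * ?x powr (-5/8))"
          using True \<tau> by (intro mult_left_mono mult_right_mono powr_mono2) auto
        finally show "(s + (t + h) - \<tau>) powr (-3/4) \<le> s powr (-1/4) * (h powr (1/8) * ?x powr (-5/8))" .
      qed (use N grad_const_pos norm4_nonneg[of \<psi>] in auto)
      finally have "\<bar>?H (s + (t + h) - \<tau>) \<tau>\<bar> \<le> (N * \<tau> powr (-1/2)) *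
          (grad_const * (s powr (-1/4) * (h powr (1/8) * ?x powr (-5/8))) * norm4 \<psi>)" .
      then show ?thesis using True \<tau> by (simp add: g_def mult_ac)
    qed (use K in \<open>simp add: g_def\<close>)
  qed (use t h K in \<open>auto simp: g_def\<close>)
  let ?E1 = "(?K * h powr (1/4)) * (Beta (1/4) (1/2) * t powr (-1/4))"
  let ?E2 = "(?K * h powr (1/8)) * (Beta (3/8) (1/2) * t powr (-1/8))"
  have Bp: "0 < Beta (1/4) (1/2 :: real)" "0 < Beta (3/8) (1/2 :: real)"
    by (auto simp: Beta_def Gamma_real_pos)
  have E: "0 \<le> ?E1" "0 \<le> ?E2" using K Bp by auto
  have gb': "(\<integral>\<^sup>+\<tau>. ennreal \<bar>g \<tau>\<bar> \<partial>lborel) \<le> ennreal ?E2"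
  proof (rule order_trans[OF gb], intro ennreal_leI mult_left_mono)
    have "(t + h) powr (-1/8) \<le> t powr (-1/8)" using t h by (intro powr_mono2') auto
    then show "(t + h) powr (3/8 + 1/2 - 1) \<le> t powr (-1/8)" by simp
  qed (use K Bp in auto)
  have "duhamel F (t + h) (heat_test s \<psi>) - duhamel F t (heat_test s \<psi>) = (LINT \<tau>|lborel. f \<tau> + g \<tau>)"
    using int[of "t + h"] int[of t] t h unfolding fg[symmetric]
    by (simp add: duhamel_heat_test[OF s \<psi>])
  also have "norm \<dots> \<le> ?E1 + ?E2"
  proof (rule abs_integral_le_ennreal)
    have fm: "(\<lambda>\<tau>. f \<tau> + g \<tau>) \<in> borel_measurable borel"
      using int[of "t + h"] int[of t] t h unfolding fg[symmetric] by auto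
    \<comment> \<open>Measurability is known only for the sum, through the two Duhamel integrands;
      the parts are recovered as its restrictions to disjoint intervals.\<close>
    have f_eq: "f = (\<lambda>\<tau>. indicator {0<..<t} \<tau> * (f \<tau> + g \<tau>))"
      by (auto simp: f_def g_def indicator_def fun_eq_iff)
    have g_eq: "g = (\<lambda>\<tau>. indicator {t..<t + h} \<tau> * (f \<tau> + g \<tau>))"
      by (auto simp: f_def g_def indicator_def fun_eq_iff)
    have [measurable]: "f \<in> borel_measurable borel" "g \<in> borel_measurable borel"
      by (subst f_eq, use fm in measurable) (subst g_eq, use fm in measurable)
    have "(\<integral>\<^sup>+\<tau>. ennreal (norm (f \<tau> + g \<tau>)) \<partial>lborel) \<le> (\<integral>\<^sup>+\<tau>. ennreal \<bar>f \<tau>\<bar> + ennreal \<bar>g \<tau>\<bar> \<partial>lborel)"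
      by (intro nn_integral_mono) (auto simp flip: ennreal_plus intro!: ennreal_leI)
    also have "\<dots> = (\<integral>\<^sup>+\<tau>. ennreal \<bar>f \<tau>\<bar> \<partial>lborel) + (\<integral>\<^sup>+\<tau>. ennreal \<bar>g \<tau>\<bar> \<partial>lborel)"
      by (rule nn_integral_add) measurable
    also have "\<dots> \<le> ennreal ?E1 + ennreal ?E2"
      using fb gb' by (intro add_mono) auto
    finally show "(\<integral>\<^sup>+\<tau>. ennreal (norm (f \<tau> + g \<tau>)) \<partial>lborel) \<le> ennreal (?E1 + ?E2)"
      using E by (simp add: ennreal_plus)
  qed (use E in auto)
  finally show ?thesis by (simp add: algebra_simps)
qed

subsection \<open>Strong measurability\<close>

text \<open>The approximating step functions take on each cell the value at its right end point.\<close>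

lemma BX_measurable_right_continuous:
  assumes BX: "\<And>t. 0 \<le> t \<Longrightarrow> U t \<in> BX"
    and cont: "\<And>t. 0 < t \<Longrightarrow> (E t \<longlongrightarrow> 0) (at_right 0)"
    and le: "\<And>t h. 0 < t \<Longrightarrow> 0 < h \<Longrightarrow> BX_norm (U t - U (t + h)) \<le> ennreal (E t h)"
  shows "BX_measurable U"
proof -
  \<comment> \<open>The cap keeps the range finite, so the step functions are simple; from time n +
    1 on they take the value U 0. For a fixed t the cap is inactive for all large n.\<close>
  define j where "j n t = min (nat \<lfloor>real (Suc n) * t\<rfloor>) (Suc n * Suc n)" for n :: nat and t :: real
  define S where "S n k = (if k < Suc n * Suc n then U ((real k + 1) / real (Suc n)) else U 0)" for n k ::
      nat
  have jm: "j n \<in> measurable (lebesgue_on {0..}) (count_space UNIV)" for n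
  proof -
    have "j n \<in> measurable borel (count_space UNIV)" unfolding j_def[abs_def] by measurable
    then have "j n \<in> measurable lebesgue (count_space UNIV)" by (intro measurable_completion) simp
    then show ?thesis by (rule measurable_restrict_space1)
  qed
  have simple: "simple_function (lebesgue_on {0..}) (\<lambda>t. S n (j n t))" for n
  proof -
    have "finite (range (j n))"
      by (rule finite_subset[of _ "{..Suc n * Suc n}"]) (auto simp: j_def)
    then have "finite (j n ` space (lebesgue_on {0..}))" by (rule finite_subset[rotated]) auto
    moreover have "j n -` {k} \<inter> space (lebesgue_on {0..}) \<in> sets (lebesgue_on {0..})" for k
      by (rule measurable_sets[OF jm]) simp
    ultimately have "simple_function (lebesgue_on {0..}) (j n)" by (simp add: simple_function_def)
    then show ?thesis by (rule simple_function_compose1)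
  qed
  have SBX: "S n k \<in> BX" for n k by (auto simp: S_def intro!: BX)
  have conv: "(\<lambda>n. BX_norm (U t - S n (j n t))) \<longlonglongrightarrow> 0" if t: "0 < t" for t
  proof -
    define h where "h n = (real (nat \<lfloor>real (Suc n) * t\<rfloor>) + 1) / real (Suc n) - t" for n :: nat
    have hn: "0 < h n" "h n \<le> 1 / real (Suc n)" for n
    proof -
      have f: "real (nat \<lfloor>real (Suc n) * t\<rfloor>) = of_int \<lfloor>real (Suc n) * t\<rfloor>" using t by simp
      have "real (Suc n) * t < real (nat \<lfloor>real (Suc n) * t\<rfloor>) + 1" unfolding f by linarith
      then show "0 < h n" by (simp add: h_def pos_less_divide_eq mult.commute)
      have "real (nat \<lfloor>real (Suc n) * t\<rfloor>) + 1 \<le> real (Suc n) * t + 1" unfolding f by linarith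
      then have "(real (nat \<lfloor>real (Suc n) * t\<rfloor>) + 1) / real (Suc n) \<le> (real (Suc n) * t + 1) / real (Suc n)"
        by (intro divide_right_mono) auto
      also have "\<dots> = t + 1 / real (Suc n)" by (simp add: add_divide_distrib del: of_nat_Suc)
      finally show "h n \<le> 1 / real (Suc n)" by (simp add: h_def)
    qed
    have h0: "h \<longlonglongrightarrow> 0"
      by (rule tendsto_sandwich[OF _ _ tendsto_const LIMSEQ_inverse_real_of_nat])
        (use hn in \<open>auto intro!: always_eventually less_imp_le simp: inverse_eq_divide simp del:
            of_nat_Suc\<close>)
    have "filterlim h (at_right 0) sequentially"
      using h0 hn(1) by (auto simp: filterlim_at less_imp_neq[symmetric] intro!: always_eventually)
    then have "(\<lambda>n. E t (h n)) \<longlonglongrightarrow> 0" using cont[OF t] by (rule filterlim_compose[rotated])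
    then have lim: "(\<lambda>n. ennreal (E t (h n))) \<longlonglongrightarrow> 0" using tendsto_ennrealI[of _ 0] by simp
    obtain N :: nat where N: "t < real N" using reals_Archimedean2 by blast
    have ev: "BX_norm (U t - S n (j n t)) \<le> ennreal (E t (h n))" if n: "N \<le> n" for n
    proof -
      have lt: "real (Suc n) * t < real (Suc n) * real (Suc n)"
        using N n by (intro mult_strict_left_mono) auto
      then have "nat \<lfloor>real (Suc n) * t\<rfloor> < Suc n * Suc n"
      proof (subst nat_less_iff)
        show "0 \<le> \<lfloor>real (Suc n) * t\<rfloor>" using t by simp
        show "\<lfloor>real (Suc n) * t\<rfloor> < int (Suc n * Suc n)"
          using lt by (simp only: floor_less_iff of_nat_mult of_int_mult of_int_of_nat_eq)
      qed
      then have "S n (j n t) = U (t + h n)" by (simp add: S_def j_def h_def del: of_nat_Suc)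
      then show ?thesis using le[OF t hn(1)] by simp
    qed
    show ?thesis
      by (rule tendsto_sandwich[OF _ _ tendsto_const lim]) (use ev in \<open>auto simp: eventually_sequentially\<close>)
  qed
  have "AE t in lborel. t \<noteq> (0::real)" by (rule AE_lborel_singleton)
  then have "AE t in lebesgue. t \<noteq> (0::real)" by (rule AE_completion)
  then have "AE t in lebesgue_on {0..}. (\<lambda>n. BX_norm (U t - S n (j n t))) \<longlonglongrightarrow> 0"
    by (subst AE_restrict_space_iff) (auto intro: conv elim!: eventually_mono)
  then show ?thesis
    unfolding BX_measurable_def using simple SBX by (intro exI[of _ "\<lambda>n t. S n (j n t)"]) auto
qed

subsection \<open>Existence and uniqueness\<close>

lemma heat_orbit_bound:
  assumes "0 \<le> M" "BX_norm T \<le> ennreal M" "0 < t" "\<psi> \<in> schwartz"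
  shows "\<bar>heat t T \<psi>\<bar> \<le> M * t powr (-1/4) * norm4 \<psi>"
proof -
  have "Lp_norm (4/3) (heat t T) \<le> ennreal (M * t powr (-1/4))" using assms by (simp add: BX_norm_le_iff)
  then obtain g where "represents g (heat t T)" "L43 g (M * t powr (-1/4))"
    using assms by (auto simp: Lp_norm_le_iff)
  then show ?thesis using Holder_integrable(2)[OF _ L4_schwartz[OF assms(4)]] assms
      by (simp add: representsD(3))
qed

text \<open>The orbit is restarted at time t/2, where it has a density in L^(4/3), so the L^1
  distance of two kernels applies. The factor h/(s + t/2) is then split to release s^(-1/4).\<close>

lemma heat_orbit_time_diff:
  assumes M: "0 \<le> M" "BX_norm T \<le> ennreal M" and t: "0 < t" and h: "0 < h" and s: "0 < s" and \<psi>: "\<psi> \<in>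
      schwartz"
  shows "\<bar>heat (s + (t + h)) T \<psi> - heat (s + t) T \<psi>\<bar> \<le> (4 * M * h / t) * s powr (-1/4) * norm4 \<psi>"
proof -
  let ?q = "t / 2"
  have q: "0 < ?q" using t by simp
  have "Lp_norm (4/3) (heat ?q T) \<le> ennreal (M * ?q powr (-1/4))" using M q by (simp add: BX_norm_le_iff)
  then obtain g where g: "represents g (heat ?q T)" "L43 g (M * ?q powr (-1/4))"
    using M by (auto simp: Lp_norm_le_iff)
  have T: "heat ?q T = distr_of g" by (rule represents_distr_of[OF g(1)]) (simp add: heat_def)
  have e: "heat (s + (t + h)) T = heat (s + ?q + h) (distr_of g)" "heat (s + t) T = heat (s + ?q)
      (distr_of g)"
    unfolding T[symmetric] using q s h by (simp_all add: heat_heat algebra_simps)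
  have "\<bar>heat (s + (t + h)) T \<psi> - heat (s + t) T \<psi>\<bar> \<le>
     (M * ?q powr (-1/4)) * (2 * (s + ?q + h - (s + ?q)) / (s + ?q + h)) * norm4 \<psi>"
    unfolding e by (rule heat_diff_bound[OF g(2) _ _ \<psi>]) (use q s h in auto)
  also have "\<dots> \<le> (M * ?q powr (-1/4)) * (2 * h * (s powr (-1/4) * ?q powr (-3/4))) * norm4 \<psi>"
  proof (intro mult_left_mono mult_right_mono norm4_nonneg)
    have "2 * (s + ?q + h - (s + ?q)) / (s + ?q + h) \<le> 2 * h / (s + ?q)"
      using q s h by (intro frac_le) auto
    also have "\<dots> = 2 * h * (s + ?q) powr (- (1/4 + 3/4))"
      using q s powr_minus_divide[of "s + ?q" 1] by simp
    also have "\<dots> \<le> 2 * h * (s powr (- (1/4)) * ?q powr (- (3/4)))"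
      using q s h by (intro mult_left_mono powr_split_le) auto
    finally show "2 * (s + ?q + h - (s + ?q)) / (s + ?q + h) \<le> 2 * h * (s powr (-1/4) * ?q powr (-3/4))"
        by simp
  qed (use M in auto)
  also have "\<dots> = (M * 2 * h * (?q powr (-1/4) * ?q powr (-3/4))) * s powr (-1/4) * norm4 \<psi>" by simp
  also have "?q powr (-1/4) * ?q powr (-3/4) = 2 / t"
    using q powr_minus_divide[of ?q 1] by (simp flip: powr_add)
  finally show ?thesis by (simp add: mult_ac)
qed

text \<open>Beyond the fixed point, membership in \<open>X_space\<close> asks for a bound in
  \<open>BX\<close> uniform in t, right continuity in \<open>BX\<close> and the weak initial limit.
  Each is the sum of an estimate for the linear orbit and one for the Duhamel term.\<close>

lemma mild_solution_exists:
  assumes u0: "u0 \<in> BX" and M: "0 \<le> M" "BX_norm u0 \<le> ennreal M"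
    and A: "0 < A" "M + contraction_const * A * A \<le> A" "4 * contraction_const * A \<le> 1"
  shows "\<exists>U u. U \<in> X_space u0 \<and> mild_solution u0 U \<and> weighted_norm U \<le> ennreal A \<and>
    (\<forall>t>0. represents (u t) (U t) \<and> L43 (u t) (A * t powr (-1/4)))"
proof -
  obtain a where a: "case_prod a \<in> borel_measurable (borel \<Otimes>\<^sub>M borel)"
    "\<And>t. 0 < t \<Longrightarrow> represents (a t) (heat t u0)" "\<And>t. 0 < t \<Longrightarrow> L43 (a t) (M * t powr (-1/4))"
    using heat_orbit_density[OF M] by blast
  obtain u where u: "case_prod u \<in> borel_measurable (borel \<Otimes>\<^sub>M borel)"
    "\<And>t. 0 < t \<Longrightarrow> L43 (u t) (A * t powr (-1/4))"
    "\<And>t \<psi>. 0 < t \<Longrightarrow> \<psi> \<in> schwartz \<Longrightarrow> distr_of (u t) \<psi> = heat t u0 \<psi> + duhamel (\<lambda>\<tau>. nl (u \<tau>)) t \<psi>"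
    using picard_solution[OF a A] by blast
  \<comment> \<open>\<open>X_space\<close> requires an element of \<open>BX\<close> at time 0 as
    well; the datum is the natural one.\<close>
  define U where "U t = (if 0 < t then distr_of (u t) else u0)" for t
  define F where "F \<tau> = nl (u \<tau>)" for \<tau>
  define N where "N = nl_const * A * A"
  have adm: "duhamel_admissible F N" unfolding F_def N_def
      by (rule duhamel_admissible_nl[OF u(1) A(1) u(2)])
  have rep: "represents (u t) (U t)" if "0 < t" for t
    using L43_represents[OF u(2)[OF that]] that by (simp add: U_def)
  have nonlin: "debye_nonlin (U t) = div_distr (F t)" if "0 < t" for t
    unfolding F_def by (rule debye_nonlin_represents[OF rep[OF that]])
  have Ueq: "U t \<psi> = heat t u0 \<psi> + duhamel F t \<psi>" if "0 < t" "\<psi> \<in> schwartz" for t \<psi>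
    using u(3)[OF that] that by (simp add: U_def F_def[abs_def])
  have hU: "heat s (U t) \<psi> = heat (s + t) u0 \<psi> + duhamel F t (heat_test s \<psi>)" if "0 < s" "0 < t" "\<psi> \<in>
      schwartz" for s t \<psi>
    using that Ueq[OF that(2) schwartz_heat_test[OF that(1,3)]] heat_heat_test[OF that(2,1,3)]
        by (simp add: heat_eq[of s])
  have hrep: "represents (\<lambda>x. LINT y|lborel. u t y * heat_kernel s (x - y)) (heat s (U t))" if "0 < s" "0 <
      t" for s t
    using represents_heat[OF u(2)[OF that(2)] that(1)] that by (simp add: U_def)
  define B where "B = N * grad_const * Beta (1/2) (1/2)"
  have B0: "0 \<le> B" using adm grad_const_pos
      by (auto simp: B_def duhamel_admissible_def Beta_def Gamma_real_pos less_imp_le)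
  have BXb: "BX_norm (U t) \<le> ennreal (M + B)" if t: "0 < t" for t
  proof (subst BX_norm_le_iff)
    show "\<forall>s>0. Lp_norm (4/3) (heat s (U t)) \<le> ennreal ((M + B) * s powr (-1/4))"
    proof (intro allI impI)
      fix s :: real assume s: "0 < s"
      have "L43 (\<lambda>x. LINT y|lborel. u t y * heat_kernel s (x - y)) ((M + B) * s powr (-1/4))"
      proof (rule represents_L43[OF hrep[OF s t]])
        fix \<psi> assume \<psi>: "\<psi> \<in> schwartz"
        have "\<bar>heat (s + t) u0 \<psi>\<bar> \<le> M * (s + t) powr (-1/4) * norm4 \<psi>"
          by (rule heat_orbit_bound[OF M _ \<psi>]) (use s t in simp)
        also have "\<dots> \<le> M * s powr (-1/4) * norm4 \<psi>"
          using M s t by (intro mult_right_mono mult_left_mono powr_mono2' norm4_nonneg) auto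
        finally show "\<bar>heat s (U t) \<psi>\<bar> \<le> (M + B) * s powr (-1/4) * norm4 \<psi>"
          using duhamel_heat_bound[OF adm t s \<psi>] hU[OF s t \<psi>] by (simp add: B_def distrib_right)
      qed (use M B0 in auto)
      then show "Lp_norm (4/3) (heat s (U t)) \<le> ennreal ((M + B) * s powr (-1/4))"
        using hrep[OF s t] M B0 by (subst Lp_norm_le_iff) auto
    qed
  qed (use M B0 in auto)
  have UBX: "U t \<in> BX" if "0 \<le> t" for t
  proof (cases "0 < t")
    case True
    then have "U t \<in> tempered" using L43_tempered[OF u(2)[OF True]] by (simp add: U_def)
    moreover have "BX_norm (U t) < \<infinity>" using BXb[OF True] by (simp add: le_less_trans)
    ultimately show ?thesis by (simp add: BX_def)
  qed (use u0 in \<open>simp add: U_def\<close>)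
  \<comment> \<open>The modulus of continuity: Lipschitz part from the linear orbit, orders 1/4 and
    1/8 from the Duhamel term. It degenerates as t tends to 0, so continuity is obtained only at t >
    0.\<close>
  define E where "E t h = 4 * M * h / t + N * grad_const *
      (h powr (1/4) * (Beta (1/4) (1/2) * t powr (-1/4)) + h powr (1/8) *
      (Beta (3/8) (1/2) * t powr (-1/8)))" for t h
  have N0: "0 \<le> N" using adm by (simp add: duhamel_admissible_def)
  have E0: "0 \<le> E t h" if "0 < t" "0 < h" for t h
    using that M N0 grad_const_pos by (auto simp: E_def Beta_def Gamma_real_pos less_imp_le intro!:
        add_nonneg_nonneg mult_nonneg_nonneg)
  have meas: "BX_measurable U"
  proof (rule BX_measurable_right_continuous[OF UBX])
    show "(E t \<longlongrightarrow> 0) (at_right 0)" if "0 < t" for t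
    proof -
      have p: "((\<lambda>h::real. h powr c) \<longlongrightarrow> 0) (at_right 0)" if "0 < c" for c
      proof -
        have "((\<lambda>h::real. h powr c) \<longlongrightarrow> 0 powr c) (at_right 0)"
          by (intro tendsto_powr' tendsto_ident_at tendsto_const)
            (use that in \<open>auto intro: eventually_mono[OF eventually_at_right_less]\<close>)
        then show ?thesis by simp
      qed
      have "((\<lambda>h. 4 * M * h / t + N * grad_const *
          (h powr (1/4) * (Beta (1/4) (1/2) * t powr (-1/4)) + h powr (1/8) *
          (Beta (3/8) (1/2) * t powr (-1/8))))
        \<longlongrightarrow> 4 * M * 0 / t + N * grad_const * (0 * (Beta (1/4) (1/2) * t powr (-1/4)) + 0 *
            (Beta (3/8) (1/2) * t powr (-1/8)))) (at_right 0)"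
        using that by (intro tendsto_add tendsto_mult tendsto_divide tendsto_const tendsto_ident_at p) auto
      then show ?thesis by (simp add: E_def[abs_def])
    qed
    show "BX_norm (U t - U (t + h)) \<le> ennreal (E t h)" if t: "0 < t" and h: "0 < h" for t h
    proof (subst BX_norm_le_iff)
      have th: "0 < t + h" using t h by simp
      show "\<forall>s>0. Lp_norm (4/3) (heat s (U t - U (t + h))) \<le> ennreal (E t h * s powr (-1/4))"
      proof (intro allI impI)
        fix s :: real assume s: "0 < s"
        have e: "heat s (U t - U (t + h)) = (\<lambda>\<psi>. heat s (U t) \<psi> - heat s (U (t + h)) \<psi>)"
          by (auto simp: heat_eq fun_eq_iff)
        note r = represents_minus[OF hrep[OF s t] hrep[OF s th]]
        have "\<bar>heat s (U t) \<psi> - heat s (U (t + h)) \<psi>\<bar> \<le> E t h * s powr (-1/4) * norm4 \<psi>" if \<psi>: "\<psi> \<in>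
            schwartz" for \<psi>
          using heat_orbit_time_diff[OF M t h s \<psi>] duhamel_heat_time_diff[OF adm t h s \<psi>]
          unfolding hU[OF s t \<psi>] hU[OF s th \<psi>] E_def distrib_right by linarith
        from represents_L43[OF r _ this] E0[OF t h]
        show "Lp_norm (4/3) (heat s (U t - U (t + h))) \<le> ennreal (E t h * s powr (-1/4))"
          unfolding e using r by (subst Lp_norm_le_iff) auto
      qed
    qed (rule E0[OF t h])
  qed
  have init: "((\<lambda>t. U t \<psi>) \<longlongrightarrow> u0 \<psi>) (at_right 0)" if \<psi>: "\<psi> \<in> schwartz" for \<psi>
  proof (rule Lim_transform_eventually)
    have "u0 \<in> tempered" using u0 by (simp add: BX_def)
    from tendsto_add[OF heat_tendsto[OF this \<psi>] duhamel_initial[OF adm \<psi>]]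
    show "((\<lambda>t. heat t u0 \<psi> + duhamel F t \<psi>) \<longlongrightarrow> u0 \<psi>) (at_right 0)" by simp
    show "\<forall>\<^sub>F t in at_right 0. heat t u0 \<psi> + duhamel F t \<psi> = U t \<psi>"
      using eventually_at_right_less[of "0::real"] by eventually_elim (simp add: Ueq \<psi>)
  qed
  have Lp: "Lp_norm (4/3) (U t) \<le> ennreal (A * t powr (-1/4))" if "0 < t" for t
    using Lp_norm_le_represents[OF rep[OF that]] u(2)[OF that] A by simp
  then have wn: "weighted_norm U \<le> ennreal A" using A by (simp add: weighted_norm_le_iff)
  have "(SUP t\<in>{0<..}. BX_norm (U t)) \<le> ennreal (M + B)" by (rule SUP_least) (use BXb in auto)
  then have "X_norm U < \<infinity>" using wn by (auto simp: X_norm_def le_less_trans)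
  moreover have "Lp_norm (4/3) (U t) < \<infinity>" if "0 < t" for t using Lp[OF that] by (simp add: le_less_trans)
  ultimately have "U \<in> X_space u0" using UBX meas init by (simp add: X_space_def)
  moreover have "mild_solution u0 U"
    unfolding mild_solution_def
  proof (intro allI impI ballI)
    fix t :: real and \<psi> assume t: "0 < t" and \<psi>: "\<psi> \<in> schwartz"
    have e: "(\<lambda>\<tau>. indicator {0<..<t} \<tau> *\<^sub>R heat (t - \<tau>) (debye_nonlin (U \<tau>)) \<psi>) =
        (\<lambda>\<tau>. indicator {0<..<t} \<tau> * heat (t - \<tau>) (div_distr (F \<tau>)) \<psi>)"
      by (auto simp: fun_eq_iff indicator_def nonlin)
    have i: "integrable lborel (\<lambda>\<tau>. indicator {0<..<t} \<tau> * heat (t - \<tau>) (div_distr (F \<tau>)) \<psi>)"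
      by (rule duhamel_represents(2)[OF adm t \<psi>])
    show "set_integrable lebesgue {0<..<t} (\<lambda>\<tau>. heat (t - \<tau>) (debye_nonlin (U \<tau>)) \<psi>) \<and>
      U t \<psi> = heat t u0 \<psi> + (LINT \<tau>:{0<..<t}|lebesgue. heat (t - \<tau>) (debye_nonlin (U \<tau>)) \<psi>)"
      unfolding set_integrable_def set_lebesgue_integral_def e
      using i borel_measurable_integrable[OF i] Ueq[OF t \<psi>] \<psi>
      by (simp add: integrable_completion integral_completion duhamel_def)
  qed
  ultimately show ?thesis using wn rep u(2) by blast
qed

text \<open>Any bound D on the weighted difference improves to D/2, because the Lipschitz constant 2
  kappa B is at most 1/2. Starting from 2B, iteration forces the pairings of the difference to
  vanish.\<close>

lemma mild_solution_unique:
  assumes B: "0 < B" "4 * contraction_const * B \<le> 1"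
    and U: "mild_solution u0 U" "\<And>t. 0 < t \<Longrightarrow> represents (u t) (U t)" "\<And>t. 0 < t \<Longrightarrow> L43 (u t)
        (B * t powr (-1/4))"
    and V: "mild_solution u0 V" "\<And>t. 0 < t \<Longrightarrow> represents (v t) (V t)" "\<And>t. 0 < t \<Longrightarrow> L43 (v t)
        (B * t powr (-1/4))"
    and t: "0 < t" and \<psi>: "\<psi> \<in> schwartz"
  shows "V t \<psi> = U t \<psi>"
proof -
  have halve: "L43 (\<lambda>x. u t x - v t x) (D / 2 * t powr (-1/4))"
    if D: "\<And>t. 0 < t \<Longrightarrow> L43 (\<lambda>x. u t x - v t x) (D * t powr (-1/4))" "0 < D" and t: "0 < t" for D t
  proof (rule represents_L43[OF represents_minus[OF U(2)[OF t] V(2)[OF t]]])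
    fix \<psi> assume \<psi>: "\<psi> \<in> schwartz"
    let ?HU = "\<lambda>\<tau>. indicator {0<..<t} \<tau> *\<^sub>R heat (t - \<tau>) (debye_nonlin (U \<tau>)) \<psi>"
    let ?HV = "\<lambda>\<tau>. indicator {0<..<t} \<tau> *\<^sub>R heat (t - \<tau>) (debye_nonlin (V \<tau>)) \<psi>"
    have iU: "integrable lebesgue ?HU" "U t \<psi> = heat t u0 \<psi> + integral\<^sup>L lebesgue ?HU"
      using U(1) t \<psi> unfolding mild_solution_def set_integrable_def set_lebesgue_integral_def by auto
    have iV: "integrable lebesgue ?HV" "V t \<psi> = heat t u0 \<psi> + integral\<^sup>L lebesgue ?HV"
      using V(1) t \<psi> unfolding mild_solution_def set_integrable_def set_lebesgue_integral_def by auto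
    have "\<bar>LINT \<tau>|lebesgue. ?HU \<tau> - ?HV \<tau>\<bar> \<le> (2 * nl_const * B * D * grad_const * norm4 \<psi>) *
        (Beta (1/4) (1/2) * t powr (1/4 + 1/2 - 1))"
    proof (rule weighted_time_bound(1))
      fix \<tau> assume \<tau>: "0 < \<tau>" "\<tau> < t"
      have L: "L1_bounded (nl (u \<tau>)) (nl_const * B * B * \<tau> powr (-1/2))" "L1_bounded (nl (v \<tau>))
          (nl_const * B * B * \<tau> powr (-1/2))"
        by (rule L1_bounded_nl[OF U(3)[OF \<tau>(1)] B(1) \<tau>(1)], rule L1_bounded_nl[OF V(3)[OF \<tau>(1)] B(1) \<tau>(1)])
      have Ld: "L1_bounded (\<lambda>x. nl (u \<tau>) x - nl (v \<tau>) x) (2 * nl_const * B * D * \<tau> powr (-1/2))"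
        using \<tau> B D by (intro L1_bounded_nl_diff U V) auto
      have "?HU \<tau> - ?HV \<tau> = heat (t - \<tau>) (div_distr (\<lambda>x. nl (u \<tau>) x - nl (v \<tau>) x)) \<psi>"
        using \<tau> heat_div_minus[OF L _ \<psi>, of "t - \<tau>"]
        by (simp add: debye_nonlin_represents[OF U(2)] debye_nonlin_represents[OF V(2)])
      also have "\<bar>\<dots>\<bar> \<le> (2 * nl_const * B * D * \<tau> powr (-1/2)) *
          (grad_const * (t - \<tau>) powr (-3/4) * norm4 \<psi>)"
        using \<tau> by (intro heat_div_bound[OF Ld _ \<psi>]) auto
      finally show "\<bar>?HU \<tau> - ?HV \<tau>\<bar> \<le> (2 * nl_const * B * D * grad_const * norm4 \<psi>) *
          ((t - \<tau>) powr (1/4 - 1) * \<tau> powr (1/2 - 1))"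
        by (simp add: mult_ac)
    qed (use t B D nl_const_pos grad_const_pos norm4_nonneg in auto)
    moreover have "U t \<psi> - V t \<psi> = (LINT \<tau>|lebesgue. ?HU \<tau> - ?HV \<tau>)"
      using iU iV by simp
    ultimately have "\<bar>U t \<psi> - V t \<psi>\<bar> \<le> (2 * nl_const * B * D * grad_const * norm4 \<psi>) *
        (Beta (1/4) (1/2) * t powr (1/4 + 1/2 - 1))"
      by simp
    also have "\<dots> = (2 * contraction_const * B) * D * t powr (-1/4) * norm4 \<psi>"
      by (simp add: contraction_const_def duhamel_const_def)
    also have "\<dots> \<le> (1/2) * D * t powr (-1/4) * norm4 \<psi>"
      using B D by (intro mult_right_mono norm4_nonneg) auto
    finally show "\<bar>U t \<psi> - V t \<psi>\<bar> \<le> D / 2 * t powr (-1/4) * norm4 \<psi>" by simp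
  qed (use D in auto)
  have D: "L43 (\<lambda>x. u t x - v t x) (((1/2) ^ n * (2 * B)) * t powr (-1/4))" if "0 < t" for n t
    using that
  proof (induction n arbitrary: t)
    case 0
    from L43_diff[OF U(3)[OF 0] V(3)[OF 0]] show ?case by (simp add: algebra_simps)
  next
    case (Suc n)
    from halve[OF Suc.IH _ Suc.prems] B show ?case by simp
  qed
  have "\<bar>U t \<psi> - V t \<psi>\<bar> \<le> (1/2) ^ n * (2 * B * t powr (-1/4) * norm4 \<psi>)" for n
    using Holder_integrable(2)[OF D[OF t, of n] L4_schwartz[OF \<psi>]]
      representsD(3)[OF represents_minus[OF U(2)[OF t] V(2)[OF t]] \<psi>] by (simp add: mult_ac)
  moreover have "(\<lambda>n. (1/2) ^ n * (2 * B * t powr (-1/4) * norm4 \<psi>)) \<longlonglongrightarrow> 0"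
    by (intro tendsto_mult_left_zero LIMSEQ_realpow_zero) auto
  ultimately have "\<bar>U t \<psi> - V t \<psi>\<bar> \<le> 0" by (intro LIMSEQ_le_const) auto
  then show ?thesis by simp
qed

theorem theorem2p2:
  shows "\<exists>\<epsilon>::real. \<epsilon> > 0 \<and>
    (\<forall>u0\<in>BX. BX_norm u0 < ennreal \<epsilon> \<longrightarrow>
      (\<exists>u\<in>X_space u0. mild_solution u0 u \<and> weighted_norm u < ennreal (2 * \<epsilon>) \<and>
        (\<forall>v\<in>X_space u0. mild_solution u0 v \<and> weighted_norm v < ennreal (2 * \<epsilon>)
           \<longrightarrow> (\<forall>t>0. v t = u t))))"
proof -
  \<comment> \<open>Chosen so that B = 2 \<open>\<epsilon>\<close> meets the contraction condition 4
    kappa B \<le> 1 with equality; uniqueness then holds on the whole ball of the claim.\<close>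
  define \<epsilon> where "\<epsilon> = 1 / (8 * contraction_const)"
  have \<epsilon>: "0 < \<epsilon>" "contraction_const * \<epsilon> = 1/8" using contraction_const_pos by (auto simp: \<epsilon>_def)
  show ?thesis
  proof (intro exI[of _ \<epsilon>] conjI ballI impI \<epsilon>(1))
    fix u0 assume u0: "u0 \<in> BX" "BX_norm u0 < ennreal \<epsilon>"
    define M where "M = enn2real (BX_norm u0)"
    have M: "BX_norm u0 = ennreal M" "0 \<le> M" "M < \<epsilon>"
      using u0 \<epsilon> by (auto simp: M_def BX_def ennreal_enn2real_if enn2real_less_iff)
    \<comment> \<open>The radius must exceed M by at least kappa A^2 and stay strictly below 2
      \<open>\<epsilon>\<close>. The addition of \<open>\<epsilon>\<close>/2 achieves both, as kappa
      A^2 \<le> 9/32 \<open>\<epsilon>\<close>, and keeps A positive even for the zero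
      datum.\<close>
    define A where "A = M + \<epsilon> / 2"
    have A: "0 < A" "A \<le> 3/2 * \<epsilon>" "A < 2 * \<epsilon>" using M \<epsilon> by (auto simp: A_def)
    have kA: "contraction_const * A \<le> 3/16"
    proof -
      have "contraction_const * A \<le> contraction_const * (3/2 * \<epsilon>)"
        using A contraction_const_pos by (intro mult_left_mono) auto
      also have "\<dots> = 3/2 * (contraction_const * \<epsilon>)" by simp
      finally show ?thesis using \<epsilon>(2) by simp
    qed
    have "contraction_const * A * A \<le> 3/16 * (3/2 * \<epsilon>)"
      using kA A \<epsilon> by (intro mult_mono) auto
    then have "M + contraction_const * A * A \<le> A" using \<epsilon> by (simp add: A_def)
    moreover have "4 * contraction_const * A \<le> 1" using kA unfolding mult.assoc by linarith
    moreover have "BX_norm u0 \<le> ennreal M" by (simp add: M)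
    ultimately obtain U u where U: "U \<in> X_space u0" "mild_solution u0 U" "weighted_norm U \<le> ennreal A"
      and u: "\<And>t. 0 < t \<Longrightarrow> represents (u t) (U t)" "\<And>t. 0 < t \<Longrightarrow> L43 (u t) (A * t powr (-1/4))"
      using mild_solution_exists[OF u0(1) M(2) _ A(1)] by blast
    have u2: "L43 (u t) (2 * \<epsilon> * t powr (-1/4))" if "0 < t" for t
      using A that by (intro L43_mono[OF u(2)] mult_right_mono) auto
    show "\<exists>u\<in>X_space u0. mild_solution u0 u \<and> weighted_norm u < ennreal (2 * \<epsilon>) \<and>
        (\<forall>v\<in>X_space u0. mild_solution u0 v \<and> weighted_norm v < ennreal (2 * \<epsilon>) \<longrightarrow> (\<forall>t>0. v t = u t))"
    proof (intro bexI[OF _ U(1)] conjI ballI impI allI U(2))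
      show "weighted_norm U < ennreal (2 * \<epsilon>)"
        using U(3) A by (auto intro: le_less_trans simp: ennreal_less_iff)
      fix V t assume V: "V \<in> X_space u0" "mild_solution u0 V \<and> weighted_norm V < ennreal (2 * \<epsilon>)" and t: "0
          < (t::real)"
      have "weighted_norm V \<le> ennreal (2 * \<epsilon>)" using V(2) by (auto intro: less_imp_le)
      then have "\<exists>g. represents g (V t) \<and> L43 g (2 * \<epsilon> * t powr (-1/4))" if "0 < t" for t
        using \<epsilon> that by (auto simp: weighted_norm_le_iff Lp_norm_le_iff)
      then obtain v where v: "\<And>t. 0 < t \<Longrightarrow> represents (v t) (V t)" "\<And>t. 0 < t \<Longrightarrow> L43 (v t)
          (2 * \<epsilon> * t powr (-1/4))"
        by metis
      \<comment> \<open>Equality of distributions is equality at every function; outside the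
        Schwartz space both sides vanish by the convention in \<open>tempered\<close>.\<close>
      have out: "W \<psi> = 0" if "W \<in> BX" "\<psi> \<notin> schwartz" for W \<psi>
        using that unfolding BX_def tempered_def by blast
      have BX: "U t \<in> BX" "V t \<in> BX" using U(1) V(1) t by (auto simp: X_space_def)
      show "V t = U t"
      proof
        fix \<psi>
        show "V t \<psi> = U t \<psi>"
        proof (cases "\<psi> \<in> schwartz")
          case True
          show ?thesis
            by (rule mild_solution_unique[where B = "2 * \<epsilon>", OF _ _ U(2) u(1) u2 _ v t True])
              (use \<epsilon> V(2) in auto)
        qed (simp add: out[OF BX(1)] out[OF BX(2)])
      qed
    qed
  qed
qed

end
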